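(* Let $\kappa,N$ be relatively prime integers with $0<\kappa<N$, let $k,k'$ be integers with $0<k<N$, $0<k'<N$, $\kappa k\equiv -1 \pmod N$, $\kappa k'\equiv 2\pmod N$, and let $n>1$ and $1\le l\le n$ be integers. Let $U(t,z)$, $t=(t_1,\dots,t_l)$, $z=(z_1,\dots,z_n)$, be the $V^{\otimes n}[n-2l]$-valued polynomial $U(t,z)=\sum_{I\in\mathcal I_l}U_I(t,z)\,v_I$ defined in the context. For any sequence $r=(r_1,\dots,r_l)$ of non-negative integers put $f_r(z)=\{U(t,z)\}_r^{t_1,\dots,t_l}$ (the difference $r$-integral, taken coordinatewise). Then $f_r(z)$ is a polynomial in $z_1,\dots,z_n$ (with values in $V^{\otimes n}[n-2l]$, whose coordinates in the basis $v_I$ lie in $\mathbb Z[z_1,\dots,z_n]$) which solves the symmetric qKZ equations modulo $N$: $$f_r(z_1,\dots,z_{a+1},z_a,\dots,z_n)\equiv P^{(a,a+1)}R^{(a,a+1)}(z_a-z_{a+1})\,f_r(z)\pmod N,\qquad a=1,\dots,n-1,$$ $$f_r(z_1-\kappa,z_2,\dots,z_n)\equiv P^{(\mu)}f_r(z_2,\dots,z_n,z_1)\pmod N .$$ Moreover $f_r(z)$ is singular modulo $N$: $e\,f_r(z)\equiv 0\pmod N$.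
   Context: **Representation.** $\mathfrak{sl}_2$ has basis $e,f,h$ with $[e,f]=h$, $[h,e]=2e$, $[h,f]=-2f$. $V$ is the two-dimensional module with basis $v_1,v_2$ and $ev_1=0$, $ev_2=v_1$, $fv_1=v_2$, $fv_2=0$, $hv_1=v_1$, $hv_2=-v_2$. $\mathfrak{sl}_2$ acts on $V^{\otimes n}$ in the usual (diagonal) way; $V^{\otimes n}[n-2l]$ is the eigenspace of $h$ with eigenvalue $n-2l$. $\mathcal I_l$ is the set of $l$-element subsets of $\{1,\dots,n\}$; for $I\in\mathcal I_l$, $v_I=v_{i_1}\otimes\dots\otimes v_{i_n}$ with $i_j=2$ if $j\in I$ and $i_j=1$ if $j\notin I$. The $v_I$, $I\in\mathcal I_l$, form a basis of $V^{\otimes n}[n-2l]$. **Operators.** $P^{(a,b)}$ permutes the $a$-th and $b$-th factors of $V^{\otimes n}$; $R^{(a,b)}(u)=\dfrac{u-P^{(a,b)}}{u-1}$; $P^{(\mu)}=P^{(1,2)}P^{(2,3)}\cdots P^{(n-1,n)}$. **Congruences.** A congruence modulo $N$ between vector-valued polynomials with integer coordinates in the basis $v_I$ means that all coefficients of all coordinates are congruent modulo $N$. The congruences involving $R^{(a,a+1)}(z_a-z_{a+1})$ are understood after multiplying by the denominator $z_a-z_{a+1}-1$, i.e. as $(z_a-z_{a+1}-1)f_r(z_1,\dots,z_{a+1},z_a,\dots,z_n)\equiv P^{(a,a+1)}\big(z_a-z_{a+1}-P^{(a,a+1)}\big)f_r(z)\pmod N$. **Pochhammer polynomials.** $[x]_m=\prod_{i=1}^m(x-(i-1)\kappa)$,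 $[x]_0=1$. **Master polynomial.** $\Phi(t,z)=\prod_{a=1}^n\prod_{i=1}^l[t_i-z_a]_k\prod_{1\le i<j\le l}[t_i-t_j+1]_{k'}$. **Weight function.** For $\tau\in S_l$ and a function $g(t_1,\dots,t_l)$ put $$(\tau g)(t_1,\dots,t_l)=g(t_{\tau(1)},\dots,t_{\tau(l)})\prod_{i<j,\ \tau^{-1}(i)>\tau^{-1}(j)}\frac{t_i-t_j+1-\kappa k'}{t_i-t_j+1}.$$ For $I=\{a_1<\dots<a_l\}\in\mathcal I_l$ put $$w_I^\tau(t,z)=\tau\left(\prod_{i=1}^l\frac1{t_i-z_{a_i}}\prod_{j=1}^{a_i-1}\frac{t_i-z_j-\kappa k}{t_i-z_j}\right),\qquad w_I=\sum_{\tau\in S_l}w_I^\tau,\qquad U_I(t,z)=\Phi(t,z)\,w_I(t,z).$$ Each $U_I$ is a polynomial with integer coefficients in $t,z$, and $U(t,z)=\sum_{I\in\mathcal I_l}U_I(t,z)v_I$. **Difference $r$-integral.** For $r=(r_1,\dots,r_l)\in\mathbb Z_{\ge0}^l$ let $N_r$ be the least positive integer with $N_r(r_i+1)\equiv0\pmod N$ for all $i=1,\dots,l$. The products $\prod_{i=1}^l[t_i]_{m_i}$, $m\in\mathbb Z_{\ge0}^l$, form a $\mathbb Z[z]$-basis of $\mathbb Z[z][t_1,\dots,t_l]$. If $g=\sum_m c_m(z)\prod_{i=1}^l[t_i]_{m_i}$, then $\{g\}_r^{t_1,\dots,t_l}=N_r\,c_r(z)\in\mathbb Z[z]$. *)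

theory Defs
  imports
    "HOL-Library.Poly_Mapping"
    "HOL-Library.FuncSet"
    "HOL-Combinatorics.Permutations"
    "HOL-Computational_Algebra.Polynomial_Factorial"
    "HOL-Number_Theory.Cong"
begin

section \<open>Multivariate polynomials\<close>

text \<open>
  A polynomial is a finitely supported function from monomials to coefficients, and a monomial is
  a finitely supported function from variable indices to exponents; the multiplication of
  \<^typ>\<open>('b \<Rightarrow>\<^sub>0 'a)\<close> is convolution.  The type \<open>zpoly\<close> stands for \<open>\<int>[z\<^sub>1, z\<^sub>2, \<dots>]\<close>, and \<open>tzpoly\<close> for
  \<open>\<int>[z\<^sub>1, z\<^sub>2, \<dots>][t\<^sub>1, t\<^sub>2, \<dots>]\<close>.
\<close>

type_synonym 'a mpoly = "(nat \<Rightarrow>\<^sub>0 nat) \<Rightarrow>\<^sub>0 'a"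
type_synonym zpoly = "int mpoly"
type_synonym tzpoly = "zpoly mpoly"

definition Const :: "'a::zero \<Rightarrow> 'a mpoly" where
  "Const c = Poly_Mapping.single 0 c"

definition Var :: "nat \<Rightarrow> 'a::zero_neq_one mpoly" where
  "Var i = Poly_Mapping.single (Poly_Mapping.single i 1) 1"

definition vars :: "'a::zero mpoly \<Rightarrow> nat set" where
  "vars p = (\<Union>m\<in>Poly_Mapping.keys p. Poly_Mapping.keys m)"

text \<open>\<open>mpoly_subst \<rho> p\<close> replaces each variable \<open>z\<^sub>i\<close> of \<open>p\<close> by the polynomial \<open>\<rho> i\<close>.\<close>

definition mpoly_subst :: "(nat \<Rightarrow> 'a mpoly) \<Rightarrow> 'a::comm_semiring_1 mpoly \<Rightarrow> 'a mpoly" where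
  "mpoly_subst \<rho> p = (\<Sum>m\<in>Poly_Mapping.keys p. Const (Poly_Mapping.lookup p m) *
     (\<Prod>i\<in>Poly_Mapping.keys m. \<rho> i ^ Poly_Mapping.lookup m i))"


section \<open>The tensor power of the two-dimensional representation\<close>

text \<open>
  An element of \<open>V\<^sup>\<otimes>\<^sup>n\<close> with scalars extended to a commutative ring is given by its coordinates in the
  basis \<open>v_i = v\<^bsub>i 1\<^esub> \<otimes> \<dots> \<otimes> v\<^bsub>i n\<^esub>\<close>, where \<open>i\<close> runs through the words \<open>i : {1..n} \<rightarrow> {1,2}\<close>.
\<close>

definition words :: "nat \<Rightarrow> (nat \<Rightarrow> nat) set" where
  "words n = {1..n} \<rightarrow>\<^sub>E {1, 2}"

type_synonym 'a tensor = "(nat \<Rightarrow> nat) \<Rightarrow> 'a"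

definition tensor_power :: "nat \<Rightarrow> 'a::comm_ring_1 tensor set" where
  "tensor_power n = {F. \<forall>i. i \<notin> words n \<longrightarrow> F i = 0}"

text \<open>The vector \<open>v_I\<close>.\<close>

definition subset_word :: "nat \<Rightarrow> nat set \<Rightarrow> nat \<Rightarrow> nat" where
  "subset_word n I = (\<lambda>j\<in>{1..n}. if j \<in> I then 2 else 1)"

definition basis_vec :: "nat \<Rightarrow> nat set \<Rightarrow> 'a::comm_ring_1 tensor" where
  "basis_vec n I = (\<lambda>i. if i = subset_word n I then 1 else 0)"

text \<open>
  Operators on \<open>V\<close> are given by matrices: \<open>A p q\<close> is the coefficient of \<open>v\<^sub>p\<close> in \<open>A v\<^sub>q\<close>.
\<close>

definition e_mat :: "nat \<Rightarrow> nat \<Rightarrow> 'a::comm_ring_1" where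
  "e_mat p q = (if p = 1 \<and> q = 2 then 1 else 0)"

definition h_mat :: "nat \<Rightarrow> nat \<Rightarrow> 'a::comm_ring_1" where
  "h_mat p q = (if p = 1 \<and> q = 1 then 1 else if p = 2 \<and> q = 2 then - 1 else 0)"

text \<open>
  \<open>act_at A j\<close> is \<open>1 \<otimes> \<dots> \<otimes> A \<otimes> \<dots> \<otimes> 1\<close> with \<open>A\<close> in the \<open>j\<close>-th place, and \<open>act n A\<close> is the sum of
  these over all places.
\<close>

definition act_at :: "(nat \<Rightarrow> nat \<Rightarrow> 'a) \<Rightarrow> nat \<Rightarrow> 'a::comm_ring_1 tensor \<Rightarrow> 'a tensor" where
  "act_at A j F = (\<lambda>i. \<Sum>q\<in>{1, 2}. A (i j) q * F (i(j := q)))"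

definition act :: "nat \<Rightarrow> (nat \<Rightarrow> nat \<Rightarrow> 'a) \<Rightarrow> 'a::comm_ring_1 tensor \<Rightarrow> 'a tensor" where
  "act n A F = (\<lambda>i. \<Sum>j=1..n. act_at A j F i)"

definition weight_space :: "nat \<Rightarrow> int \<Rightarrow> 'a::comm_ring_1 tensor set" where
  "weight_space n w = {F \<in> tensor_power n. act n h_mat F = (\<lambda>i. of_int w * F i)}"

definition P_op :: "nat \<Rightarrow> nat \<Rightarrow> 'a::comm_ring_1 tensor \<Rightarrow> 'a tensor" where
  "P_op a b F = (\<lambda>i. F (i \<circ> transpose a b))"

text \<open>\<open>P\<^sup>(\<^sup>\<mu>\<^sup>) = P\<^sup>(\<^sup>1\<^sup>,\<^sup>2\<^sup>) P\<^sup>(\<^sup>2\<^sup>,\<^sup>3\<^sup>) \<dots> P\<^sup>(\<^sup>n\<^sup>-\<^sup>1\<^sup>,\<^sup>n\<^sup>)\<close>, so \<open>P\<^sup>(\<^sup>n\<^sup>-\<^sup>1\<^sup>,\<^sup>n\<^sup>)\<close> is applied first.\<close>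

definition P_mu :: "nat \<Rightarrow> 'a::comm_ring_1 tensor \<Rightarrow> 'a tensor" where
  "P_mu n = foldr (\<lambda>a. (\<circ>) (P_op a (a + 1))) [1..<n] id"

text \<open>
  The rational \<open>R\<close>-matrix is \<open>R\<^sup>(\<^sup>a\<^sup>,\<^sup>b\<^sup>)(u) = (u - P\<^sup>(\<^sup>a\<^sup>,\<^sup>b\<^sup>)) / (u - 1)\<close>.  Congruences involving it are
  understood after multiplication by \<open>u - 1\<close>, so only the operator \<open>(u - 1) R\<^sup>(\<^sup>a\<^sup>,\<^sup>b\<^sup>)(u)\<close> is needed.
\<close>

definition R_num :: "nat \<Rightarrow> nat \<Rightarrow> 'a \<Rightarrow> 'a::comm_ring_1 tensor \<Rightarrow> 'a tensor" where
  "R_num a b u F = (\<lambda>i. u * F i - P_op a b F i)"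

definition tensor_subst :: "(nat \<Rightarrow> zpoly) \<Rightarrow> zpoly tensor \<Rightarrow> zpoly tensor" where
  "tensor_subst \<rho> F = (\<lambda>i. mpoly_subst \<rho> (F i))"

definition tensor_cong :: "nat \<Rightarrow> int \<Rightarrow> zpoly tensor \<Rightarrow> zpoly tensor \<Rightarrow> bool" where
  "tensor_cong n N F G \<longleftrightarrow> (\<forall>i\<in>words n. \<forall>m.
     [Poly_Mapping.lookup (F i) m = Poly_Mapping.lookup (G i) m] (mod N))"


section \<open>Master polynomial and weight functions\<close>

definition poch :: "int \<Rightarrow> 'a::comm_ring_1 \<Rightarrow> nat \<Rightarrow> 'a" where
  "poch \<kappa> x m = (\<Prod>i=1..m. x - of_int ((int i - 1) * \<kappa>))"

definition master ::
    "int \<Rightarrow> nat \<Rightarrow> nat \<Rightarrow> nat \<Rightarrow> nat \<Rightarrow> (nat \<Rightarrow> 'a) \<Rightarrow> (nat \<Rightarrow> 'a) \<Rightarrow> 'a::comm_ring_1" where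
  "master \<kappa> k k' n l t z =
     (\<Prod>a=1..n. \<Prod>i=1..l. poch \<kappa> (t i - z a) k) *
     (\<Prod>(i, j)\<in>{(i, j). 1 \<le> i \<and> i < j \<and> j \<le> l}. poch \<kappa> (t i - t j + 1) k')"

text \<open>
  Rational functions are written as functions of a point of a field, and are evaluated in \<open>U_poly\<close>
  below at the generic point, in the field of fractions of the polynomial ring.
\<close>

definition perm_act ::
    "int \<Rightarrow> nat \<Rightarrow> nat \<Rightarrow> (nat \<Rightarrow> nat) \<Rightarrow> ((nat \<Rightarrow> 'a) \<Rightarrow> 'a) \<Rightarrow> (nat \<Rightarrow> 'a) \<Rightarrow> 'a::field" where
  "perm_act \<kappa> k' l \<tau> g t = g (\<lambda>i. t (\<tau> i)) *
     (\<Prod>(i, j)\<in>{(i, j). 1 \<le> i \<and> i < j \<and> j \<le> l \<and> inv \<tau> i > inv \<tau> j}.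
        (t i - t j + 1 - of_int (\<kappa> * int k')) / (t i - t j + 1))"

text \<open>The \<open>i\<close>-th smallest element \<open>a\<^sub>i\<close> of \<open>I\<close>, counted from 1.\<close>

definition nth_elem :: "nat set \<Rightarrow> nat \<Rightarrow> nat" where
  "nth_elem I i = sorted_list_of_set I ! (i - 1)"

definition weight_fun_perm ::
    "int \<Rightarrow> nat \<Rightarrow> nat \<Rightarrow> nat \<Rightarrow> nat set \<Rightarrow> (nat \<Rightarrow> nat) \<Rightarrow>
     (nat \<Rightarrow> 'a) \<Rightarrow> (nat \<Rightarrow> 'a) \<Rightarrow> 'a::field" where
  "weight_fun_perm \<kappa> k k' l I \<tau> t z = perm_act \<kappa> k' l \<tau>
     (\<lambda>s. \<Prod>i=1..l. 1 / (s i - z (nth_elem I i)) *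
        (\<Prod>j=1..nth_elem I i - 1. (s i - z j - of_int (\<kappa> * int k)) / (s i - z j))) t"

definition weight_fun ::
    "int \<Rightarrow> nat \<Rightarrow> nat \<Rightarrow> nat \<Rightarrow> nat set \<Rightarrow> (nat \<Rightarrow> 'a) \<Rightarrow> (nat \<Rightarrow> 'a) \<Rightarrow> 'a::field" where
  "weight_fun \<kappa> k k' l I t z =
     (\<Sum>\<tau> | \<tau> permutes {1..l}. weight_fun_perm \<kappa> k k' l I \<tau> t z)"

abbreviation t_var :: "nat \<Rightarrow> tzpoly" where
  "t_var i \<equiv> Var i"

abbreviation z_var :: "nat \<Rightarrow> tzpoly" where
  "z_var a \<equiv> Const (Var a)"

text \<open>
  The embedding \<open>to_fract\<close> is injective, so \<open>U_I = \<Phi> w_I\<close> is determined by its image in the field of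
  fractions; it exists since \<open>\<Phi>\<close> cancels all denominators of \<open>w_I\<close> when \<open>k\<close> and \<open>k'\<close> are positive.
\<close>

definition U_poly :: "int \<Rightarrow> nat \<Rightarrow> nat \<Rightarrow> nat \<Rightarrow> nat \<Rightarrow> nat set \<Rightarrow> tzpoly" where
  "U_poly \<kappa> k k' n l I = (THE u. to_fract u =
     to_fract (master \<kappa> k k' n l t_var z_var) *
     weight_fun \<kappa> k k' l I (\<lambda>i. to_fract (t_var i)) (\<lambda>a. to_fract (z_var a)))"

definition l_subsets :: "nat \<Rightarrow> nat \<Rightarrow> nat set set" where
  "l_subsets n l = {I. I \<subseteq> {1..n} \<and> card I = l}"

definition U_vec :: "int \<Rightarrow> nat \<Rightarrow> nat \<Rightarrow> nat \<Rightarrow> nat \<Rightarrow> tzpoly tensor" where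
  "U_vec \<kappa> k k' n l = (\<lambda>i. \<Sum>I\<in>l_subsets n l. U_poly \<kappa> k k' n l I * basis_vec n I i)"


section \<open>The difference \<open>r\<close>-integral\<close>

definition N_r :: "int \<Rightarrow> nat \<Rightarrow> (nat \<Rightarrow> nat) \<Rightarrow> nat" where
  "N_r N l r = (LEAST M. 0 < M \<and> (\<forall>i\<in>{1..l}. [int M * (int (r i) + 1) = 0] (mod N)))"

text \<open>
  The coefficients \<open>c\<^sub>m(z)\<close> of \<open>g\<close> in the basis \<open>\<Prod>\<^sub>i [t\<^sub>i]\<^bsub>m i\<^esub>\<close>, where \<open>m\<close> runs through the sequences
  \<open>(m\<^sub>1, \<dots>, m\<^sub>l)\<close>, encoded as functions extensional on \<open>{1..l}\<close>.
\<close>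

definition poch_coeffs :: "int \<Rightarrow> nat \<Rightarrow> tzpoly \<Rightarrow> (nat \<Rightarrow> nat) \<Rightarrow> zpoly" where
  "poch_coeffs \<kappa> l g = (THE c. finite {m. c m \<noteq> 0} \<and> {m. c m \<noteq> 0} \<subseteq> {1..l} \<rightarrow>\<^sub>E UNIV \<and>
     g = (\<Sum>m | c m \<noteq> 0. Const (c m) * (\<Prod>i=1..l. poch \<kappa> (t_var i) (m i))))"

definition diff_integral :: "int \<Rightarrow> int \<Rightarrow> nat \<Rightarrow> (nat \<Rightarrow> nat) \<Rightarrow> tzpoly \<Rightarrow> zpoly" where
  "diff_integral \<kappa> N l r g = of_nat (N_r N l r) * poch_coeffs \<kappa> l g (restrict r {1..l})"

definition f_sol ::
    "int \<Rightarrow> int \<Rightarrow> nat \<Rightarrow> nat \<Rightarrow> nat \<Rightarrow> nat \<Rightarrow> (nat \<Rightarrow> nat) \<Rightarrow> zpoly tensor" where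
  "f_sol \<kappa> N k k' n l r = (\<lambda>i. diff_integral \<kappa> N l r (U_vec \<kappa> k k' n l i))"

end

theory Submission
  imports Defs
begin

text \<open>
  The polynomial \<open>U_I\<close> is a sum over the bijections of the variables \<open>t\<^sub>1, \<dots>, t\<^sub>l\<close> onto \<open>I\<close>. Modulo \<open>N\<close>,
  a factor symmetric in \<open>z\<^sub>1, \<dots>, z\<^sub>n\<close> splits off from all summands, because \<open>\<kappa> k\<close> and \<open>\<kappa> k'\<close> become
  \<open>-1\<close> and \<open>2\<close>, and the first qKZ equation is an identity between the remaining factors.
  In the second equation the summands on both sides agree up to the shift by \<open>\<kappa>\<close> of the variable at
  the first site. For the singular vector property, the sum is taken over the positions
  of one free variable; it telescopes, up to terms that cancel in pairs, to the difference between the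
  two extreme positions, and these two differ again by a shift of the free variable by \<open>\<kappa>\<close>.
  Difference integrals modulo \<open>N\<close> are invariant under such shifts.
\<close>


section \<open>Homomorphisms out of polynomial rings\<close>

text \<open>The rational factors of a weight function merely shift or shorten Pochhammer products:
  [x]_k (x - \<kappa> k) / x = [x - \<kappa>]_k and [x]_k / x = [x - \<kappa>]_(k-1). So each
  summand of \<open>U_I\<close> is a product of Pochhammer polynomials whose shape depends only on
  how the positions of the variables and sites compare. Two kinds of identities must be combined.
  Moving a variable from the lowest to the highest position is an exact shift by \<kappa>, but for
  the full terms; the exchange relation and the telescoping are identities of the reduced terms,
  which represent the full ones only modulo \<open>N\<close> and up to the common factor. The
  singular vector property therefore passes to reduced terms and back. The cancellations in pairs
  show that twice a sum vanishes. As \<open>N\<close> may be even, they are carried out exactly in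
  characteristic 0, and only the result is multiplied by the common factor. Shifts are harmless
  after integration because [t + \<kappa>]_m - [t]_m = m \<kappa> [t]_(m-1): the coefficient of
  [t]_r changes by a multiple of r + 1.\<close>

locale comm_ring_hom =
  fixes h :: "'a::comm_ring_1 \<Rightarrow> 'b::comm_ring_1"
  assumes hom_one [simp]: "h 1 = 1"
    and hom_add: "h (x + y) = h x + h y"
    and hom_mult: "h (x * y) = h x * h y"
begin

lemma hom_zero [simp]: "h 0 = 0"
  using hom_add[of 0 0] by simp

lemma hom_uminus: "h (- x) = - h x"
  using hom_add[of x "- x"] by (simp add: eq_neg_iff_add_eq_0 add.commute)

lemma hom_diff: "h (x - y) = h x - h y"
  using hom_add[of x "- y"] by (simp add: hom_uminus)

lemma hom_of_nat [simp]: "h (of_nat m) = of_nat m"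
  by (induction m) (simp_all add: hom_add)

lemma hom_of_int [simp]: "h (of_int m) = of_int m"
  by (cases m rule: int_diff_cases) (simp add: hom_diff)

lemma hom_sum: "h (sum f X) = (\<Sum>x\<in>X. h (f x))"
  by (induction X rule: infinite_finite_induct) (simp_all add: hom_add)

lemma hom_prod: "h (prod f X) = (\<Prod>x\<in>X. h (f x))"
  by (induction X rule: infinite_finite_induct) (simp_all add: hom_mult)

lemma hom_poch: "h (poch \<kappa> x m) = poch \<kappa> (h x) m"
  by (simp only: poch_def hom_prod hom_diff hom_of_int)

end

lemmas hom_simps = comm_ring_hom.hom_one comm_ring_hom.hom_zero comm_ring_hom.hom_add
  comm_ring_hom.hom_mult comm_ring_hom.hom_uminus comm_ring_hom.hom_diff
  comm_ring_hom.hom_of_int comm_ring_hom.hom_of_nat comm_ring_hom.hom_sum comm_ring_hom.hom_prod comm_ring_hom.hom_poch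

lemma comm_ring_hom_id: "comm_ring_hom id"
  by unfold_locales simp_all

lemma comm_ring_hom_comp: "comm_ring_hom g \<Longrightarrow> comm_ring_hom h \<Longrightarrow> comm_ring_hom (g \<circ> h)"
  by (simp add: comm_ring_hom_def)

lemma comm_ring_hom_Const: "comm_ring_hom Const"
  by unfold_locales (simp_all add: Const_def single_add mult_single)

lemma comm_ring_hom_to_fract: "comm_ring_hom to_fract"
  by unfold_locales (simp_all flip: to_fract_add to_fract_mult)

section \<open>Evaluation of multivariate polynomials\<close>

definition monom_eval :: "(nat \<Rightarrow> 'b::comm_ring_1) \<Rightarrow> (nat \<Rightarrow>\<^sub>0 nat) \<Rightarrow> 'b" where
  "monom_eval \<rho> m = (\<Prod>i\<in>Poly_Mapping.keys m. \<rho> i ^ Poly_Mapping.lookup m i)"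

text \<open>Coefficients and variables are mapped separately, which covers three uses:
  \<open>Const\<close> on coefficients gives substitution, \<open>id\<close> gives evaluation at a
  point, and \<open>Const \<circ> \<phi>\<close> with \<open>Var\<close> changes the coefficients
  only.\<close>

definition mpoly_eval ::
    "('a::comm_ring_1 \<Rightarrow> 'b::comm_ring_1) \<Rightarrow> (nat \<Rightarrow> 'b) \<Rightarrow> 'a mpoly \<Rightarrow> 'b" where
  "mpoly_eval \<phi> \<rho> p = (\<Sum>m\<in>Poly_Mapping.keys p. \<phi> (Poly_Mapping.lookup p m) * monom_eval \<rho> m)"

lemma monom_eval_superset:
  assumes "finite X" and "Poly_Mapping.keys m \<subseteq> X"
  shows "monom_eval \<rho> m = (\<Prod>i\<in>X. \<rho> i ^ Poly_Mapping.lookup m i)"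
  unfolding monom_eval_def using assms
  by (intro prod.mono_neutral_left) (auto simp: in_keys_iff)

lemma monom_eval_0 [simp]: "monom_eval \<rho> 0 = 1"
  by (simp add: monom_eval_def)

lemma monom_eval_single [simp]: "monom_eval \<rho> (Poly_Mapping.single i e) = \<rho> i ^ e"
  by (cases "e = 0") (simp_all add: monom_eval_def)

lemma monom_eval_add: "monom_eval \<rho> (m + m') = monom_eval \<rho> m * monom_eval \<rho> m'"
proof -
  let ?X = "Poly_Mapping.keys m \<union> Poly_Mapping.keys m'"
  have "Poly_Mapping.keys (m + m') \<subseteq> ?X"
    by (rule keys_add)
  then show ?thesis
    by (simp add: monom_eval_superset[of ?X] lookup_add power_add prod.distrib)
qed

lemma mpoly_subst_eq_eval:
  fixes p :: "'a::comm_ring_1 mpoly"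
  shows "mpoly_subst \<rho> p = mpoly_eval Const \<rho> p"
  by (simp add: mpoly_subst_def mpoly_eval_def monom_eval_def)

context
  fixes \<phi> :: "'a::comm_ring_1 \<Rightarrow> 'b::comm_ring_1" and \<rho> :: "nat \<Rightarrow> 'b"
  assumes \<phi>: "comm_ring_hom \<phi>"
begin

lemma mpoly_eval_superset:
  assumes "finite X" and "Poly_Mapping.keys p \<subseteq> X"
  shows "mpoly_eval \<phi> \<rho> p = (\<Sum>m\<in>X. \<phi> (Poly_Mapping.lookup p m) * monom_eval \<rho> m)"
  unfolding mpoly_eval_def using assms
  by (intro sum.mono_neutral_left) (auto simp: in_keys_iff hom_simps[OF \<phi>])

lemma mpoly_eval_add: "mpoly_eval \<phi> \<rho> (p + q) = mpoly_eval \<phi> \<rho> p + mpoly_eval \<phi> \<rho> q"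
proof -
  let ?X = "Poly_Mapping.keys p \<union> Poly_Mapping.keys q"
  have "Poly_Mapping.keys (p + q) \<subseteq> ?X"
    by (rule keys_add)
  then show ?thesis
    by (simp add: mpoly_eval_superset[of ?X] lookup_add hom_simps[OF \<phi>] distrib_right sum.distrib)
qed

lemma mpoly_eval_0 [simp]: "mpoly_eval \<phi> \<rho> 0 = 0"
  by (simp add: mpoly_eval_def)

lemma mpoly_eval_sum: "mpoly_eval \<phi> \<rho> (sum f X) = (\<Sum>x\<in>X. mpoly_eval \<phi> \<rho> (f x))"
  by (induction X rule: infinite_finite_induct) (simp_all add: mpoly_eval_add)

lemma mpoly_eval_single: "mpoly_eval \<phi> \<rho> (Poly_Mapping.single m c) = \<phi> c * monom_eval \<rho> m"
  by (subst mpoly_eval_superset[of "{m}"]) auto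

lemma mpoly_eq_sum_single:
  fixes p :: "'c::comm_ring_1 mpoly"
  shows "p = (\<Sum>m\<in>Poly_Mapping.keys p. Poly_Mapping.single m (Poly_Mapping.lookup p m))"
proof (rule poly_mapping_eqI)
  fix k
  show "Poly_Mapping.lookup p k =
    Poly_Mapping.lookup (\<Sum>m\<in>Poly_Mapping.keys p. Poly_Mapping.single m (Poly_Mapping.lookup p m)) k"
    by (auto simp: lookup_sum lookup_single when_def in_keys_iff)
qed

lemma mpoly_eval_mult: "mpoly_eval \<phi> \<rho> (p * q) = mpoly_eval \<phi> \<rho> p * mpoly_eval \<phi> \<rho> q"
proof -
  let ?s = "\<lambda>p m. Poly_Mapping.single m (Poly_Mapping.lookup p m)"
  have "p * q = (\<Sum>m\<in>Poly_Mapping.keys p. ?s p m) * (\<Sum>m'\<in>Poly_Mapping.keys q. ?s q m')"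
    by (simp flip: mpoly_eq_sum_single)
  then have "mpoly_eval \<phi> \<rho> (p * q) = (\<Sum>m\<in>Poly_Mapping.keys p. \<Sum>m'\<in>Poly_Mapping.keys q.
      (\<phi> (Poly_Mapping.lookup p m) * monom_eval \<rho> m) *
      (\<phi> (Poly_Mapping.lookup q m') * monom_eval \<rho> m'))"
    by (simp add: sum_product mpoly_eval_sum mult_single mpoly_eval_single hom_simps[OF \<phi>]
        monom_eval_add mult_ac)
  then show ?thesis
    by (simp add: mpoly_eval_def sum_product)
qed

lemma comm_ring_hom_mpoly_eval: "comm_ring_hom (mpoly_eval \<phi> \<rho>)"
proof
  have "mpoly_eval \<phi> \<rho> (Poly_Mapping.single 0 1) = 1"
    unfolding mpoly_eval_single by (simp add: hom_simps[OF \<phi>])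
  then show "mpoly_eval \<phi> \<rho> 1 = 1"
    by simp
qed (rule mpoly_eval_add mpoly_eval_mult)+

lemma mpoly_eval_Const [simp]: "mpoly_eval \<phi> \<rho> (Const c) = \<phi> c"
  by (simp add: Const_def mpoly_eval_single)

lemma mpoly_eval_Var [simp]: "mpoly_eval \<phi> \<rho> (Var i) = \<rho> i"
  by (simp add: Var_def mpoly_eval_single hom_simps[OF \<phi>])

end

lemma comm_ring_hom_mpoly_subst: "comm_ring_hom (mpoly_subst \<rho>)"
  unfolding mpoly_subst_eq_eval[abs_def] by (rule comm_ring_hom_mpoly_eval[OF comm_ring_hom_Const])

lemma mpoly_subst_Var [simp]: "mpoly_subst \<rho> (Var i :: 'a::comm_ring_1 mpoly) = \<rho> i"
  by (simp add: mpoly_subst_eq_eval comm_ring_hom_Const)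

lemma lookup_of_int_mult:
  "Poly_Mapping.lookup (of_int c * p) m = of_int c * Poly_Mapping.lookup (p :: 'a::comm_ring_1 mpoly) m"
proof -
  have "of_int c * p = Poly_Mapping.map ((*) (of_int c)) p"
    by (simp add: mult_map_scale_conv_mult)
  then show ?thesis
    by (simp add: Poly_Mapping.map.rep_eq when_def)
qed


section \<open>Terms of the weight functions\<close>

text \<open>
  A summand of \<open>U_I\<close> attaches to each variable \<open>t\<^sub>i\<close> a site \<open>b i \<in> I\<close>. The site \<open>a\<close> is put at the
  position \<open>2 * a\<close>, which leaves room for positions between the sites.
\<close>

definition zfac :: "int \<Rightarrow> nat \<Rightarrow> nat \<Rightarrow> nat \<Rightarrow> 'a \<Rightarrow> 'a::comm_ring_1" where
  "zfac \<kappa> k u v x = (if v < u then poch \<kappa> (x - of_int \<kappa>) k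
     else if v = u then poch \<kappa> (x - of_int \<kappa>) (k - 1) else poch \<kappa> x k)"

text \<open>The second case is [y + 1]_k' (y + 1 - \<kappa> k') / (y + 1), the factor of an inverted
  pair after cancellation. In the same way \<open>zfac\<close> is [x]_k times (x - \<kappa> k) / x,
  1 / x or 1.\<close>

definition tfac :: "int \<Rightarrow> nat \<Rightarrow> nat \<Rightarrow> nat \<Rightarrow> 'a \<Rightarrow> 'a::comm_ring_1" where
  "tfac \<kappa> k' u v y = (if u < v then poch \<kappa> (y + 1) k' else poch \<kappa> (y + 1 - of_int \<kappa>) k')"

definition pairs :: "nat \<Rightarrow> (nat \<times> nat) set" where
  "pairs l = {(i, j). 1 \<le> i \<and> i < j \<and> j \<le> l}"

definition zrow :: "int \<Rightarrow> nat \<Rightarrow> nat \<Rightarrow> nat \<Rightarrow> 'a \<Rightarrow> (nat \<Rightarrow> 'a) \<Rightarrow> 'a::comm_ring_1" where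
  "zrow \<kappa> k n u x z = (\<Prod>a=1..n. zfac \<kappa> k u (2 * a) (x - z a))"

definition weight_term ::
    "int \<Rightarrow> nat \<Rightarrow> nat \<Rightarrow> nat \<Rightarrow> nat \<Rightarrow> (nat \<Rightarrow> nat) \<Rightarrow>
     (nat \<Rightarrow> 'a) \<Rightarrow> (nat \<Rightarrow> 'a) \<Rightarrow> 'a::comm_ring_1" where
  "weight_term \<kappa> k k' n l c t z = (\<Prod>i=1..l. zrow \<kappa> k n (c i) (t i) z) *
     (\<Prod>(i, j)\<in>pairs l. tfac \<kappa> k' (c i) (c j) (t i - t j))"

text \<open>What remains of the factors modulo \<open>N\<close> when the common factor of all summands is removed.\<close>

definition zred :: "nat \<Rightarrow> nat \<Rightarrow> 'a \<Rightarrow> 'a::comm_ring_1" where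
  "zred u v x = (if v < u then x + 1 else if v = u then 1 else x)"

definition tred :: "nat \<Rightarrow> nat \<Rightarrow> 'a \<Rightarrow> 'a::comm_ring_1" where
  "tred u v y = (if u < v then y + 1 else y - 1)"

definition zrow_red :: "nat \<Rightarrow> nat \<Rightarrow> 'a \<Rightarrow> (nat \<Rightarrow> 'a) \<Rightarrow> 'a::comm_ring_1" where
  "zrow_red n u x z = (\<Prod>a=1..n. zred u (2 * a) (x - z a))"

definition red_term ::
    "nat \<Rightarrow> nat \<Rightarrow> (nat \<Rightarrow> nat) \<Rightarrow> (nat \<Rightarrow> 'a) \<Rightarrow> (nat \<Rightarrow> 'a) \<Rightarrow> 'a::comm_ring_1" where
  "red_term n l c t z = (\<Prod>i=1..l. zrow_red n (c i) (t i) z) *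
     (\<Prod>(i, j)\<in>pairs l. tred (c i) (c j) (t i - t j))"

text \<open>Extensionality makes each bijection a single function. The set is empty when
  \<open>card I \<noteq> l\<close>, so sums over it vanish for sets of the wrong size.\<close>

definition bijs :: "nat \<Rightarrow> nat set \<Rightarrow> (nat \<Rightarrow> nat) set" where
  "bijs l I = {b \<in> {1..l} \<rightarrow>\<^sub>E UNIV. bij_betw b {1..l} I}"

definition weight_sum ::
    "int \<Rightarrow> nat \<Rightarrow> nat \<Rightarrow> nat \<Rightarrow> nat \<Rightarrow> nat set \<Rightarrow>
     (nat \<Rightarrow> 'a) \<Rightarrow> (nat \<Rightarrow> 'a) \<Rightarrow> 'a::comm_ring_1" where
  "weight_sum \<kappa> k k' n l I t z = (\<Sum>b\<in>bijs l I. weight_term \<kappa> k k' n l (\<lambda>i. 2 * b i) t z)"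

definition red_sum ::
    "nat \<Rightarrow> nat \<Rightarrow> nat set \<Rightarrow> (nat \<Rightarrow> 'a) \<Rightarrow> (nat \<Rightarrow> 'a) \<Rightarrow> 'a::comm_ring_1" where
  "red_sum n l I t z = (\<Sum>b\<in>bijs l I. red_term n l (\<lambda>i. 2 * b i) t z)"

lemma finite_pairs [simp]: "finite (pairs l)"
  by (rule finite_subset[of _ "{1..l} \<times> {1..l}"]) (auto simp: pairs_def)

lemma weight_term_cong:
  assumes "\<And>i. i \<in> {1..l} \<Longrightarrow> c i = c' i" and "\<And>i. i \<in> {1..l} \<Longrightarrow> t i = t' i"
    and "\<And>a. a \<in> {1..n} \<Longrightarrow> z a = z' a"
  shows "weight_term \<kappa> k k' n l c t z = weight_term \<kappa> k k' n l c' t' z'"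
  unfolding weight_term_def zrow_def using assms
  by (intro arg_cong2[of _ _ _ _ "(*)"] prod.cong) (auto simp: pairs_def)

lemma red_term_cong:
  assumes "\<And>i. i \<in> {1..l} \<Longrightarrow> c i = c' i"
  shows "red_term n l c t z = red_term n l c' t z"
  unfolding red_term_def zrow_red_def using assms
  by (intro arg_cong2[of _ _ _ _ "(*)"] prod.cong) (auto simp: pairs_def)

section \<open>Reindexing and cancellation in sums over bijections\<close>

text \<open>Composition with \<open>inv_into I g\<close> is the inverse; the restrictions keep the
  composites extensional.\<close>

lemma bij_betw_bijs_image:
  assumes "inj_on g I"
  shows "bij_betw (\<lambda>b. restrict (g \<circ> b) {1..l}) (bijs l I) (bijs l (g ` I))"
proof (rule bij_betw_byWitness[where f' = "\<lambda>b. restrict (inv_into I g \<circ> b) {1..l}"])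
  show "\<forall>b\<in>bijs l I. restrict (inv_into I g \<circ> restrict (g \<circ> b) {1..l}) {1..l} = b"
  proof (intro ballI ext)
    fix b i assume "b \<in> bijs l I"
    then have "b i \<in> I" if "i \<in> {1..l}"
      using that by (auto simp: bijs_def bij_betw_def)
    moreover have "b i = undefined" if "i \<notin> {1..l}"
      using \<open>b \<in> bijs l I\<close> that unfolding bijs_def by (blast dest: PiE_arb)
    ultimately show "restrict (inv_into I g \<circ> restrict (g \<circ> b) {1..l}) {1..l} i = b i"
      using assms by (cases "i \<in> {1..l}") simp_all
  qed
  show "\<forall>b\<in>bijs l (g ` I). restrict (g \<circ> restrict (inv_into I g \<circ> b) {1..l}) {1..l} = b"
  proof (intro ballI ext)
    fix b i assume "b \<in> bijs l (g ` I)"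
    then have "b i \<in> g ` I" if "i \<in> {1..l}"
      using that by (auto simp: bijs_def bij_betw_def)
    moreover have "b i = undefined" if "i \<notin> {1..l}"
      using \<open>b \<in> bijs l (g ` I)\<close> that unfolding bijs_def by (blast dest: PiE_arb)
    ultimately show "restrict (g \<circ> restrict (inv_into I g \<circ> b) {1..l}) {1..l} i = b i"
      by (cases "i \<in> {1..l}") (simp_all add: f_inv_into_f)
  qed
  have g: "bij_betw g I (g ` I)"
    using assms by (simp add: bij_betw_def)
  have cong: "bij_betw (restrict f {1..l}) {1..l} X" if "bij_betw f {1..l} X"
    for f :: "nat \<Rightarrow> nat" and X
    using that by (subst bij_betw_cong[of _ _ f]) auto
  show "(\<lambda>b. restrict (g \<circ> b) {1..l}) ` bijs l I \<subseteq> bijs l (g ` I)"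
  proof (intro image_subsetI)
    fix b assume "b \<in> bijs l I"
    then have "bij_betw (g \<circ> b) {1..l} (g ` I)"
      by (intro bij_betw_trans[OF _ g]) (simp add: bijs_def)
    from cong[OF this] show "restrict (g \<circ> b) {1..l} \<in> bijs l (g ` I)"
      by (simp add: bijs_def)
  qed
  show "(\<lambda>b. restrict (inv_into I g \<circ> b) {1..l}) ` bijs l (g ` I) \<subseteq> bijs l I"
  proof (intro image_subsetI)
    fix b assume "b \<in> bijs l (g ` I)"
    then have "bij_betw (inv_into I g \<circ> b) {1..l} I"
      by (intro bij_betw_trans[OF _ bij_betw_inv_into[OF g]]) (simp add: bijs_def)
    from cong[OF this] show "restrict (inv_into I g \<circ> b) {1..l} \<in> bijs l I"
      by (simp add: bijs_def)
  qed
qed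

lemma sum_bijs_image:
  assumes "inj_on g I"
    and F: "\<And>b b'. (\<And>i. i \<in> {1..l} \<Longrightarrow> b i = b' i) \<Longrightarrow> F b = F b'"
  shows "(\<Sum>b\<in>bijs l (g ` I). F b) = (\<Sum>b\<in>bijs l I. F (g \<circ> b))"
proof -
  have "(\<Sum>b\<in>bijs l (g ` I). F b) = (\<Sum>b\<in>bijs l I. F (restrict (g \<circ> b) {1..l}))"
    by (rule sum.reindex_bij_betw[OF bij_betw_bijs_image[OF assms(1)], symmetric])
  also have "\<dots> = (\<Sum>b\<in>bijs l I. F (g \<circ> b))"
    by (intro sum.cong refl F) simp
  finally show ?thesis .
qed

lemma bijsD:
  assumes "b \<in> bijs l I"
  shows "i \<in> {1..l} \<Longrightarrow> b i \<in> I"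
    and "i \<in> {1..l} \<Longrightarrow> j \<in> {1..l} \<Longrightarrow> b i = b j \<longleftrightarrow> i = j"
    and "u \<in> I \<Longrightarrow> \<exists>i\<in>{1..l}. b i = u"
proof -
  have "inj_on b {1..l}" and "b ` {1..l} = I"
    using assms by (simp_all add: bijs_def bij_betw_def)
  then show "i \<in> {1..l} \<Longrightarrow> b i \<in> I"
    and "i \<in> {1..l} \<Longrightarrow> j \<in> {1..l} \<Longrightarrow> b i = b j \<longleftrightarrow> i = j"
    and "u \<in> I \<Longrightarrow> \<exists>i\<in>{1..l}. b i = u"
    by (blast, simp add: inj_on_eq_iff, blast)
qed

text \<open>Pairing \<open>b\<close> with \<open>g \<circ> b\<close> shows that twice the sum vanishes.\<close>

lemma sum_bijs_eq_0:
  fixes F :: "(nat \<Rightarrow> nat) \<Rightarrow> 'a::{idom, ring_char_0}"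
  assumes g: "bij_betw g I I" and gg: "\<And>u. u \<in> I \<Longrightarrow> g (g u) = u"
    and F: "\<And>b b'. (\<And>i. i \<in> {1..l} \<Longrightarrow> b i = b' i) \<Longrightarrow> F b = F b'"
    and uv: "u \<in> I" "v \<in> I" "g u = v" "u \<noteq> v"
    and cancel: "\<And>b p q. b \<in> bijs l I \<Longrightarrow> p \<in> {1..l} \<Longrightarrow> q \<in> {1..l} \<Longrightarrow> p < q \<Longrightarrow>
       b p = u \<Longrightarrow> b q = v \<Longrightarrow> F b + F (g \<circ> b) = 0"
  shows "(\<Sum>b\<in>bijs l I. F b) = 0"
proof -
  have inj: "inj_on g I" and im: "g ` I = I"
    using g by (auto simp: bij_betw_def)
  have "F b + F (g \<circ> b) = 0" if b: "b \<in> bijs l I" for b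
  proof -
    obtain p q where p: "p \<in> {1..l}" "b p = u" and q: "q \<in> {1..l}" "b q = v"
      using bijsD(3)[OF b] uv by metis
    consider "p < q" | "q < p"
      using p q uv by (metis linorder_neqE_nat)
    then show ?thesis
    proof cases
      case 1
      then show ?thesis
        using cancel b p q by blast
    next
      case 2
      \<comment> \<open>The labels occur in the opposite order, so \<open>cancel\<close> is applied
        to the partner of \<open>b\<close>, in which \<open>u\<close> and \<open>v\<close> have
        changed places.\<close>
      define b' where "b' = restrict (g \<circ> b) {1..l}"
      have "b' \<in> bijs l I"
        using bij_betw_apply[OF bij_betw_bijs_image[OF inj] b] im by (simp add: b'_def)
      moreover have "b' q = u" "b' p = v"
        using p q uv(3) gg[OF uv(1)] by (auto simp: b'_def)
      ultimately have "F b' + F (g \<circ> b') = 0"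
        using cancel[of b' q p] p q 2 by blast
      moreover have "F b' = F (g \<circ> b)"
        by (rule F) (simp add: b'_def)
      moreover have "F (g \<circ> b') = F b"
        by (rule F) (use bijsD(1)[OF b] gg in \<open>simp add: b'_def\<close>)
      ultimately show ?thesis
        by (simp add: add.commute)
    qed
  qed
  then have "(\<Sum>b\<in>bijs l I. F b) + (\<Sum>b\<in>bijs l I. F (g \<circ> b)) = 0"
    by (simp flip: sum.distrib)
  moreover have "(\<Sum>b\<in>bijs l I. F (g \<circ> b)) = (\<Sum>b\<in>bijs l I. F b)"
    using sum_bijs_image[of g I l F, OF inj F] im by simp
  ultimately have "2 * (\<Sum>b\<in>bijs l I. F b) = 0"
    by simp
  then show ?thesis
    by simp
qed

section \<open>Splitting off two variables\<close>

text \<open>Of the pair factors only (p, q) is left out. Pairs with one member in {p, q} stay,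
  because the terms that cancel against each other agree in them.\<close>

definition red_rest ::
    "nat \<Rightarrow> nat \<Rightarrow> nat \<Rightarrow> nat \<Rightarrow> (nat \<Rightarrow> nat) \<Rightarrow>
     (nat \<Rightarrow> 'a) \<Rightarrow> (nat \<Rightarrow> 'a) \<Rightarrow> 'a::comm_ring_1" where
  "red_rest n l p q c t z = (\<Prod>i\<in>{1..l} - {p, q}. zrow_red n (c i) (t i) z) *
     (\<Prod>(i, j)\<in>pairs l - {(p, q)}. tred (c i) (c j) (t i - t j))"

lemma red_term_split:
  assumes "p \<in> {1..l}" and "q \<in> {1..l}" and "p < q"
  shows "red_term n l c t z = zrow_red n (c p) (t p) z * zrow_red n (c q) (t q) z *
    tred (c p) (c q) (t p - t q) * red_rest n l p q c t z"
proof -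
  have "(\<Prod>i=1..l. zrow_red n (c i) (t i) z) = zrow_red n (c p) (t p) z *
      (zrow_red n (c q) (t q) z * (\<Prod>i\<in>{1..l} - {p} - {q}. zrow_red n (c i) (t i) z))"
    using assms by (subst prod.remove[of _ p], simp, simp, subst prod.remove[of _ q]) auto
  moreover have "{1..l} - {p} - {q} = {1..l} - {p, q}"
    by auto
  moreover have "(\<Prod>(i, j)\<in>pairs l. tred (c i) (c j) (t i - t j)) =
      tred (c p) (c q) (t p - t q) * (\<Prod>(i, j)\<in>pairs l - {(p, q)}. tred (c i) (c j) (t i - t j))"
    using assms by (subst prod.remove[of _ "(p, q)"]) (simp_all add: pairs_def[THEN eqset_imp_iff])
  ultimately show ?thesis
    by (simp add: red_term_def red_rest_def mult_ac)
qed

text \<open>\<open>tred\<close> sees positions only through a comparison, so the positions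
  themselves may differ, or even collide at \<open>p\<close> and \<open>q\<close>, as long as the
  other comparisons agree.\<close>

lemma red_rest_cong:
  assumes "\<And>i. i \<in> {1..l} \<Longrightarrow> i \<noteq> p \<Longrightarrow> i \<noteq> q \<Longrightarrow>
      zrow_red n (c i) (t i) z = zrow_red n (c' i) (t i) z'"
    and "\<And>i j. (i, j) \<in> pairs l \<Longrightarrow> (i, j) \<noteq> (p, q) \<Longrightarrow> c i < c j \<longleftrightarrow> c' i < c' j"
  shows "red_rest n l p q c t z = red_rest n l p q c' t z'"
  unfolding red_rest_def
proof (intro arg_cong2[of _ _ _ _ "(*)"] prod.cong refl)
  show "zrow_red n (c i) (t i) z = zrow_red n (c' i) (t i) z'" if "i \<in> {1..l} - {p, q}" for i
    using that assms(1) by auto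
  show "(case e of (i, j) \<Rightarrow> tred (c i) (c j) (t i - t j)) =
      (case e of (i, j) \<Rightarrow> tred (c' i) (c' j) (t i - t j))" if "e \<in> pairs l - {(p, q)}" for e
    using that assms(2) by (cases e) (auto simp: tred_def)
qed

section \<open>The exchange relation of the reduced weight functions\<close>

text \<open>Both sites lie on the same side of \<open>u\<close>, so the swap of parameters permutes
  factors of the same shape.\<close>

lemma zrow_red_swap:
  assumes "1 \<le> a" and "a < n" and "u \<noteq> a" and "u \<noteq> a + 1"
  shows "zrow_red n (2 * u) x (z \<circ> transpose a (a + 1)) = zrow_red n (2 * u) x z"
proof -
  let ?s = "transpose a (a + 1)"
  have s: "bij_betw ?s {1..n} {1..n}"
    using assms by (intro permutes_imp_bij permutes_swap_id) auto
  have "zrow_red n (2 * u) x z = (\<Prod>b=1..n. zred (2 * u) (2 * ?s b) (x - z (?s b)))"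
    unfolding zrow_red_def by (rule prod.reindex_bij_betw[OF s, symmetric])
  also have "\<dots> = zrow_red n (2 * u) x (z \<circ> ?s)"
    unfolding zrow_red_def using assms
    by (intro prod.cong) (auto simp: zred_def transpose_def)
  finally show ?thesis ..
qed

text \<open>Every other site lies on the same side of \<open>a\<close> and of \<open>a + 1\<close>,
  so the other sites contribute one common factor \<open>R\<close> in all four cases.\<close>

lemma zrow_red_at_swap:
  fixes z :: "nat \<Rightarrow> 'a::comm_ring_1"
  assumes "1 \<le> a" and "a < n"
  obtains R where "zrow_red n (2 * a) x z = R * (x - z (a + 1))"
    and "zrow_red n (2 * (a + 1)) x z = R * (x - z a + 1)"
    and "zrow_red n (2 * a) x (z \<circ> transpose a (a + 1)) = R * (x - z a)"
    and "zrow_red n (2 * (a + 1)) x (z \<circ> transpose a (a + 1)) = R * (x - z (a + 1) + 1)"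
proof -
  define R where "R = (\<Prod>b\<in>{1..n} - {a} - {a + 1}. zred (2 * a) (2 * b) (x - z b))"
  have split: "zrow_red n u x w = zred u (2 * a) (x - w a) * (zred u (2 * (a + 1)) (x - w (a + 1)) *
      (\<Prod>b\<in>{1..n} - {a} - {a + 1}. zred u (2 * b) (x - w b)))" for u and w :: "nat \<Rightarrow> 'a"
    unfolding zrow_red_def using assms
    by (subst prod.remove[of _ a], simp, simp, subst prod.remove[of _ "a + 1"]) auto
  have "(\<Prod>b\<in>{1..n} - {a} - {a + 1}. zred u (2 * b) (x - w b)) = R"
    if "u = 2 * a \<or> u = 2 * (a + 1)" and "w = z \<or> w = z \<circ> transpose a (a + 1)" for u w
    unfolding R_def using that by (intro prod.cong) (auto simp: zred_def)
  then show ?thesis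
    by (intro that[of R]) (simp_all add: split, simp_all add: zred_def mult_ac)
qed

text \<open>No number lies strictly between \<open>a\<close> and \<open>a + 1\<close>, so only the
  order of these two is reversed.\<close>

lemma transpose_less_iff:
  assumes "\<not> (u = a \<and> v = a + 1)" and "\<not> (u = a + 1 \<and> v = a)"
  shows "transpose a (a + 1) u < transpose a (a + 1) v \<longleftrightarrow> u < (v::nat)"
  using assms by (auto simp: transpose_def)

text \<open>With at most one of the two sites occupied, the transposition changes no comparison
  between variables. The relation is then a linear relation between rows of a single
  variable.\<close>

lemma red_term_swap:
  assumes "1 \<le> a" and "a < n" and "inj_on b {1..l}"
    and "\<not> (a \<in> b ` {1..l} \<and> a + 1 \<in> b ` {1..l})"
  shows "(z a - z (a + 1) - 1) * red_term n l (\<lambda>i. 2 * b i) t (z \<circ> transpose a (a + 1)) =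
     (z a - z (a + 1)) * red_term n l (\<lambda>i. 2 * transpose a (a + 1) (b i)) t z -
     red_term n l (\<lambda>i. 2 * b i) t z"
proof -
  let ?s = "transpose a (a + 1)"
  define Q where "Q = (\<Prod>(i, j)\<in>pairs l. tred (2 * b i) (2 * b j) (t i - t j))"
  have Q: "(\<Prod>(i, j)\<in>pairs l. tred (2 * ?s (b i)) (2 * ?s (b j)) (t i - t j)) = Q"
    unfolding Q_def
  proof (intro prod.cong refl)
    fix e assume "e \<in> pairs l"
    then obtain i j where e: "e = (i, j)" "i \<in> {1..l}" "j \<in> {1..l}"
      by (auto simp: pairs_def)
    then have "?s (b i) < ?s (b j) \<longleftrightarrow> b i < b j"
      using assms(4) by (intro transpose_less_iff) (metis image_eqI)+
    then show "(case e of (i, j) \<Rightarrow> tred (2 * ?s (b i)) (2 * ?s (b j)) (t i - t j)) =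
        (case e of (i, j) \<Rightarrow> tred (2 * b i) (2 * b j) (t i - t j))"
      by (simp add: e tred_def)
  qed
  show ?thesis
  proof (cases "\<exists>p\<in>{1..l}. b p = a \<or> b p = a + 1")
    case False
    \<comment> \<open>Neither site is occupied: the three terms coincide, and the relation reads u -
      1 = u - 1 with u = z_a - z_(a+1).\<close>
    have "(\<Prod>i=1..l. zrow_red n (2 * b i) (t i) (z \<circ> ?s)) = (\<Prod>i=1..l. zrow_red n (2 * b i) (t i) z)"
      using False assms by (intro prod.cong refl zrow_red_swap) auto
    then have "red_term n l (\<lambda>i. 2 * b i) t (z \<circ> ?s) = red_term n l (\<lambda>i. 2 * b i) t z"
      by (simp add: red_term_def)
    moreover have "red_term n l (\<lambda>i. 2 * ?s (b i)) t z = red_term n l (\<lambda>i. 2 * b i) t z"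
      using False by (intro red_term_cong) (auto simp: transpose_def)
    ultimately show ?thesis
      by (simp add: left_diff_distrib)
  next
    case True
    then obtain p where p: "p \<in> {1..l}" "b p = a \<or> b p = a + 1"
      by blast
    define M where "M = (\<Prod>i\<in>{1..l} - {p}. zrow_red n (2 * b i) (t i) z)"
    have other: "b i \<noteq> a" "b i \<noteq> a + 1" if "i \<in> {1..l} - {p}" for i
      using p that assms(3,4) by (metis DiffD1 DiffD2 image_eqI inj_onD singletonI)+
    have split: "(\<Prod>i=1..l. zrow_red n (2 * d i) (t i) w) = zrow_red n (2 * d p) (t p) w *
        (\<Prod>i\<in>{1..l} - {p}. zrow_red n (2 * d i) (t i) w)" for d w
      using p by (simp add: prod.remove)
    have M1: "(\<Prod>i\<in>{1..l} - {p}. zrow_red n (2 * b i) (t i) (z \<circ> ?s)) = M"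
      unfolding M_def using other assms by (intro prod.cong refl zrow_red_swap) auto
    have M2: "(\<Prod>i\<in>{1..l} - {p}. zrow_red n (2 * ?s (b i)) (t i) z) = M"
      unfolding M_def using other by (intro prod.cong refl) (simp add: transpose_def)
    obtain R where R: "zrow_red n (2 * a) (t p) z = R * (t p - z (a + 1))"
      "zrow_red n (2 * (a + 1)) (t p) z = R * (t p - z a + 1)"
      "zrow_red n (2 * a) (t p) (z \<circ> ?s) = R * (t p - z a)"
      "zrow_red n (2 * (a + 1)) (t p) (z \<circ> ?s) = R * (t p - z (a + 1) + 1)"
      using zrow_red_at_swap[OF assms(1,2)] by blast
    \<comment> \<open>Up to \<open>R\<close>, with u = z_a - z_(a+1) and t = t_p, the two cases are
      (u - 1)(t - z_a) = u (t - z_a + 1) - (t - z_(a+1)) and (u - 1)(t - z_(a+1) + 1) = u (t -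
      z_(a+1)) - (t - z_a + 1).\<close>
    have "(z a - z (a + 1) - 1) * zrow_red n (2 * b p) (t p) (z \<circ> ?s) =
        (z a - z (a + 1)) * zrow_red n (2 * ?s (b p)) (t p) z - zrow_red n (2 * b p) (t p) z"
      using p(2)
    proof
      assume b: "b p = a"
      have "?s (b p) = a + 1"
        by (simp add: b)
      then show ?thesis
        unfolding b by (simp only: R) (simp add: algebra_simps)
    next
      assume b: "b p = a + 1"
      have "?s (b p) = a"
        by (simp add: b)
      then show ?thesis
        unfolding b by (simp only: R) (simp add: algebra_simps)
    qed
    then have "(z a - z (a + 1) - 1) * (zrow_red n (2 * b p) (t p) (z \<circ> ?s) * M * Q) =
        (z a - z (a + 1)) * (zrow_red n (2 * ?s (b p)) (t p) z * M * Q) -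
        zrow_red n (2 * b p) (t p) z * M * Q"
      by (simp only: mult.assoc[symmetric] left_diff_distrib[symmetric])
    then show ?thesis
      unfolding red_term_def Q split M1 M2
      by (simp only: Q_def M_def)
  qed
qed

text \<open>Single terms are not symmetric here, because two rows and the factor of their pair
  interact. The sum of the terms for \<open>b\<close> and for
  \<open>transpose a (a + 1) \<circ> b\<close> is.\<close>

lemma red_sum_symmetric:
  fixes z :: "nat \<Rightarrow> 'a::{idom, ring_char_0}"
  assumes a: "1 \<le> a" "a < n" and I: "a \<in> I" "a + 1 \<in> I"
  shows "red_sum n l I t (z \<circ> transpose a (a + 1)) = red_sum n l I t z"
proof -
  let ?s = "transpose a (a + 1)"
  define F where "F b = red_term n l (\<lambda>i. 2 * b i) t (z \<circ> ?s) - red_term n l (\<lambda>i. 2 * b i) t z" for b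
  have "(\<Sum>b\<in>bijs l I. F b) = 0"
  proof (rule sum_bijs_eq_0[of ?s _ _ _ a "a + 1"])
    show "bij_betw ?s I I"
      using I by (intro permutes_imp_bij permutes_swap_id)
    show "F b = F b'" if "\<And>i. i \<in> {1..l} \<Longrightarrow> b i = b' i" for b b'
      using that unfolding F_def by (intro arg_cong2[of _ _ _ _ "(-)"] red_term_cong) auto
    fix b p q
    assume b: "b \<in> bijs l I" and pq: "p \<in> {1..l}" "q \<in> {1..l}" "p < q" "b p = a" "b q = a + 1"
    have at: "b i = a \<longleftrightarrow> i = p" "b i = a + 1 \<longleftrightarrow> i = q" if "i \<in> {1..l}" for i
      using bijsD(2)[OF b that pq(1)] bijsD(2)[OF b that pq(2)] pq(4,5) by simp_all
    have other: "b i \<noteq> a" "b i \<noteq> a + 1" if "i \<in> {1..l}" "i \<noteq> p" "i \<noteq> q" for i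
      using at[OF that(1)] that by blast+
    define Q where "Q = red_rest n l p q (\<lambda>i. 2 * b i) t z"
    have Q1: "red_rest n l p q (\<lambda>i. 2 * b i) t (z \<circ> ?s) = Q"
      unfolding Q_def by (intro red_rest_cong refl zrow_red_swap a other)
    have less: "?s (b i) < ?s (b j) \<longleftrightarrow> b i < b j" if "(i, j) \<in> pairs l" "(i, j) \<noteq> (p, q)" for i j
    proof (rule transpose_less_iff)
      have ij: "i \<in> {1..l}" "j \<in> {1..l}" "i < j"
        using that by (auto simp: pairs_def)
      show "\<not> (b i = a \<and> b j = a + 1)" "\<not> (b i = a + 1 \<and> b j = a)"
        unfolding at[OF ij(1)] at[OF ij(2)] using ij(3) that(2) pq(3) by auto
    qed
    have s: "?s (b i) = b i" if "i \<in> {1..l}" "i \<noteq> p" "i \<noteq> q" for i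
      using other[OF that] by (simp add: transpose_def)
    have Q2: "red_rest n l p q (\<lambda>i. 2 * ?s (b i)) t z = Q"
      unfolding Q_def by (intro red_rest_cong) (simp_all only: s less mult_less_cancel1 zero_less_numeral simp_thms)
    have Q3: "red_rest n l p q (\<lambda>i. 2 * ?s (b i)) t (z \<circ> ?s) = Q"
      unfolding Q2[symmetric]
    proof (intro red_rest_cong refl)
      fix i assume i: "i \<in> {1..l}" "i \<noteq> p" "i \<noteq> q"
      show "zrow_red n (2 * ?s (b i)) (t i) (z \<circ> ?s) = zrow_red n (2 * ?s (b i)) (t i) z"
        unfolding s[OF i] by (rule zrow_red_swap[OF a other[OF i]])
    qed
    obtain R where R: "zrow_red n (2 * a) (t p) z = R * (t p - z (a + 1))"
      "zrow_red n (2 * (a + 1)) (t p) z = R * (t p - z a + 1)"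
      "zrow_red n (2 * a) (t p) (z \<circ> ?s) = R * (t p - z a)"
      "zrow_red n (2 * (a + 1)) (t p) (z \<circ> ?s) = R * (t p - z (a + 1) + 1)"
      using zrow_red_at_swap[OF a] by blast
    obtain S where S: "zrow_red n (2 * a) (t q) z = S * (t q - z (a + 1))"
      "zrow_red n (2 * (a + 1)) (t q) z = S * (t q - z a + 1)"
      "zrow_red n (2 * a) (t q) (z \<circ> ?s) = S * (t q - z a)"
      "zrow_red n (2 * (a + 1)) (t q) (z \<circ> ?s) = S * (t q - z (a + 1) + 1)"
      using zrow_red_at_swap[OF a] by blast
    have sb: "?s (b p) = a + 1" "?s (b q) = a"
      using pq by simp_all
    have T: "tred (2 * a) (2 * (a + 1)) y = y + 1" "tred (2 * (a + 1)) (2 * a) y = y - 1" for y :: 'a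
      by (simp_all add: tred_def)
    have assoc: "R * x * (S * y) * w * Q = R * S * Q * (x * y * w)" for x y w
      by (simp add: mult_ac)
    \<comment> \<open>The four configurations of the two variables, stripped of the common factor
      \<open>R * S * Q\<close>.\<close>
    have "(t p - z a) * (t q - z (a + 1) + 1) * (t p - t q + 1) -
        (t p - z (a + 1)) * (t q - z a + 1) * (t p - t q + 1) +
        ((t p - z (a + 1) + 1) * (t q - z a) * (t p - t q - 1) -
        (t p - z a + 1) * (t q - z (a + 1)) * (t p - t q - 1)) = 0"
      by algebra
    moreover have "F b = R * S * Q * ((t p - z a) * (t q - z (a + 1) + 1) * (t p - t q + 1) -
        (t p - z (a + 1)) * (t q - z a + 1) * (t p - t q + 1))"
      unfolding F_def red_term_split[OF pq(1,2,3)] Q1 Q_def[symmetric]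
        pq(4,5) R S T assoc right_diff_distrib[symmetric] ..
    moreover have "F (?s \<circ> b) = R * S * Q * ((t p - z (a + 1) + 1) * (t q - z a) * (t p - t q - 1) -
        (t p - z a + 1) * (t q - z (a + 1)) * (t p - t q - 1))"
      unfolding F_def red_term_split[OF pq(1,2,3)] comp_apply Q2 Q3 sb R S T assoc
        right_diff_distrib[symmetric] ..
    ultimately show "F b + F (?s \<circ> b) = 0"
      by (simp only: distrib_left[symmetric] mult_zero_right)
  qed (use I in auto)
  then show ?thesis
    by (simp add: F_def red_sum_def sum_subtractf)
qed

text \<open>If both sites belong to \<open>I\<close>, the transposition fixes \<open>I\<close> and
  the relation reduces to symmetry of the sum; otherwise it holds term by term.\<close>

lemma red_sum_swap:
  fixes z :: "nat \<Rightarrow> 'a::{idom, ring_char_0}"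
  assumes a: "1 \<le> a" "a < n"
  shows "(z a - z (a + 1) - 1) * red_sum n l I t (z \<circ> transpose a (a + 1)) =
     (z a - z (a + 1)) * red_sum n l (transpose a (a + 1) ` I) t z - red_sum n l I t z"
proof (cases "a \<in> I \<and> a + 1 \<in> I")
  case True
  then have "transpose a (a + 1) ` I = I"
    by (simp add: transpose_image_eq)
  moreover have "red_sum n l I t (z \<circ> transpose a (a + 1)) = red_sum n l I t z"
    using True by (intro red_sum_symmetric[OF a]) blast+
  ultimately show ?thesis
    by (simp only: left_diff_distrib mult_1)
next
  case False
  let ?s = "transpose a (a + 1)"
  have im: "red_sum n l (?s ` I) t z = (\<Sum>b\<in>bijs l I. red_term n l (\<lambda>i. 2 * (?s \<circ> b) i) t z)"
    unfolding red_sum_def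
  proof (rule sum_bijs_image)
    show "inj_on ?s I"
      by (rule inj_on_subset[OF inj_transpose]) simp
    show "red_term n l (\<lambda>i. 2 * b i) t z = red_term n l (\<lambda>i. 2 * b' i) t z"
      if "\<And>i. i \<in> {1..l} \<Longrightarrow> b i = b' i" for b b'
      using that by (intro red_term_cong) simp
  qed
  have step: "(z a - z (a + 1) - 1) * red_term n l (\<lambda>i. 2 * b i) t (z \<circ> ?s) =
     (z a - z (a + 1)) * red_term n l (\<lambda>i. 2 * ?s (b i)) t z - red_term n l (\<lambda>i. 2 * b i) t z"
    if "b \<in> bijs l I" for b
  proof (rule red_term_swap[OF a])
    show "inj_on b {1..l}" "\<not> (a \<in> b ` {1..l} \<and> a + 1 \<in> b ` {1..l})"
      using that False by (simp_all add: bijs_def bij_betw_def)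
  qed
  have "(z a - z (a + 1) - 1) * red_sum n l I t (z \<circ> ?s) =
      (z a - z (a + 1)) * (\<Sum>b\<in>bijs l I. red_term n l (\<lambda>i. 2 * ?s (b i)) t z) - red_sum n l I t z"
    unfolding red_sum_def sum_distrib_left sum_subtractf[symmetric] by (rule sum.cong[OF refl step])
  then show ?thesis
    by (simp only: im comp_apply)
qed


section \<open>The sum over a free variable\<close>

text \<open>
  In a bijection onto \<open>insert 0 J\<close>, the label \<open>0\<close> marks a free variable, which sits at an arbitrary
  position \<open>h\<close>. Moving it across a site \<open>a\<close> changes the term by the term with the free variable at
  \<open>a\<close>, if \<open>a \<notin> J\<close>. If \<open>a \<in> J\<close>, the changes cancel in pairs: exchange the free variable with the one
  at \<open>a\<close>.
\<close>

definition free_pos :: "nat \<Rightarrow> nat \<Rightarrow> nat" where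
  "free_pos h u = (if u = 0 then h else 2 * u)"

lemma free_pos_simps: "free_pos h 0 = h" "u \<noteq> 0 \<Longrightarrow> free_pos h u = 2 * u"
  by (simp_all add: free_pos_def)

text \<open>The positions 2a - 1, 2a and 2a + 1 compare alike with every site other than
  \<open>a\<close>. Only the factor at \<open>a\<close> changes, from x - z_a through 1 to x - z_a +
  1, so the difference of the outer rows is the middle one.\<close>

lemma zrow_red_beside:
  assumes "a \<in> {1..n}"
  shows "zrow_red n (2 * a + 1) x z = zrow_red n (2 * a) x z * (x - z a + 1)"
    and "zrow_red n (2 * a - 1) x z = zrow_red n (2 * a) x z * (x - z a)"
proof -
  define R where "R = (\<Prod>b\<in>{1..n} - {a}. zred (2 * a) (2 * b) (x - z b))"
  have split: "zrow_red n u x z = zred u (2 * a) (x - z a) * (\<Prod>b\<in>{1..n} - {a}. zred u (2 * b) (x - z b))" for u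
    unfolding zrow_red_def using assms by (simp add: prod.remove)
  have R: "(\<Prod>b\<in>{1..n} - {a}. zred u (2 * b) (x - z b)) = R"
    if "u = 2 * a \<or> u = 2 * a + 1 \<or> u = 2 * a - 1" for u
    unfolding R_def
  proof (intro prod.cong refl)
    fix b assume "b \<in> {1..n} - {a}"
    then have "b \<noteq> a" "1 \<le> a"
      using assms by simp_all
    then have "2 * b < u \<longleftrightarrow> 2 * b < 2 * a"
      using that by presburger
    moreover have "2 * b = u \<longleftrightarrow> 2 * b = 2 * a"
      using that \<open>b \<noteq> a\<close> \<open>1 \<le> a\<close> by presburger
    ultimately show "zred u (2 * b) (x - z b) = zred (2 * a) (2 * b) (x - z b)"
      by (simp add: zred_def)
  qed
  have "zred (2 * a + 1) (2 * a) y = y + 1" "zred (2 * a) (2 * a) y = 1"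
    "zred (2 * a - 1) (2 * a) y = y" for y :: 'a
    using assms by (auto simp: zred_def)
  then show "zrow_red n (2 * a + 1) x z = zrow_red n (2 * a) x z * (x - z a + 1)"
    and "zrow_red n (2 * a - 1) x z = zrow_red n (2 * a) x z * (x - z a)"
    unfolding split by (simp_all only: R simp_thms) (simp_all add: mult.commute)
qed

text \<open>No variable sits at \<open>a\<close>, hence crossing it affects only the row of the free
  variable, and (x - z_a + 1) - (x - z_a) = 1.\<close>

lemma red_term_free_step:
  assumes b: "b \<in> bijs l (insert 0 J)" and a: "a \<in> {1..n}" and J: "a \<notin> J" "0 \<notin> J"
  shows "red_term n l (\<lambda>i. free_pos (2 * a + 1) (b i)) t z -
    red_term n l (\<lambda>i. free_pos (2 * a - 1) (b i)) t z = red_term n l (\<lambda>i. free_pos (2 * a) (b i)) t z"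
proof -
  obtain p where p: "p \<in> {1..l}" "b p = 0"
    using bijsD(3)[OF b, of 0] by auto
  have other: "b i \<noteq> 0" if "i \<in> {1..l} - {p}" for i
    using bijsD(2)[OF b, of i p] that p by auto
  have at: "b i \<noteq> a" if "i \<in> {1..l}" for i
    using bijsD(1)[OF b that] a J by auto
  define M where "M = (\<Prod>i\<in>{1..l} - {p}. zrow_red n (2 * b i) (t i) z)"
  define Q where "Q = (\<Prod>(i, j)\<in>pairs l.
    tred (free_pos (2 * a) (b i)) (free_pos (2 * a) (b j)) (t i - t j))"
  have split: "red_term n l (\<lambda>i. free_pos h (b i)) t z = zrow_red n h (t p) z * M * Q"
    if h: "h = 2 * a \<or> h = 2 * a + 1 \<or> h = 2 * a - 1" for h
  proof -
    have "(\<Prod>i=1..l. zrow_red n (free_pos h (b i)) (t i) z) = zrow_red n h (t p) z *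
        (\<Prod>i\<in>{1..l} - {p}. zrow_red n (free_pos h (b i)) (t i) z)"
      using p by (simp add: prod.remove free_pos_simps)
    moreover have "(\<Prod>i\<in>{1..l} - {p}. zrow_red n (free_pos h (b i)) (t i) z) = M"
      unfolding M_def by (intro prod.cong refl) (simp only: free_pos_simps(2)[OF other])
    moreover have "(\<Prod>(i, j)\<in>pairs l. tred (free_pos h (b i)) (free_pos h (b j)) (t i - t j)) = Q"
      unfolding Q_def
    proof (intro prod.cong refl)
      fix e assume "e \<in> pairs l"
      then obtain i j where e: "e = (i, j)" "i \<in> {1..l}" "j \<in> {1..l}"
        by (auto simp: pairs_def)
      have "free_pos h (b i) < free_pos h (b j) \<longleftrightarrow> free_pos (2 * a) (b i) < free_pos (2 * a) (b j)"
      proof -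
        have "h < 2 * u \<longleftrightarrow> 2 * a < 2 * u" "2 * u < h \<longleftrightarrow> 2 * u < 2 * a" if "u \<noteq> a" for u
          using h that a by auto
        then show ?thesis
          using at[OF e(2)] at[OF e(3)] by (simp add: free_pos_def)
      qed
      then show "(case e of (i, j) \<Rightarrow> tred (free_pos h (b i)) (free_pos h (b j)) (t i - t j)) =
          (case e of (i, j) \<Rightarrow> tred (free_pos (2 * a) (b i)) (free_pos (2 * a) (b j)) (t i - t j))"
        by (simp add: e tred_def)
    qed
    ultimately show ?thesis
      by (simp add: red_term_def)
  qed
  have s: "red_term n l (\<lambda>i. free_pos (2 * a + 1) (b i)) t z =
      zrow_red n (2 * a) (t p) z * (t p - z a + 1) * M * Q"
    "red_term n l (\<lambda>i. free_pos (2 * a - 1) (b i)) t z = zrow_red n (2 * a) (t p) z * (t p - z a) * M * Q"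
    "red_term n l (\<lambda>i. free_pos (2 * a) (b i)) t z = zrow_red n (2 * a) (t p) z * M * Q"
    using split[of "2 * a + 1"] split[of "2 * a - 1"] split[of "2 * a"]
    unfolding zrow_red_beside[OF a] by simp_all
  show ?thesis
    unfolding s by (simp add: algebra_simps)
qed

text \<open>Crossing an occupied site also reverses the comparison with the variable there, so the
  change is no longer a single term; only the sum over both assignments of the two variables
  vanishes.\<close>

lemma sum_red_term_free_step_eq_0:
  fixes z :: "nat \<Rightarrow> 'a::{idom, ring_char_0}"
  assumes a: "a \<in> {1..n}" "a \<in> J" and J: "0 \<notin> J"
  shows "(\<Sum>b\<in>bijs l (insert 0 J). red_term n l (\<lambda>i. free_pos (2 * a + 1) (b i)) t z -
    red_term n l (\<lambda>i. free_pos (2 * a - 1) (b i)) t z) = 0"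
proof -
  let ?s = "transpose 0 a"
  define F where "F b = red_term n l (\<lambda>i. free_pos (2 * a + 1) (b i)) t z -
    red_term n l (\<lambda>i. free_pos (2 * a - 1) (b i)) t z" for b
  have a0: "0 < a"
    using a by simp
  have "(\<Sum>b\<in>bijs l (insert 0 J). F b) = 0"
  proof (rule sum_bijs_eq_0[of ?s _ _ _ 0 a])
    show "bij_betw ?s (insert 0 J) (insert 0 J)"
      using a by (intro permutes_imp_bij permutes_swap_id) auto
    show "F b = F b'" if "\<And>i. i \<in> {1..l} \<Longrightarrow> b i = b' i" for b b'
      using that unfolding F_def by (intro arg_cong2[of _ _ _ _ "(-)"] red_term_cong) simp_all
    fix b p q
    assume b: "b \<in> bijs l (insert 0 J)"
      and pq: "p \<in> {1..l}" "q \<in> {1..l}" "p < q" "b p = 0" "b q = a"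
    have at: "b i = 0 \<longleftrightarrow> i = p" "b i = a \<longleftrightarrow> i = q" if "i \<in> {1..l}" for i
      using bijsD(2)[OF b that pq(1)] bijsD(2)[OF b that pq(2)] pq(4,5) by simp_all
    have s: "?s (b i) = b i" if "i \<in> {1..l}" "i \<noteq> p" "i \<noteq> q" for i
      using at[OF that(1)] that by (simp add: transpose_def)
    have sb: "?s (b p) = a" "?s (b q) = 0"
      using pq by simp_all
    \<comment> \<open>The reference puts both \<open>p\<close> and \<open>q\<close> at 2a. This
      collision is invisible, since the pair (p, q) is left out of \<open>red_rest\<close> and all
      other variables compare with 2a as with its neighbours.\<close>
    define Q where "Q = red_rest n l p q (\<lambda>i. free_pos (2 * a) (b i)) t z"
    have Q: "red_rest n l p q (\<lambda>i. free_pos h (\<sigma> (b i))) t z = Q"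
      if h: "h = 2 * a + 1 \<or> h = 2 * a - 1" and \<sigma>: "\<sigma> = (\<lambda>u. u) \<or> \<sigma> = ?s" for h \<sigma>
      unfolding Q_def
    proof (rule red_rest_cong)
      have \<sigma>_other: "\<sigma> (b i) = b i" if "i \<in> {1..l}" "i \<noteq> p" "i \<noteq> q" for i
        using \<sigma> s[OF that] by metis
      have other: "free_pos h' (b i) = 2 * b i" "b i \<noteq> a" if "i \<in> {1..l}" "i \<noteq> p" "i \<noteq> q" for i h'
        using at[OF that(1)] that(2,3) by (simp_all add: free_pos_def)
      have \<sigma>_at: "\<sigma> (b i) = 0 \<or> \<sigma> (b i) = a" if "i = p \<or> i = q" for i
        using that \<sigma> sb pq(4,5) by metis
      have beside: "h + 1 = 2 * a \<or> h = 2 * a + 1"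
        using h a0 by linarith
      have near: "free_pos h (\<sigma> (b i)) + 1 = 2 * a \<or> free_pos h (\<sigma> (b i)) = 2 * a \<or>
          free_pos h (\<sigma> (b i)) = 2 * a + 1" if "i = p \<or> i = q" for i
        using \<sigma>_at[OF that] beside a0 by (elim disjE) (simp_all add: free_pos_def)
      have fp: "free_pos (2 * a) (b i) = 2 * a" if "i = p \<or> i = q" for i
        using that pq(4,5) a0 by (elim disjE) (simp_all add: free_pos_def)
      show "zrow_red n (free_pos h (\<sigma> (b i))) (t i) z = zrow_red n (free_pos (2 * a) (b i)) (t i) z"
        if "i \<in> {1..l}" "i \<noteq> p" "i \<noteq> q" for i
        by (simp only: \<sigma>_other[OF that] other(1)[OF that])
      show "free_pos h (\<sigma> (b i)) < free_pos h (\<sigma> (b j)) \<longleftrightarrow>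
          free_pos (2 * a) (b i) < free_pos (2 * a) (b j)"
        if ij: "(i, j) \<in> pairs l" "(i, j) \<noteq> (p, q)" for i j
      proof -
        have r: "i \<in> {1..l}" "j \<in> {1..l}" "i < j"
          using ij(1) by (auto simp: pairs_def)
        have not_both: "\<not> ((i = p \<or> i = q) \<and> (j = p \<or> j = q))"
          using ij(2) r(3) pq(3) by auto
        consider "i = p \<or> i = q" "j \<noteq> p" "j \<noteq> q" | "j = p \<or> j = q" "i \<noteq> p" "i \<noteq> q"
          | "i \<noteq> p" "i \<noteq> q" "j \<noteq> p" "j \<noteq> q"
          using not_both by blast
        then show ?thesis
        proof cases
          case 1
          show ?thesis
            unfolding fp[OF 1(1)] \<sigma>_other[OF r(2) 1(2,3)] other(1)[OF r(2) 1(2,3)]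
            using near[OF 1(1)] other(2)[OF r(2) 1(2,3)] by linarith
        next
          case 2
          show ?thesis
            unfolding fp[OF 2(1)] \<sigma>_other[OF r(1) 2(2,3)] other(1)[OF r(1) 2(2,3)]
            using near[OF 2(1)] other(2)[OF r(1) 2(2,3)] by linarith
        next
          case 3
          show ?thesis
            by (simp only: \<sigma>_other[OF r(1) 3(1,2)] \<sigma>_other[OF r(2) 3(3,4)]
                other(1)[OF r(1) 3(1,2)] other(1)[OF r(2) 3(3,4)])
        qed
      qed
    qed
    have Qs: "red_rest n l p q (\<lambda>i. free_pos (2 * a + 1) (b i)) t z = Q"
      "red_rest n l p q (\<lambda>i. free_pos (2 * a - 1) (b i)) t z = Q"
      "red_rest n l p q (\<lambda>i. free_pos (2 * a + 1) (?s (b i))) t z = Q"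
      "red_rest n l p q (\<lambda>i. free_pos (2 * a - 1) (?s (b i))) t z = Q"
      using Q[of "2 * a + 1" "\<lambda>u. u"] Q[of "2 * a - 1" "\<lambda>u. u"] Q[of "2 * a + 1" ?s]
        Q[of "2 * a - 1" ?s] by simp_all
    have T: "tred (2 * a + 1) (2 * a) y = y - 1" "tred (2 * a) (2 * a + 1) y = y + 1"
      "tred (2 * a - 1) (2 * a) y = y + 1" "tred (2 * a) (2 * a - 1) y = y - 1" for y :: 'a
      using a0 by (simp_all add: tred_def)
    have fp: "free_pos h 0 = h" "free_pos h a = 2 * a" for h
      using a0 by (simp_all add: free_pos_def)
    define R where "R = zrow_red n (2 * a) (t p) z"
    define S where "S = zrow_red n (2 * a) (t q) z"
    have assoc: "R * x * S * w * Q = R * S * Q * (x * w)" "R * (S * x) * w * Q = R * S * Q * (x * w)"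
      for x w
      by (simp_all add: mult_ac)
    have "F b = R * S * Q * ((t p - z a + 1) * (t p - t q - 1) - (t p - z a) * (t p - t q + 1))"
      unfolding F_def red_term_split[OF pq(1,2,3)] Qs pq(4,5) fp T zrow_red_beside[OF a(1)]
        R_def[symmetric] S_def[symmetric] assoc right_diff_distrib[symmetric] ..
    moreover have "F (?s \<circ> b) =
        R * S * Q * ((t q - z a + 1) * (t p - t q + 1) - (t q - z a) * (t p - t q - 1))"
      unfolding F_def red_term_split[OF pq(1,2,3)] comp_apply Qs sb fp T zrow_red_beside[OF a(1)]
        R_def[symmetric] S_def[symmetric] assoc right_diff_distrib[symmetric] ..
    \<comment> \<open>With A = t_p - z_a, B = t_q - z_a and y = A - B, the left-hand side expands to
      2y - 2(A - B).\<close>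
    moreover have "(t p - z a + 1) * (t p - t q - 1) - (t p - z a) * (t p - t q + 1) +
        ((t q - z a + 1) * (t p - t q + 1) - (t q - z a) * (t p - t q - 1)) = 0"
      by algebra
    ultimately show "F b + F (?s \<circ> b) = 0"
      by (simp only: distrib_left[symmetric] mult_zero_right)
  qed (use a in auto)
  then show ?thesis
    by (simp only: F_def)
qed

text \<open>The sites in \<open>J\<close> may be added to the sum because their steps vanish in
  total. Then the steps fit together, since the position 2a + 1 behind \<open>a\<close> is the
  position 2(a + 1) - 1 before \<open>a + 1\<close>.\<close>

lemma sum_red_sum_insert:
  fixes z :: "nat \<Rightarrow> 'a::{idom, ring_char_0}"
  assumes J: "J \<subseteq> {1..n}"
  shows "(\<Sum>a\<in>{1..n} - J. red_sum n l (insert a J) t z) =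
    (\<Sum>b\<in>bijs l (insert 0 J). red_term n l (\<lambda>i. free_pos (2 * n + 1) (b i)) t z -
      red_term n l (\<lambda>i. free_pos 1 (b i)) t z)"
proof -
  define T where "T h b = red_term n l (\<lambda>i. free_pos h (b i)) t z" for h b
  have J0: "0 \<notin> J"
    using J by auto
  have new: "red_sum n l (insert a J) t z = (\<Sum>b\<in>bijs l (insert 0 J). T (2 * a + 1) b - T (2 * a - 1) b)"
    if a: "a \<in> {1..n} - J" for a
  proof -
    \<comment> \<open>Giving the label 0 the value \<open>a\<close> turns configurations with the
      free variable at 2a into bijections onto \<open>insert a J\<close>.\<close>
    define g where "g u = (if u = 0 then a else u)" for u
    have gJ: "g u = u" if "u \<in> J" for u
      using J0 that by (metis g_def)
    have "g ` J = (\<lambda>u. u) ` J"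
      by (intro image_cong refl gJ)
    moreover have "g 0 = a"
      by (simp add: g_def)
    ultimately have "g ` insert 0 J = insert a J"
      by simp
    moreover have "inj_on g (insert 0 J)"
      using a J0 by (auto simp: inj_on_def g_def)
    ultimately have "red_sum n l (insert a J) t z =
        (\<Sum>b\<in>bijs l (insert 0 J). red_term n l (\<lambda>i. 2 * (g \<circ> b) i) t z)"
      using sum_bijs_image[of g "insert 0 J" l "\<lambda>b. red_term n l (\<lambda>i. 2 * b i) t z", OF _ red_term_cong]
      by (simp add: red_sum_def)
    also have "\<dots> = (\<Sum>b\<in>bijs l (insert 0 J). T (2 * a) b)"
      unfolding T_def by (intro sum.cong refl red_term_cong) (simp add: g_def free_pos_def)
    also have "\<dots> = (\<Sum>b\<in>bijs l (insert 0 J). T (2 * a + 1) b - T (2 * a - 1) b)"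
      unfolding T_def using a J0 by (intro sum.cong refl red_term_free_step[symmetric]) auto
    finally show ?thesis .
  qed
  have old: "(\<Sum>b\<in>bijs l (insert 0 J). T (2 * a + 1) b - T (2 * a - 1) b) = 0" if "a \<in> J" for a
    unfolding T_def using that J J0 by (intro sum_red_term_free_step_eq_0) auto
  have tele: "(\<Sum>a=1..m. T (2 * a + 1) b - T (2 * a - 1) b) = T (2 * m + 1) b - T 1 b" for m b
    by (induction m) simp_all
  have "(\<Sum>a\<in>{1..n} - J. red_sum n l (insert a J) t z) =
      (\<Sum>a\<in>{1..n} - J. \<Sum>b\<in>bijs l (insert 0 J). T (2 * a + 1) b - T (2 * a - 1) b)"
    by (intro sum.cong refl new)
  also have "\<dots> = (\<Sum>a\<in>{1..n}. \<Sum>b\<in>bijs l (insert 0 J). T (2 * a + 1) b - T (2 * a - 1) b)"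
    using old by (intro sum.mono_neutral_left) auto
  also have "\<dots> = (\<Sum>b\<in>bijs l (insert 0 J). T (2 * n + 1) b - T 1 b)"
    by (subst sum.swap) (simp only: tele)
  finally show ?thesis
    by (simp only: T_def)
qed

section \<open>Shifts of a variable\<close>

text \<open>When \<open>p\<close> moves from the lowest to the highest position, a pair (p, j)
  passes from [y + 1]_k' to [y + 1 - \<kappa>]_k', and a pair (i, p) the other way. Adding \<kappa>
  to t_p compensates both, exactly and not only modulo \<open>N\<close>.\<close>

lemma weight_term_shift:
  fixes t z z' :: "nat \<Rightarrow> 'a::comm_ring_1"
  assumes p: "p \<in> {1..l}"
    and row: "\<And>i x. i \<in> {1..l} \<Longrightarrow> i \<noteq> p \<Longrightarrow> zrow \<kappa> k n (c i) x z = zrow \<kappa> k n (c' i) x z'"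
    and row_p: "\<And>x. zrow \<kappa> k n (c p) x z = zrow \<kappa> k n (c' p) (x + of_int \<kappa>) z'"
    and order: "\<And>i j. i \<in> {1..l} \<Longrightarrow> j \<in> {1..l} \<Longrightarrow> i \<noteq> p \<Longrightarrow> j \<noteq> p \<Longrightarrow> c i < c j \<longleftrightarrow> c' i < c' j"
    and order_p: "\<And>j. j \<in> {1..l} \<Longrightarrow> j \<noteq> p \<Longrightarrow> c p < c j \<and> c' j < c' p"
  shows "weight_term \<kappa> k k' n l c t z = weight_term \<kappa> k k' n l c' (t(p := t p + of_int \<kappa>)) z'"
  unfolding weight_term_def
proof (intro arg_cong2[of _ _ _ _ "(*)"] prod.cong refl)
  show "zrow \<kappa> k n (c i) (t i) z = zrow \<kappa> k n (c' i) ((t(p := t p + of_int \<kappa>)) i) z'"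
    if "i \<in> {1..l}" for i
    using that row row_p by auto
next
  fix e assume "e \<in> pairs l"
  then obtain i j where e: "e = (i, j)" "i \<in> {1..l}" "j \<in> {1..l}" "i < j"
    by (auto simp: pairs_def)
  have "tfac \<kappa> k' (c i) (c j) (t i - t j) = tfac \<kappa> k' (c' i) (c' j)
      ((t(p := t p + of_int \<kappa>)) i - (t(p := t p + of_int \<kappa>)) j)"
  proof -
    consider "i = p" "j \<noteq> p" | "i \<noteq> p" "j = p" | "i \<noteq> p" "j \<noteq> p"
      using e(4) by blast
    then show ?thesis
    proof cases
      case 1
      then show ?thesis
        using order_p[OF e(3) 1(2)] by (simp add: tfac_def algebra_simps)
    next
      case 2
      then show ?thesis
        using order_p[OF e(2) 2(1)] by (simp add: tfac_def algebra_simps)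
    next
      case 3
      then show ?thesis
        using order[OF e(2,3) 3] by (simp add: tfac_def)
    qed
  qed
  then show "(case e of (i, j) \<Rightarrow> tfac \<kappa> k' (c i) (c j) (t i - t j)) = (case e of (i, j) \<Rightarrow>
      tfac \<kappa> k' (c' i) (c' j) ((t(p := t p + of_int \<kappa>)) i - (t(p := t p + of_int \<kappa>)) j))"
    by (simp add: e)
qed

text \<open>Position 1 is below and 2n + 1 above all sites, so the row of the free variable consists
  of factors [x]_k at one end and [x - \<kappa>]_k at the other.\<close>

lemma weight_term_free_shift:
  assumes b: "b \<in> bijs l (insert 0 J)" and J: "J \<subseteq> {1..n}" and p: "p \<in> {1..l}" "b p = 0"
  shows "weight_term \<kappa> k k' n l (\<lambda>i. free_pos 1 (b i)) t z =
    weight_term \<kappa> k k' n l (\<lambda>i. free_pos (2 * n + 1) (b i)) (t(p := t p + of_int \<kappa>)) z"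
proof (rule weight_term_shift[OF p(1)])
  have range: "b i \<in> {1..n}" if "i \<in> {1..l}" "i \<noteq> p" for i
    using bijsD(1)[OF b that(1)] bijsD(2)[OF b that(1) p(1)] that p J by auto
  show "zrow \<kappa> k n (free_pos 1 (b i)) x z = zrow \<kappa> k n (free_pos (2 * n + 1) (b i)) x z"
    if "i \<in> {1..l}" "i \<noteq> p" for i x
    using range[OF that] by (simp add: free_pos_def)
  show "zrow \<kappa> k n (free_pos 1 (b p)) x z = zrow \<kappa> k n (free_pos (2 * n + 1) (b p)) (x + of_int \<kappa>) z"
    for x
    unfolding p(2) free_pos_simps zrow_def
    by (intro prod.cong refl) (auto simp: zfac_def algebra_simps)
  show "free_pos 1 (b i) < free_pos 1 (b j) \<longleftrightarrow> free_pos (2 * n + 1) (b i) < free_pos (2 * n + 1) (b j)"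
    if "i \<in> {1..l}" "j \<in> {1..l}" "i \<noteq> p" "j \<noteq> p" for i j
    using range[OF that(1,3)] range[OF that(2,4)] by (simp add: free_pos_def)
  show "free_pos 1 (b p) < free_pos 1 (b j) \<and> free_pos (2 * n + 1) (b j) < free_pos (2 * n + 1) (b p)"
    if "j \<in> {1..l}" "j \<noteq> p" for j
    using range[OF that] p by (simp add: free_pos_def)
qed

section \<open>Cyclic rotation of the sites\<close>

definition rotate_site :: "nat \<Rightarrow> nat \<Rightarrow> nat" where
  "rotate_site n a = (if a = 1 then n else a - 1)"

text \<open>The parameter z_1 moves from the first to the last site. For a variable elsewhere, the
  \<kappa> in z_1 - \<kappa> cancels the shift caused by a site below it:
  [x - (z_1 - \<kappa>) - \<kappa>]_k = [x - z_1]_k. A variable at site 1 moves along with z_1 to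
  the top, which costs a shift of its own.\<close>

lemma zrow_rotate:
  fixes z :: "nat \<Rightarrow> 'a::comm_ring_1"
  assumes "1 \<le> n"
  defines "z' \<equiv> \<lambda>a. if a < n then z (a + 1) else z 1"
  shows "2 \<le> u \<Longrightarrow> u \<le> n \<Longrightarrow>
      zrow \<kappa> k n (2 * u) x (z(1 := z 1 - of_int \<kappa>)) = zrow \<kappa> k n (2 * (u - 1)) x z'"
    and "zrow \<kappa> k n 2 x (z(1 := z 1 - of_int \<kappa>)) = zrow \<kappa> k n (2 * n) (x + of_int \<kappa>) z'"
proof -
  have L: "zrow \<kappa> k n w x (z(1 := z 1 - of_int \<kappa>)) =
      zfac \<kappa> k w 2 (x - z 1 + of_int \<kappa>) * (\<Prod>a\<in>{1..<n}. zfac \<kappa> k w (2 * (a + 1)) (x - z (a + 1)))"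
    for w x
  proof -
    have "(\<Prod>a=1..n. f a) = f 1 * (\<Prod>a\<in>{1..<n}. f (a + 1))" for f :: "nat \<Rightarrow> 'a"
      using assms prod.atLeast_Suc_atMost[of 1 n f] prod.shift_bounds_Suc_ivl[of f 1 n]
      by (simp add: atLeastLessThanSuc_atLeastAtMost)
    moreover have "(\<Prod>a\<in>{1..<n}. zfac \<kappa> k w (2 * (a + 1)) (x - (z(1 := z 1 - of_int \<kappa>)) (a + 1))) =
        (\<Prod>a\<in>{1..<n}. zfac \<kappa> k w (2 * (a + 1)) (x - z (a + 1)))"
      by (intro prod.cong) simp_all
    moreover have "x - (z(1 := z 1 - of_int \<kappa>)) 1 = x - z 1 + of_int \<kappa>" "2 * (1 :: nat) = 2"
      by simp_all
    ultimately show ?thesis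
      unfolding zrow_def by (simp only:)
  qed
  have R: "zrow \<kappa> k n w x z' =
      zfac \<kappa> k w (2 * n) (x - z 1) * (\<Prod>a\<in>{1..<n}. zfac \<kappa> k w (2 * a) (x - z (a + 1)))" for w x
  proof -
    have "{1..n} = insert n {1..<n}"
      using assms by auto
    then show ?thesis
      unfolding zrow_def by (simp add: z'_def)
  qed
  show "zrow \<kappa> k n (2 * u) x (z(1 := z 1 - of_int \<kappa>)) = zrow \<kappa> k n (2 * (u - 1)) x z'"
    if "2 \<le> u" "u \<le> n"
    unfolding L R using that
    by (intro arg_cong2[of _ _ _ _ "(*)"] prod.cong refl) (auto simp: zfac_def)
  show "zrow \<kappa> k n 2 x (z(1 := z 1 - of_int \<kappa>)) = zrow \<kappa> k n (2 * n) (x + of_int \<kappa>) z'"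
    unfolding L R using assms(1)
    by (intro arg_cong2[of _ _ _ _ "(*)"] prod.cong refl) (auto simp: zfac_def algebra_simps)
qed

text \<open>Rotation preserves the order of the sites other than 1 and takes site 1 from the bottom
  to the top, which is the situation of \<open>weight_term_shift\<close> when that site is
  occupied.\<close>

lemma weight_term_rotate:
  fixes z :: "nat \<Rightarrow> 'a::comm_ring_1"
  assumes n: "1 \<le> n" and b: "b \<in> bijs l I" and I: "I \<subseteq> {1..n}"
  defines "z' \<equiv> \<lambda>a. if a < n then z (a + 1) else z 1"
  shows "1 \<notin> I \<Longrightarrow> weight_term \<kappa> k k' n l (\<lambda>i. 2 * b i) t (z(1 := z 1 - of_int \<kappa>)) =
      weight_term \<kappa> k k' n l (\<lambda>i. 2 * rotate_site n (b i)) t z'"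
    and "p \<in> {1..l} \<Longrightarrow> b p = 1 \<Longrightarrow>
      weight_term \<kappa> k k' n l (\<lambda>i. 2 * b i) t (z(1 := z 1 - of_int \<kappa>)) =
      weight_term \<kappa> k k' n l (\<lambda>i. 2 * rotate_site n (b i)) (t(p := t p + of_int \<kappa>)) z'"
proof -
  have range: "1 \<le> b i" "b i \<le> n" if "i \<in> {1..l}" for i
    using bijsD(1)[OF b that] I by auto
  have row: "zrow \<kappa> k n (2 * b i) x (z(1 := z 1 - of_int \<kappa>)) = zrow \<kappa> k n (2 * rotate_site n (b i)) x z'"
    if "i \<in> {1..l}" "b i \<noteq> 1" for i x
    using zrow_rotate(1)[OF n, of "b i"] range[OF that(1)] that(2) unfolding z'_def
    by (simp add: rotate_site_def)
  have order: "2 * b i < 2 * b j \<longleftrightarrow> 2 * rotate_site n (b i) < 2 * rotate_site n (b j)"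
    if "i \<in> {1..l}" "j \<in> {1..l}" "b i \<noteq> 1" "b j \<noteq> 1" for i j
    using range[OF that(1)] range[OF that(2)] that by (auto simp: rotate_site_def)
  show "weight_term \<kappa> k k' n l (\<lambda>i. 2 * b i) t (z(1 := z 1 - of_int \<kappa>)) =
      weight_term \<kappa> k k' n l (\<lambda>i. 2 * rotate_site n (b i)) t z'" if "1 \<notin> I"
  proof -
    have b1: "b i \<noteq> 1" if "i \<in> {1..l}" for i
      using bijsD(1)[OF b that] \<open>1 \<notin> I\<close> by metis
    show ?thesis
      unfolding weight_term_def
    proof (intro arg_cong2[of _ _ _ _ "(*)"] prod.cong refl)
      fix e assume "e \<in> pairs l"
      then obtain i j where e: "e = (i, j)" "i \<in> {1..l}" "j \<in> {1..l}"
        by (auto simp: pairs_def)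
      show "(case e of (i, j) \<Rightarrow> tfac \<kappa> k' (2 * b i) (2 * b j) (t i - t j)) =
          (case e of (i, j) \<Rightarrow>
             tfac \<kappa> k' (2 * rotate_site n (b i)) (2 * rotate_site n (b j)) (t i - t j))"
        using order[OF e(2,3) b1[OF e(2)] b1[OF e(3)]] by (simp add: e(1) tfac_def)
    qed (rule row, assumption, erule b1)
  qed
  show "weight_term \<kappa> k k' n l (\<lambda>i. 2 * b i) t (z(1 := z 1 - of_int \<kappa>)) =
      weight_term \<kappa> k k' n l (\<lambda>i. 2 * rotate_site n (b i)) (t(p := t p + of_int \<kappa>)) z'"
    if p: "p \<in> {1..l}" "b p = 1"
  proof (rule weight_term_shift[OF p(1)])
    have b1: "b i \<noteq> 1" if "i \<in> {1..l}" "i \<noteq> p" for i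
      using bijsD(2)[OF b that(1) p(1)] that p by simp
    show "zrow \<kappa> k n (2 * b i) x (z(1 := z 1 - of_int \<kappa>)) =
        zrow \<kappa> k n (2 * rotate_site n (b i)) x z'" if "i \<in> {1..l}" "i \<noteq> p" for i x
      by (rule row[OF that(1) b1[OF that]])
    show "zrow \<kappa> k n (2 * b p) x (z(1 := z 1 - of_int \<kappa>)) =
        zrow \<kappa> k n (2 * rotate_site n (b p)) (x + of_int \<kappa>) z'" for x
      using zrow_rotate(2)[OF n] unfolding z'_def p(2) by (simp add: rotate_site_def)
    show "2 * b i < 2 * b j \<longleftrightarrow> 2 * rotate_site n (b i) < 2 * rotate_site n (b j)"
      if "i \<in> {1..l}" "j \<in> {1..l}" "i \<noteq> p" "j \<noteq> p" for i j
      by (rule order[OF that(1,2) b1[OF that(1,3)] b1[OF that(2,4)]])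
    show "2 * b p < 2 * b j \<and> 2 * rotate_site n (b j) < 2 * rotate_site n (b p)"
      if "j \<in> {1..l}" "j \<noteq> p" for j
      using range[OF that(1)] b1[OF that] p by (simp add: rotate_site_def)
  qed
qed


section \<open>Congruences in subrings\<close>

locale sub_ring =
  fixes S :: "'a::comm_ring_1 set"
  assumes of_int_mem [simp]: "of_int c \<in> S"
    and add_mem: "x \<in> S \<Longrightarrow> y \<in> S \<Longrightarrow> x + y \<in> S"
    and mult_mem: "x \<in> S \<Longrightarrow> y \<in> S \<Longrightarrow> x * y \<in> S"
begin

lemma zero_mem [simp]: "0 \<in> S" and one_mem [simp]: "1 \<in> S"
  using of_int_mem[of 0] of_int_mem[of 1] by simp_all

lemma of_nat_mem [simp]: "of_nat m \<in> S"
  using of_int_mem[of "int m"] by simp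

lemma diff_mem: "x \<in> S \<Longrightarrow> y \<in> S \<Longrightarrow> x - y \<in> S"
  using add_mem[of x "of_int (- 1) * y"] mult_mem[of "of_int (- 1)" y] of_int_mem[of "- 1"] by simp

lemma sum_mem: "(\<And>x. x \<in> X \<Longrightarrow> f x \<in> S) \<Longrightarrow> sum f X \<in> S"
  by (induction X rule: infinite_finite_induct) (simp_all add: add_mem)

lemma prod_mem: "(\<And>x. x \<in> X \<Longrightarrow> f x \<in> S) \<Longrightarrow> prod f X \<in> S"
  by (induction X rule: infinite_finite_induct) (simp_all add: mult_mem)

lemma poch_mem: "x \<in> S \<Longrightarrow> poch \<kappa> x m \<in> S"
  unfolding poch_def by (intro prod_mem diff_mem of_int_mem)

text \<open>The quotient must lie in \<open>S\<close> too: it will be integrated, and its Pochhammer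
  expansion is obtained from its being a polynomial in t_1, ..., t_l.\<close>

definition cong_mod :: "int \<Rightarrow> 'a \<Rightarrow> 'a \<Rightarrow> bool" where
  "cong_mod N x y \<longleftrightarrow> x \<in> S \<and> y \<in> S \<and> (\<exists>q\<in>S. x - y = of_int N * q)"

lemma cong_mod_refl: "x \<in> S \<Longrightarrow> cong_mod N x x"
  unfolding cong_mod_def by (auto intro!: bexI[of _ 0])

lemma cong_mod_mult:
  assumes "cong_mod N x y" and "cong_mod N x' y'"
  shows "cong_mod N (x * x') (y * y')"
proof -
  obtain q q' where q: "q \<in> S" "x - y = of_int N * q" "q' \<in> S" "x' - y' = of_int N * q'"
    using assms by (auto simp: cong_mod_def)
  have "x * x' - y * y' = (x - y) * x' + y * (x' - y')"
    by (simp add: algebra_simps)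
  also have "\<dots> = of_int N * (q * x' + y * q')"
    unfolding q by (simp add: algebra_simps)
  finally show ?thesis
    using assms q by (auto simp: cong_mod_def intro!: bexI[of _ "q * x' + y * q'"] add_mem mult_mem)
qed

lemma cong_mod_add:
  assumes "cong_mod N x y" and "cong_mod N x' y'"
  shows "cong_mod N (x + x') (y + y')"
proof -
  obtain q q' where q: "q \<in> S" "x - y = of_int N * q" "q' \<in> S" "x' - y' = of_int N * q'"
    using assms by (auto simp: cong_mod_def)
  have "x + x' - (y + y') = (x - y) + (x' - y')"
    by simp
  also have "\<dots> = of_int N * (q + q')"
    unfolding q by (simp add: algebra_simps)
  finally show ?thesis
    using assms q by (auto simp: cong_mod_def intro!: bexI[of _ "q + q'"] add_mem)
qed

lemma cong_mod_sym: "cong_mod N x y \<Longrightarrow> cong_mod N y x"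
proof -
  assume a: "cong_mod N x y"
  then obtain q where q: "q \<in> S" "x - y = of_int N * q"
    by (auto simp: cong_mod_def)
  then have "y - x = of_int N * (0 - q)"
    by (simp add: algebra_simps)
  then show ?thesis
    using a q by (auto simp: cong_mod_def intro!: bexI[of _ "0 - q"] diff_mem)
qed

lemma cong_mod_trans: "cong_mod N x y \<Longrightarrow> cong_mod N y w \<Longrightarrow> cong_mod N x w"
proof -
  assume a: "cong_mod N x y" "cong_mod N y w"
  then obtain q q' where q: "q \<in> S" "x - y = of_int N * q" "q' \<in> S" "y - w = of_int N * q'"
    by (auto simp: cong_mod_def)
  have "x - w = (x - y) + (y - w)"
    by simp
  also have "\<dots> = of_int N * (q + q')"
    unfolding q by (simp add: algebra_simps)
  finally show ?thesis
    using a q by (auto simp: cong_mod_def intro!: bexI[of _ "q + q'"] add_mem)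
qed

lemma cong_mod_diff:
  assumes "cong_mod N x y" and "cong_mod N x' y'"
  shows "cong_mod N (x - x') (y - y')"
proof -
  have "cong_mod N (of_int (- 1) * x') (of_int (- 1) * y')"
    by (intro cong_mod_mult assms cong_mod_refl of_int_mem)
  from cong_mod_add[OF assms(1) this] show ?thesis
    by simp
qed

lemma cong_mod_sum: "(\<And>x. x \<in> X \<Longrightarrow> cong_mod N (f x) (g x)) \<Longrightarrow> cong_mod N (sum f X) (sum g X)"
  by (induction X rule: infinite_finite_induct) (simp_all add: cong_mod_add cong_mod_refl)

lemma cong_mod_prod: "(\<And>x. x \<in> X \<Longrightarrow> cong_mod N (f x) (g x)) \<Longrightarrow> cong_mod N (prod f X) (prod g X)"
  by (induction X rule: infinite_finite_induct) (simp_all add: cong_mod_mult cong_mod_refl)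

end

section \<open>Expansions in Pochhammer polynomials\<close>

lemma poch_0 [simp]: "poch \<kappa> x 0 = 1"
  by (simp add: poch_def)

lemma poch_Suc: "poch \<kappa> x (Suc m) = poch \<kappa> x m * (x - of_int (int m * \<kappa>))"
  by (simp add: poch_def)

lemma poch_Suc_left: "poch \<kappa> x (Suc m) = x * poch \<kappa> (x - of_int \<kappa>) m"
  by (induction m) (simp_all add: poch_Suc algebra_simps)

text \<open>[x + \<kappa>]_m and [x]_m share the factor [x]_(m-1). For m = 0 the truncated
  \<open>m - 1\<close> does no harm, as its coefficient is 0.\<close>

lemma poch_shift:
  "poch \<kappa> (x + of_int \<kappa>) m = poch \<kappa> x m + of_int (int m * \<kappa>) * poch \<kappa> x (m - 1)"
proof (cases m)
  case (Suc j)
  have "poch \<kappa> (x + of_int \<kappa>) (Suc j) = (x + of_int \<kappa>) * poch \<kappa> x j"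
    by (simp add: poch_Suc_left)
  then show ?thesis
    unfolding Suc by (simp add: poch_Suc algebra_simps)
qed simp

lemma poch_of_int_eq_0: "a < b \<Longrightarrow> poch \<kappa> (of_int (\<kappa> * int a)) b = 0"
  unfolding poch_def by (rule prod_zero) (auto intro!: bexI[of _ "a + 1"] simp: algebra_simps)

lemma poch_of_int_neq_0:
  assumes "\<kappa> \<noteq> 0"
  shows "poch \<kappa> (of_int (\<kappa> * int a)) a \<noteq> (0 :: 'a::{idom, ring_char_0})"
proof -
  have "of_int (\<kappa> * int a) - of_int ((int i - 1) * \<kappa>) \<noteq> (0 :: 'a)" if "i \<in> {1..a}" for i
  proof -
    have "\<kappa> * int a - (int i - 1) * \<kappa> = \<kappa> * (int a - int i + 1)"
      by (simp add: algebra_simps)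
    also have "\<dots> \<noteq> 0"
      using that assms by simp
    finally show ?thesis
      unfolding of_int_diff[symmetric] by (simp only: of_int_eq_0_iff not_False_eq_True)
  qed
  then show ?thesis
    by (simp add: poch_def)
qed

definition poch_monom :: "int \<Rightarrow> nat \<Rightarrow> (nat \<Rightarrow> nat) \<Rightarrow> tzpoly" where
  "poch_monom \<kappa> l m = (\<Prod>i=1..l. poch \<kappa> (t_var i) (m i))"

text \<open>The property by which \<open>poch_coeffs\<close> selects the coefficients.\<close>

definition poch_expansion :: "int \<Rightarrow> nat \<Rightarrow> ((nat \<Rightarrow> nat) \<Rightarrow> zpoly) \<Rightarrow> tzpoly \<Rightarrow> bool" where
  "poch_expansion \<kappa> l c g \<longleftrightarrow> finite {m. c m \<noteq> 0} \<and> {m. c m \<noteq> 0} \<subseteq> {1..l} \<rightarrow>\<^sub>E UNIV \<and>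
     g = (\<Sum>m | c m \<noteq> 0. Const (c m) * poch_monom \<kappa> l m)"

lemma Const_simps [simp]:
  "Const 0 = (0 :: 'a::comm_ring_1 mpoly)" "Const 1 = (1 :: 'a mpoly)"
  "Const (of_int c) = (of_int c :: 'a mpoly)" "Const (- 1) = (- 1 :: 'a mpoly)"
  by (rule comm_ring_hom.hom_zero comm_ring_hom.hom_one comm_ring_hom.hom_of_int
      comm_ring_hom.hom_uminus[where x = 1 and h = Const, unfolded comm_ring_hom.hom_one[OF comm_ring_hom_Const]];
      rule comm_ring_hom_Const)+

lemmas Const_add = comm_ring_hom.hom_add[OF comm_ring_hom_Const]
lemmas Const_diff = comm_ring_hom.hom_diff[OF comm_ring_hom_Const]
lemmas Const_mult = comm_ring_hom.hom_mult[OF comm_ring_hom_Const]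

lemma poch_expansionI:
  assumes "finite M" and "{m. c m \<noteq> 0} \<subseteq> M" and "M \<subseteq> {1..l} \<rightarrow>\<^sub>E UNIV"
    and "g = (\<Sum>m\<in>M. Const (c m) * poch_monom \<kappa> l m)"
  shows "poch_expansion \<kappa> l c g"
proof -
  have "(\<Sum>m\<in>M. Const (c m) * poch_monom \<kappa> l m) = (\<Sum>m | c m \<noteq> 0. Const (c m) * poch_monom \<kappa> l m)"
    using assms by (intro sum.mono_neutral_right) auto
  moreover have "finite {m. c m \<noteq> 0}"
    using assms(1,2) by (rule finite_subset[rotated])
  ultimately show ?thesis
    using assms by (auto simp: poch_expansion_def)
qed

lemma poch_expansion_superset:
  assumes "poch_expansion \<kappa> l c g" and "finite M" and "{m. c m \<noteq> 0} \<subseteq> M"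
  shows "g = (\<Sum>m\<in>M. Const (c m) * poch_monom \<kappa> l m)"
proof -
  have "(\<Sum>m\<in>M. Const (c m) * poch_monom \<kappa> l m) = (\<Sum>m | c m \<noteq> 0. Const (c m) * poch_monom \<kappa> l m)"
    using assms by (intro sum.mono_neutral_right) auto
  then show ?thesis
    using assms(1) by (simp add: poch_expansion_def)
qed

lemma poch_expansion_add:
  assumes "poch_expansion \<kappa> l c g" and "poch_expansion \<kappa> l c' g'"
  shows "poch_expansion \<kappa> l (\<lambda>m. c m + c' m) (g + g')"
proof -
  let ?M = "{m. c m \<noteq> 0} \<union> {m. c' m \<noteq> 0}"
  have M: "finite ?M" "?M \<subseteq> {1..l} \<rightarrow>\<^sub>E UNIV"
    using assms by (auto simp: poch_expansion_def)
  have "g = (\<Sum>m\<in>?M. Const (c m) * poch_monom \<kappa> l m)"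
    by (rule poch_expansion_superset[OF assms(1) M(1)]) auto
  moreover have "g' = (\<Sum>m\<in>?M. Const (c' m) * poch_monom \<kappa> l m)"
    by (rule poch_expansion_superset[OF assms(2) M(1)]) auto
  ultimately have "g + g' = (\<Sum>m\<in>?M. Const (c m + c' m) * poch_monom \<kappa> l m)"
    by (simp only: Const_add distrib_right sum.distrib)
  then show ?thesis
    by (intro poch_expansionI[of ?M] M) auto
qed

lemma poch_expansion_map:
  assumes "poch_expansion \<kappa> l c g" and "h 0 = 0"
    and H_sum: "\<And>f (X :: (nat \<Rightarrow> nat) set). H (sum f X) = (\<Sum>x\<in>X. H (f x))"
    and H: "\<And>m. H (Const (c m) * poch_monom \<kappa> l m) = Const (h (c m)) * poch_monom \<kappa> l m"
  shows "poch_expansion \<kappa> l (\<lambda>m. h (c m)) (H g)"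
proof (rule poch_expansionI[of "{m. c m \<noteq> 0}"])
  have "H g = H (\<Sum>m | c m \<noteq> 0. Const (c m) * poch_monom \<kappa> l m)"
    using assms(1) by (simp add: poch_expansion_def)
  then show "H g = (\<Sum>m | c m \<noteq> 0. Const (h (c m)) * poch_monom \<kappa> l m)"
    by (simp only: H_sum H)
qed (use assms(1,2) in \<open>auto simp: poch_expansion_def\<close>)

lemma poch_expansion_scale:
  assumes "poch_expansion \<kappa> l c g"
  shows "poch_expansion \<kappa> l (\<lambda>m. d * c m) (Const d * g)"
  by (rule poch_expansion_map[OF assms]) (simp_all add: Const_mult mult.assoc sum_distrib_left)

lemma poch_expansion_single:
  assumes "m \<in> {1..l} \<rightarrow>\<^sub>E UNIV"
  shows "poch_expansion \<kappa> l (\<lambda>m'. if m' = m then d else 0) (Const d * poch_monom \<kappa> l m)"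
  by (rule poch_expansionI[of "{m}"]) (use assms in \<open>auto split: if_splits\<close>)

lemma poch_expansion_0: "poch_expansion \<kappa> l (\<lambda>_. 0) 0"
  by (rule poch_expansionI[of "{}"]) auto

text \<open>
  Evaluate at \<open>t\<^sub>i = \<kappa> m\<^sub>i\<close>, where \<open>m\<close> has minimal degree among the indices of nonzero coefficients.
\<close>

lemma poch_expansion_0_unique:
  assumes "poch_expansion \<kappa> l c 0" and \<kappa>: "\<kappa> \<noteq> 0"
  shows "c m = 0"
proof (rule ccontr)
  assume "c m \<noteq> 0"
  then obtain m where m: "c m \<noteq> 0" and min: "\<And>m'. c m' \<noteq> 0 \<Longrightarrow> (\<Sum>i=1..l. m i) \<le> (\<Sum>i=1..l. m' i)"
    using arg_min_nat_lemma[of "\<lambda>m. c m \<noteq> 0" m "\<lambda>m. \<Sum>i=1..l. m i"] by blast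
  let ?M = "{m. c m \<noteq> 0}"
  have M: "finite ?M" "\<And>m. c m \<noteq> 0 \<Longrightarrow> m \<in> {1..l} \<rightarrow>\<^sub>E UNIV"
    using assms by (auto simp: poch_expansion_def)
  define ev :: "tzpoly \<Rightarrow> zpoly" where "ev = mpoly_eval id (\<lambda>i. of_int (\<kappa> * int (m i)))"
  have hom: "comm_ring_hom ev"
    unfolding ev_def by (rule comm_ring_hom_mpoly_eval[OF comm_ring_hom_id])
  have ev: "ev (poch_monom \<kappa> l m') = (\<Prod>i=1..l. poch \<kappa> (of_int (\<kappa> * int (m i))) (m' i))" for m'
    unfolding poch_monom_def comm_ring_hom.hom_prod[OF hom] comm_ring_hom.hom_poch[OF hom]
    by (simp only: ev_def mpoly_eval_Var[OF comm_ring_hom_id])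
  have ev_Const: "ev (Const d) = d" for d
    by (simp add: ev_def mpoly_eval_Const[OF comm_ring_hom_id])
  have zero: "ev (poch_monom \<kappa> l m') = 0" if m': "c m' \<noteq> 0" "m' \<noteq> m" for m'
  proof -
    \<comment> \<open>Otherwise m' would be below m entrywise and different from it, contradicting
      the minimal degree of m. At such an index i the factor [\<kappa> m_i]_(m'_i) vanishes.\<close>
    have "\<exists>i\<in>{1..l}. m i < m' i"
    proof (rule ccontr)
      assume *: "\<not> (\<exists>i\<in>{1..l}. m i < m' i)"
      obtain i where i: "i \<in> {1..l}" "m' i \<noteq> m i"
        using PiE_ext[OF M(2)[OF m'(1)] M(2)[OF m]] m'(2) by blast
      have "(\<Sum>i=1..l. m' i) < (\<Sum>i=1..l. m i)"
      proof (rule sum_strict_mono_ex1)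
        show "\<forall>i\<in>{1..l}. m' i \<le> m i"
          using * by (simp add: not_less)
        then show "\<exists>i\<in>{1..l}. m' i < m i"
          using i by (metis order_neq_le_trans)
      qed simp
      then show False
        using min[OF m'(1)] by simp
    qed
    then show ?thesis
      unfolding ev by (intro prod_zero) (use poch_of_int_eq_0 in blast)+
  qed
  have nonzero: "ev (poch_monom \<kappa> l m) \<noteq> 0"
    unfolding ev by (simp add: poch_of_int_neq_0[OF \<kappa>] del: of_int_mult)
  have "0 = ev (\<Sum>m'\<in>?M. Const (c m') * poch_monom \<kappa> l m')"
    using assms(1) comm_ring_hom.hom_zero[OF hom] by (simp add: poch_expansion_def)
  also have "\<dots> = (\<Sum>m'\<in>?M. c m' * ev (poch_monom \<kappa> l m'))"
    by (simp only: comm_ring_hom.hom_sum[OF hom] comm_ring_hom.hom_mult[OF hom] ev_Const)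
  also have "\<dots> = (\<Sum>m'\<in>{m}. c m' * ev (poch_monom \<kappa> l m'))"
    using M(1) m zero by (intro sum.mono_neutral_right) auto
  also have "\<dots> \<noteq> 0"
    using m nonzero by simp
  finally show False
    by simp
qed

lemma poch_coeffs_eq:
  assumes c: "poch_expansion \<kappa> l c g" and \<kappa>: "\<kappa> \<noteq> 0"
  shows "poch_coeffs \<kappa> l g = c"
proof -
  have "c' = c" if c': "poch_expansion \<kappa> l c' g" for c'
  proof
    fix m
    have "poch_expansion \<kappa> l (\<lambda>m. c' m + (- 1) * c m) (g + Const (- 1) * g)"
      by (intro poch_expansion_add poch_expansion_scale c c')
    moreover have "g + Const (- 1) * g = 0"
      by simp
    ultimately have "c' m + (- 1) * c m = 0"
      using poch_expansion_0_unique[OF _ \<kappa>] by (metis (no_types, lifting))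
    then show "c' m = c m"
      by simp
  qed
  then show ?thesis
    unfolding poch_coeffs_def poch_monom_def[symmetric] poch_expansion_def[symmetric]
    using c by (intro the_equality)
qed

section \<open>Existence of expansions and operations on coefficients\<close>

text \<open>Adding one basis term at a time lets expansions, and later their shifts, be built by
  induction.\<close>

inductive_set poch_span :: "int \<Rightarrow> nat \<Rightarrow> zpoly set \<Rightarrow> tzpoly set" for \<kappa> l A where
  zero: "0 \<in> poch_span \<kappa> l A"
| add: "g \<in> poch_span \<kappa> l A \<Longrightarrow> m \<in> {1..l} \<rightarrow>\<^sub>E UNIV \<Longrightarrow> d \<in> A \<Longrightarrow>
    g + Const d * poch_monom \<kappa> l m \<in> poch_span \<kappa> l A"

text \<open>The subalgebra generated by t_1, ..., t_l over \<open>A\<close>; the subring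
  \<open>A\<close> records which variables z_a may occur.\<close>

inductive_set t_polys :: "nat \<Rightarrow> zpoly set \<Rightarrow> tzpoly set" for l A where
  Const: "c \<in> A \<Longrightarrow> Const c \<in> t_polys l A"
| Var: "i \<in> {1..l} \<Longrightarrow> t_var i \<in> t_polys l A"
| add: "g \<in> t_polys l A \<Longrightarrow> h \<in> t_polys l A \<Longrightarrow> g + h \<in> t_polys l A"
| mult: "g \<in> t_polys l A \<Longrightarrow> h \<in> t_polys l A \<Longrightarrow> g * h \<in> t_polys l A"

lemma poch_monom_split:
  assumes "p \<in> {1..l}"
  shows "poch_monom \<kappa> l (m(p := e)) =
    poch \<kappa> (t_var p) e * (\<Prod>i\<in>{1..l} - {p}. poch \<kappa> (t_var i) (m i))"
  unfolding poch_monom_def using assms by (subst prod.remove[of _ p]) (auto intro!: prod.cong)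

text \<open>This is [t]_(m+1) = [t]_m (t - m \<kappa>), solved for t [t]_m.\<close>

lemma t_var_mult_poch_monom:
  assumes "p \<in> {1..l}"
  shows "t_var p * poch_monom \<kappa> l m =
    poch_monom \<kappa> l (m(p := m p + 1)) + of_int (int (m p) * \<kappa>) * poch_monom \<kappa> l m"
  using poch_monom_split[OF assms, of \<kappa> m "m p"] poch_monom_split[OF assms, of \<kappa> m "m p + 1"]
  by (simp add: poch_Suc algebra_simps)

lemma sub_ring_t_polys:
  assumes "sub_ring A"
  shows "sub_ring (t_polys l A)"
proof
  show "of_int c \<in> t_polys l A" for c
    using t_polys.Const[of "of_int c" A l] sub_ring.of_int_mem[OF assms] by simp
qed (rule t_polys.add t_polys.mult; assumption)+

context
  fixes A :: "zpoly set"
  assumes A: "sub_ring A"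
begin

interpretation A: sub_ring A
  by (rule A)

lemma poch_span_add:
  assumes "g \<in> poch_span \<kappa> l A" and "h \<in> poch_span \<kappa> l A"
  shows "g + h \<in> poch_span \<kappa> l A"
  using assms(2)
  by (induction rule: poch_span.induct)
    (simp_all add: assms(1) add.assoc[symmetric] poch_span.add)

lemma poch_span_single: "m \<in> {1..l} \<rightarrow>\<^sub>E UNIV \<Longrightarrow> d \<in> A \<Longrightarrow> Const d * poch_monom \<kappa> l m \<in> poch_span \<kappa> l A"
  using poch_span.add[OF poch_span.zero, of m l d A \<kappa>] by simp

lemma Const_mult_poch_span: "g \<in> poch_span \<kappa> l A \<Longrightarrow> c \<in> A \<Longrightarrow> Const c * g \<in> poch_span \<kappa> l A"
proof (induction rule: poch_span.induct)
  case (add g m d)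
  then have "Const c * g + Const (c * d) * poch_monom \<kappa> l m \<in> poch_span \<kappa> l A"
    by (intro poch_span.add A.mult_mem)
  then show ?case
    by (simp add: Const_mult algebra_simps)
qed (simp add: poch_span.zero)

lemma t_var_mult_poch_span:
  assumes "g \<in> poch_span \<kappa> l A" and p: "p \<in> {1..l}"
  shows "t_var p * g \<in> poch_span \<kappa> l A"
  using assms(1)
proof (induction rule: poch_span.induct)
  case (add g m d)
  have m': "m(p := m p + 1) \<in> {1..l} \<rightarrow>\<^sub>E UNIV"
    using add.hyps(2) p by (auto simp: PiE_iff extensional_def)
  have "t_var p * (g + Const d * poch_monom \<kappa> l m) = t_var p * g +
      (Const d * poch_monom \<kappa> l (m(p := m p + 1)) +
       Const (d * of_int (int (m p) * \<kappa>)) * poch_monom \<kappa> l m)"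
    unfolding distrib_left mult.left_commute[of "t_var p" "Const d"] t_var_mult_poch_monom[OF p]
      Const_mult Const_simps(3)
    by (simp only: mult.assoc)
  also have "\<dots> \<in> poch_span \<kappa> l A"
    using add m' by (intro poch_span_add poch_span_single A.mult_mem A.of_int_mem)
  finally show ?case .
qed (simp add: poch_span.zero)

text \<open>Letting \<open>s\<close> vary makes a product act by its factors in succession;
  membership of \<open>g\<close> itself is the case s = 1.\<close>

lemma t_polys_mult_poch_span:
  "g \<in> t_polys l A \<Longrightarrow> s \<in> poch_span \<kappa> l A \<Longrightarrow> g * s \<in> poch_span \<kappa> l A"
  by (induction arbitrary: s rule: t_polys.induct)
    (simp_all add: Const_mult_poch_span t_var_mult_poch_span poch_span_add distrib_right mult.assoc)

lemma t_polys_subset_poch_span: "t_polys l A \<subseteq> poch_span \<kappa> l A"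
proof
  fix g assume "g \<in> t_polys l A"
  moreover have "1 \<in> poch_span \<kappa> l A"
    using poch_span_single[of "\<lambda>i\<in>{1..l}. 0" l 1 \<kappa>] by (simp add: poch_monom_def)
  ultimately show "g \<in> poch_span \<kappa> l A"
    using t_polys_mult_poch_span by fastforce
qed

lemma poch_span_expansion: "g \<in> poch_span \<kappa> l A \<Longrightarrow> \<exists>c. poch_expansion \<kappa> l c g \<and> range c \<subseteq> A"
proof (induction rule: poch_span.induct)
  case zero
  show ?case
    using poch_expansion_0 by (intro exI[of _ "\<lambda>_. 0"]) auto
next
  case (add g m d)
  then obtain c where c: "poch_expansion \<kappa> l c g" "range c \<subseteq> A"
    by blast
  show ?case
    using poch_expansion_add[OF c(1) poch_expansion_single[OF add.hyps(2)]] c(2) add.hyps(3)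
    by (intro exI[of _ "\<lambda>m'. c m' + (if m' = m then d else 0)"]) (auto intro!: A.add_mem)
qed

context
  fixes \<kappa> :: int and l :: nat
  assumes \<kappa>: "\<kappa> \<noteq> 0"
begin

lemma
  assumes "g \<in> t_polys l A"
  shows poch_expansion_coeffs: "poch_expansion \<kappa> l (poch_coeffs \<kappa> l g) g"
    and poch_coeffs_mem: "poch_coeffs \<kappa> l g m \<in> A"
proof -
  have "g \<in> poch_span \<kappa> l A"
    using assms t_polys_subset_poch_span by (rule subsetD[rotated])
  then obtain c where c: "poch_expansion \<kappa> l c g" "range c \<subseteq> A"
    using poch_span_expansion by (metis (no_types))
  have "poch_coeffs \<kappa> l g = c"
    by (rule poch_coeffs_eq[OF c(1) \<kappa>])
  then show "poch_expansion \<kappa> l (poch_coeffs \<kappa> l g) g" "poch_coeffs \<kappa> l g m \<in> A"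
    using c by auto
qed

lemma poch_coeffs_add:
  assumes "g \<in> t_polys l A" and "h \<in> t_polys l A"
  shows "poch_coeffs \<kappa> l (g + h) m = poch_coeffs \<kappa> l g m + poch_coeffs \<kappa> l h m"
  using poch_coeffs_eq[OF poch_expansion_add[OF poch_expansion_coeffs[OF assms(1)]
        poch_expansion_coeffs[OF assms(2)]] \<kappa>] by simp

lemma poch_coeffs_Const_mult:
  assumes "g \<in> t_polys l A"
  shows "poch_coeffs \<kappa> l (Const d * g) m = d * poch_coeffs \<kappa> l g m"
  using poch_coeffs_eq[OF poch_expansion_scale[OF poch_expansion_coeffs[OF assms]] \<kappa>] by simp

text \<open>The basis polynomials involve only the t_i and integers, so a homomorphism of the
  z-polynomials fixes them and acts on the coefficients alone.\<close>

lemma poch_coeffs_subst: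
  assumes "g \<in> t_polys l A" and "comm_ring_hom \<phi>"
  shows "poch_coeffs \<kappa> l (mpoly_eval (Const \<circ> \<phi>) Var g) m = \<phi> (poch_coeffs \<kappa> l g m)"
proof -
  let ?H = "mpoly_eval (Const \<circ> \<phi>) Var :: tzpoly \<Rightarrow> tzpoly"
  have \<phi>: "comm_ring_hom (Const \<circ> \<phi>)"
    by (intro comm_ring_hom_comp comm_ring_hom_Const assms)
  have hom: "comm_ring_hom ?H"
    by (rule comm_ring_hom_mpoly_eval[OF \<phi>])
  have "?H (Const c * poch_monom \<kappa> l m) = Const (\<phi> c) * poch_monom \<kappa> l m" for c m
    unfolding poch_monom_def comm_ring_hom.hom_mult[OF hom] comm_ring_hom.hom_prod[OF hom]
      comm_ring_hom.hom_poch[OF hom] mpoly_eval_Const[OF \<phi>] mpoly_eval_Var[OF \<phi>] comp_apply ..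
  then have "poch_expansion \<kappa> l (\<lambda>m. \<phi> (poch_coeffs \<kappa> l g m)) (?H g)"
    by (rule poch_expansion_map[where h = \<phi> and H = ?H, OF poch_expansion_coeffs[OF assms(1)]
          comm_ring_hom.hom_zero[OF assms(2)] comm_ring_hom.hom_sum[OF hom]])
  from poch_coeffs_eq[OF this \<kappa>] show ?thesis
    by simp
qed

text \<open>By \<open>poch_shift\<close>, the basis polynomial of index \<open>r\<close> receives a
  second contribution, from the index raised by one at \<open>p\<close>.\<close>

lemma poch_coeffs_shift:
  assumes "g \<in> t_polys l A" and p: "p \<in> {1..l}"
  shows "poch_coeffs \<kappa> l (mpoly_eval Const (t_var(p := t_var p + of_int \<kappa>)) g) r =
    poch_coeffs \<kappa> l g r + of_int (\<kappa> * (int (r p) + 1)) * poch_coeffs \<kappa> l g (r(p := r p + 1))"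
proof -
  let ?H = "mpoly_eval Const (t_var(p := t_var p + of_int \<kappa>)) :: tzpoly \<Rightarrow> tzpoly"
  have hom: "comm_ring_hom ?H"
    by (rule comm_ring_hom_mpoly_eval[OF comm_ring_hom_Const])
  have monom: "?H (poch_monom \<kappa> l m) =
      poch_monom \<kappa> l m + of_int (int (m p) * \<kappa>) * poch_monom \<kappa> l (m(p := m p - 1))" for m
  proof -
    have other: "?H (\<Prod>i\<in>{1..l} - {p}. poch \<kappa> (t_var i) (m i)) =
        (\<Prod>i\<in>{1..l} - {p}. poch \<kappa> (t_var i) (m i))"
      unfolding comm_ring_hom.hom_prod[OF hom] comm_ring_hom.hom_poch[OF hom]
        mpoly_eval_Var[OF comm_ring_hom_Const]
      by (intro prod.cong) simp_all
    have "?H (poch \<kappa> (t_var p) (m p)) = poch \<kappa> (t_var p + of_int \<kappa>) (m p)"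
      unfolding comm_ring_hom.hom_poch[OF hom] mpoly_eval_Var[OF comm_ring_hom_Const] by simp
    then have "?H (poch_monom \<kappa> l (m(p := m p))) =
        poch_monom \<kappa> l (m(p := m p)) + of_int (int (m p) * \<kappa>) * poch_monom \<kappa> l (m(p := m p - 1))"
      unfolding poch_monom_split[OF p] comm_ring_hom.hom_mult[OF hom] other poch_shift
      by (simp only: distrib_right mult.assoc)
    then show ?thesis
      by (simp only: fun_upd_triv)
  qed
  \<comment> \<open>The action of the shift on families of coefficients.\<close>
  define D where "D c m = c m + of_int (\<kappa> * (int (m p) + 1)) * c (m(p := m p + 1))"
    for c :: "(nat \<Rightarrow> nat) \<Rightarrow> zpoly" and m
  have single: "poch_expansion \<kappa> l (D (\<lambda>m'. if m' = m then d else 0)) (?H (Const d * poch_monom \<kappa> l m))"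
    if m: "m \<in> {1..l} \<rightarrow>\<^sub>E UNIV" for m d
  proof -
    let ?m = "m(p := m p - 1)"
    have m': "?m \<in> {1..l} \<rightarrow>\<^sub>E UNIV"
      using m p by (auto simp: PiE_iff extensional_def)
    have "?H (Const d * poch_monom \<kappa> l m) =
        Const d * poch_monom \<kappa> l m + Const (d * of_int (int (m p) * \<kappa>)) * poch_monom \<kappa> l ?m"
      unfolding comm_ring_hom.hom_mult[OF hom] monom mpoly_eval_Const[OF comm_ring_hom_Const]
        Const_mult Const_simps(3)
      by (simp only: distrib_left mult.assoc)
    moreover have "D (\<lambda>m'. if m' = m then d else 0) =
        (\<lambda>m'. (if m' = m then d else 0) + (if m' = ?m then d * of_int (int (m p) * \<kappa>) else 0))"
    proof
      fix m'
      \<comment> \<open>A raised index is never 0 at \<open>p\<close>, so for m p = 0 the left side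
        of the next equation is 0; on its right side the factor m p is 0.\<close>
      have "m'(p := m' p + 1) = m \<longleftrightarrow> m' = ?m \<and> m p \<noteq> 0"
      proof
        assume *: "m'(p := m' p + 1) = m"
        show "m' = ?m \<and> m p \<noteq> 0"
          unfolding *[symmetric] by simp
      qed simp
      then have "of_int (\<kappa> * (int (m' p) + 1)) * (if m'(p := m' p + 1) = m then d else 0) =
          (if m' = ?m then d * of_int (int (m p) * \<kappa>) else 0)"
        by (cases "m' = ?m"; cases "m p = 0") (simp_all add: of_nat_diff mult.commute)
      then show "D (\<lambda>m'. if m' = m then d else 0) m' =
          (if m' = m then d else 0) + (if m' = ?m then d * of_int (int (m p) * \<kappa>) else 0)"
        unfolding D_def by (rule arg_cong)
    qed
    ultimately show ?thesis
      using poch_expansion_add[OF poch_expansion_single[OF m, of \<kappa> d]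
          poch_expansion_single[OF m', of \<kappa> "d * of_int (int (m p) * \<kappa>)"]] by (simp only:)
  qed
  \<comment> \<open>Both expansions are built along the span with the same \<open>c\<close>;
    uniqueness afterwards identifies \<open>c\<close> with \<open>poch_coeffs\<close>.\<close>
  have "\<exists>c. poch_expansion \<kappa> l c g \<and> poch_expansion \<kappa> l (D c) (?H g)" if "g \<in> poch_span \<kappa> l A" for g
    using that
  proof (induction rule: poch_span.induct)
    case zero
    have "D (\<lambda>_. 0) = (\<lambda>_. 0)"
      by (simp add: D_def fun_eq_iff)
    then have "poch_expansion \<kappa> l (D (\<lambda>_. 0)) (?H 0)"
      unfolding comm_ring_hom.hom_zero[OF hom] by (simp only: poch_expansion_0)
    then show ?case
      using poch_expansion_0 by blast
  next
    case (add g m d)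
    then obtain c where c: "poch_expansion \<kappa> l c g" "poch_expansion \<kappa> l (D c) (?H g)"
      by blast
    let ?c = "\<lambda>m'. if m' = m then d else 0"
    have "D (\<lambda>m'. c m' + ?c m') = (\<lambda>m'. D c m' + D ?c m')"
      unfolding D_def by (rule ext) (simp only: distrib_left add_ac)
    then have "poch_expansion \<kappa> l (D (\<lambda>m'. c m' + ?c m')) (?H (g + Const d * poch_monom \<kappa> l m))"
      unfolding comm_ring_hom.hom_add[OF hom]
      using poch_expansion_add[OF c(2) single[OF add.hyps(2), of d]] by (simp only:)
    moreover have "poch_expansion \<kappa> l (\<lambda>m'. c m' + ?c m') (g + Const d * poch_monom \<kappa> l m)"
      by (rule poch_expansion_add[OF c(1) poch_expansion_single[OF add.hyps(2)]])
    ultimately show ?case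
      by blast
  qed
  from this[OF subsetD[OF t_polys_subset_poch_span assms(1)]]
  obtain c where "poch_expansion \<kappa> l c g" "poch_expansion \<kappa> l (D c) (?H g)"
    by blast
  from poch_coeffs_eq[OF this(1) \<kappa>] poch_coeffs_eq[OF this(2) \<kappa>] show ?thesis
    by (simp only: D_def)
qed

end

end


section \<open>The polynomials \<open>U_I\<close>\<close>

lemma hom_weight_term:
  assumes h: "comm_ring_hom h"
  shows "h (weight_term \<kappa> k k' n l c t z) = weight_term \<kappa> k k' n l c (\<lambda>i. h (t i)) (\<lambda>a. h (z a))"
proof -
  have z: "h (zfac \<kappa> k u v x) = zfac \<kappa> k u v (h x)" for u v x
    by (simp add: zfac_def comm_ring_hom.hom_poch[OF h] comm_ring_hom.hom_diff[OF h]
        comm_ring_hom.hom_of_int[OF h])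
  have t: "h (tfac \<kappa> k' u v x) = tfac \<kappa> k' u v (h x)" for u v x
    by (simp add: tfac_def comm_ring_hom.hom_poch[OF h] comm_ring_hom.hom_diff[OF h]
        comm_ring_hom.hom_of_int[OF h] comm_ring_hom.hom_add[OF h] comm_ring_hom.hom_one[OF h])
  show ?thesis
    unfolding weight_term_def zrow_def comm_ring_hom.hom_mult[OF h] comm_ring_hom.hom_prod[OF h]
    by (intro arg_cong2[of _ _ _ _ "(*)"] prod.cong refl)
      (simp_all add: z t comm_ring_hom.hom_diff[OF h] split: prod.split)
qed

lemma hom_weight_sum:
  assumes h: "comm_ring_hom h"
  shows "h (weight_sum \<kappa> k k' n l I t z) = weight_sum \<kappa> k k' n l I (\<lambda>i. h (t i)) (\<lambda>a. h (z a))"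
  unfolding weight_sum_def comm_ring_hom.hom_sum[OF h] hom_weight_term[OF h] ..

lemma zrow_eq_quotient:
  fixes x :: "'a::field"
  assumes k: "0 < k" and u: "u \<in> {1..n}" and x: "\<And>a. a \<in> {1..n} \<Longrightarrow> x - z a \<noteq> 0"
  shows "(\<Prod>a=1..n. poch \<kappa> (x - z a) k) *
      (1 / (x - z u) * (\<Prod>j=1..u - 1. (x - z j - of_int (\<kappa> * int k)) / (x - z j))) =
    zrow \<kappa> k n (2 * u) x z"
proof -
  \<comment> \<open>The factors of the weight function, extended by 1 beyond \<open>u\<close> so
    that they can be matched site by site with the master polynomial.\<close>
  define q where "q a = (if a < u then (x - z a - of_int (\<kappa> * int k)) / (x - z a)
    else if a = u then 1 / (x - z a) else 1)" for a
  have "(\<Prod>a=1..n. q a) = (\<Prod>a\<in>insert u {1..u - 1}. q a)"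
    using u by (intro prod.mono_neutral_right) (auto simp: q_def)
  also have "\<dots> = q u * (\<Prod>a=1..u - 1. q a)"
    using u by (intro prod.insert) auto
  also have "\<dots> = 1 / (x - z u) * (\<Prod>j=1..u - 1. (x - z j - of_int (\<kappa> * int k)) / (x - z j))"
    using u by (intro arg_cong2[of _ _ _ _ "(*)"] prod.cong refl) (auto simp: q_def)
  finally have q: "1 / (x - z u) * (\<Prod>j=1..u - 1. (x - z j - of_int (\<kappa> * int k)) / (x - z j)) =
    (\<Prod>a=1..n. q a)" ..
  obtain k0 where k0: "k = Suc k0"
    using k by (cases k) auto
  have k0': "k - 1 = k0"
    by (simp add: k0)
  have "poch \<kappa> (x - z a) k * q a = zfac \<kappa> k (2 * u) (2 * a) (x - z a)" if "a \<in> {1..n}" for a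
  proof -
    have left: "poch \<kappa> (x - z a) k = (x - z a) * poch \<kappa> (x - z a - of_int \<kappa>) k0"
      unfolding k0 by (rule poch_Suc_left)
    have right: "poch \<kappa> (x - z a - of_int \<kappa>) k =
        poch \<kappa> (x - z a - of_int \<kappa>) k0 * (x - z a - of_int (\<kappa> * int k))"
      unfolding k0 poch_Suc by (simp add: algebra_simps)
    show ?thesis
      using x[OF that] k0' by (auto simp: zfac_def q_def right left simp del: of_int_mult)
  qed
  then show ?thesis
    unfolding q zrow_def prod.distrib[symmetric] by (intro prod.cong refl)
qed

lemma tfac_eq_quotient:
  fixes y :: "'a::field"
  assumes "0 < k'" and "y + 1 \<noteq> 0"
  shows "poch \<kappa> (y + 1) k' * (if u < v then 1 else (y + 1 - of_int (\<kappa> * int k')) / (y + 1)) =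
    tfac \<kappa> k' u v y"
proof -
  obtain j where j: "k' = Suc j"
    using assms(1) by (cases k') auto
  have left: "poch \<kappa> (y + 1) k' = (y + 1) * poch \<kappa> (y + 1 - of_int \<kappa>) j"
    unfolding j by (rule poch_Suc_left)
  have right: "poch \<kappa> (y + 1 - of_int \<kappa>) k' =
      poch \<kappa> (y + 1 - of_int \<kappa>) j * (y + 1 - of_int (\<kappa> * int k'))"
    unfolding j poch_Suc by (simp add: algebra_simps)
  show ?thesis
    using assms(2) by (simp add: tfac_def left right del: of_int_mult)
qed

lemma
  assumes "finite I"
  shows nth_elem_less: "i \<in> {1..card I} \<Longrightarrow> j \<in> {1..card I} \<Longrightarrow> i < j \<Longrightarrow> nth_elem I i < nth_elem I j"
    and nth_elem_image: "nth_elem I ` {1..card I} = I"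
proof -
  let ?xs = "sorted_list_of_set I"
  have len: "length ?xs = card I"
    by simp
  show "nth_elem I i < nth_elem I j" if "i \<in> {1..card I}" "j \<in> {1..card I}" "i < j"
    unfolding nth_elem_def
    using sorted_wrt_nth_less[OF strict_sorted_list_of_set, of "i - 1" "j - 1" I] that len by auto
  have "nth_elem I ` {1..card I} = (\<lambda>i. ?xs ! i) ` {..<card I}"
  proof -
    have "{1..card I} = Suc ` {..<card I}"
      by (metis image_Suc_lessThan)
    then show ?thesis
      by (simp add: image_image nth_elem_def)
  qed
  also have "\<dots> = set ?xs"
    unfolding set_conv_nth len by auto
  finally show "nth_elem I ` {1..card I} = I"
    using assms by simp
qed

text \<open>Permutations are the identity outside {1..l} and members of \<open>bijs\<close> are
  \<open>undefined\<close> there, so \<open>F\<close> must see only values on {1..l}.\<close>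

lemma sum_permutations_eq_sum_bijs:
  assumes F: "\<And>b b'. (\<And>i. i \<in> {1..l} \<Longrightarrow> b i = b' i) \<Longrightarrow> F b = F b'"
  shows "(\<Sum>\<sigma> | \<sigma> permutes {1..l}. F \<sigma>) = (\<Sum>b\<in>bijs l {1..l}. F b)"
proof (rule sum.reindex_bij_witness[where i = "\<lambda>b i. if i \<in> {1..l} then b i else i"
      and j = "\<lambda>\<sigma>. restrict \<sigma> {1..l}"])
  fix \<sigma> assume "\<sigma> \<in> {\<sigma>. \<sigma> permutes {1..l}}"
  then have \<sigma>: "\<sigma> permutes {1..l}"
    by simp
  show "(\<lambda>i. if i \<in> {1..l} then restrict \<sigma> {1..l} i else i) = \<sigma>"
    using permutes_not_in[OF \<sigma>] by fastforce
  have "bij_betw (restrict \<sigma> {1..l}) {1..l} {1..l}"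
    using permutes_imp_bij[OF \<sigma>] by (subst bij_betw_cong[of _ _ \<sigma>]) auto
  then show "restrict \<sigma> {1..l} \<in> bijs l {1..l}"
    by (simp add: bijs_def)
  show "F (restrict \<sigma> {1..l}) = F \<sigma>"
    by (rule F) simp
next
  fix b assume b: "b \<in> bijs l {1..l}"
  let ?f = "\<lambda>i. if i \<in> {1..l} then b i else i"
  have "bij_betw ?f {1..l} {1..l}"
    using b by (subst bij_betw_cong[of _ _ b]) (auto simp: bijs_def)
  then have "?f permutes {1..l}"
    by (rule bij_imp_permutes) auto
  then show "?f \<in> {\<sigma>. \<sigma> permutes {1..l}}"
    by simp
  have "b i = undefined" if "i \<notin> {1..l}" for i
    using b that unfolding bijs_def by (blast dest: PiE_arb)
  then show "restrict ?f {1..l} = b"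
    by (simp add: fun_eq_iff)
qed

text \<open>In the summand of \<tau> the variable t_(\<tau>(i)) belongs to the i-th element of
  \<open>I\<close>, so t_i sits at the element number \<tau>^(-1)(i). As the enumeration of
  \<open>I\<close> is increasing, the inversions of \<tau>^(-1) are the pairs whose sites are in the
  opposite order.\<close>

lemma master_mult_weight_fun:
  fixes t z :: "nat \<Rightarrow> 'a::field"
  assumes k: "0 < k" "0 < k'" and I: "I \<subseteq> {1..n}" "card I = l"
    and tz: "\<And>i a. i \<in> {1..l} \<Longrightarrow> a \<in> {1..n} \<Longrightarrow> t i - z a \<noteq> 0"
    and tt: "\<And>i j. (i, j) \<in> pairs l \<Longrightarrow> t i - t j + 1 \<noteq> 0"
  shows "master \<kappa> k k' n l t z * weight_fun \<kappa> k k' l I t z = weight_sum \<kappa> k k' n l I t z"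
proof -
  have fin: "finite I"
    using I(1) finite_subset by blast
  note less = nth_elem_less[OF fin, unfolded I(2)]
  note image = nth_elem_image[OF fin, unfolded I(2)]
  have perm: "master \<kappa> k k' n l t z * weight_fun_perm \<kappa> k k' l I \<tau> t z =
      weight_term \<kappa> k k' n l (\<lambda>i. 2 * nth_elem I (inv \<tau> i)) t z" if \<tau>: "\<tau> permutes {1..l}" for \<tau>
  proof -
    have inv_mem: "inv \<tau> i \<in> {1..l}" if "i \<in> {1..l}" for i
      using permutes_in_image[OF permutes_inv[OF \<tau>]] that by blast
    have inv_eq: "inv \<tau> i = inv \<tau> j \<longleftrightarrow> i = j" for i j
      using permutes_inj[OF permutes_inv[OF \<tau>]] by (auto dest: injD)
    define G where "G u x = 1 / (x - z u) *
        (\<Prod>j=1..u - 1. (x - z j - of_int (\<kappa> * int k)) / (x - z j))" for u x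
    have "(\<Prod>i=1..l. G (nth_elem I i) (t (\<tau> i))) =
        (\<Prod>i=1..l. G (nth_elem I (inv \<tau> (\<tau> i))) (t (\<tau> i)))"
      by (simp add: permutes_inverses(2)[OF \<tau>])
    also have "\<dots> = (\<Prod>i=1..l. G (nth_elem I (inv \<tau> i)) (t i))"
      by (rule prod.reindex_bij_betw[OF permutes_imp_bij[OF \<tau>]])
    finally have G: "(\<Prod>i=1..l. G (nth_elem I i) (t (\<tau> i))) =
      (\<Prod>i=1..l. G (nth_elem I (inv \<tau> i)) (t i))" .
    have row: "(\<Prod>a=1..n. \<Prod>i=1..l. poch \<kappa> (t i - z a) k) *
        (\<Prod>i=1..l. G (nth_elem I (inv \<tau> i)) (t i)) =
        (\<Prod>i=1..l. zrow \<kappa> k n (2 * nth_elem I (inv \<tau> i)) (t i) z)"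
    proof -
      have "(\<Prod>a=1..n. poch \<kappa> (t i - z a) k) * G (nth_elem I (inv \<tau> i)) (t i) =
          zrow \<kappa> k n (2 * nth_elem I (inv \<tau> i)) (t i) z" if i: "i \<in> {1..l}" for i
        unfolding G_def
      proof (rule zrow_eq_quotient[OF k(1)])
        show "nth_elem I (inv \<tau> i) \<in> {1..n}"
          using image I(1) inv_mem[OF i] by blast
      qed (rule tz[OF i])
      then show ?thesis
        by (subst prod.swap) (simp add: prod.distrib[symmetric])
    qed
    define H where "H i j = (t i - t j + 1 - of_int (\<kappa> * int k')) / (t i - t j + 1)" for i j
    have "{(i, j). 1 \<le> i \<and> i < j \<and> j \<le> l \<and> inv \<tau> i > inv \<tau> j} =
        {e \<in> pairs l. case e of (i, j) \<Rightarrow> \<not> inv \<tau> i < inv \<tau> j}"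
      by (auto simp: pairs_def not_less order_less_le inv_eq)
    then have "(\<Prod>(i, j)\<in>{(i, j). 1 \<le> i \<and> i < j \<and> j \<le> l \<and> inv \<tau> i > inv \<tau> j}. H i j) =
        (\<Prod>e\<in>pairs l. if (case e of (i, j) \<Rightarrow> \<not> inv \<tau> i < inv \<tau> j) then (case e of (i, j) \<Rightarrow> H i j) else 1)"
      by (simp only: prod.inter_filter[OF finite_pairs])
    also have "\<dots> = (\<Prod>(i, j)\<in>pairs l. if inv \<tau> i < inv \<tau> j then 1 else H i j)"
      by (intro prod.cong refl) (simp split: prod.split)
    finally have H: "(\<Prod>(i, j)\<in>{(i, j). 1 \<le> i \<and> i < j \<and> j \<le> l \<and> inv \<tau> i > inv \<tau> j}. H i j) =
      (\<Prod>(i, j)\<in>pairs l. if inv \<tau> i < inv \<tau> j then 1 else H i j)" .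
    have pair: "(\<Prod>(i, j)\<in>pairs l. poch \<kappa> (t i - t j + 1) k') *
        (\<Prod>(i, j)\<in>pairs l. if inv \<tau> i < inv \<tau> j then 1 else H i j) =
        (\<Prod>(i, j)\<in>pairs l. tfac \<kappa> k' (2 * nth_elem I (inv \<tau> i)) (2 * nth_elem I (inv \<tau> j)) (t i - t j))"
      unfolding prod.distrib[symmetric]
    proof (intro prod.cong refl)
      fix e assume e: "e \<in> pairs l"
      then obtain i j where ij: "e = (i, j)" "i \<in> {1..l}" "j \<in> {1..l}" "i < j"
        by (auto simp: pairs_def)
      have "inv \<tau> i < inv \<tau> j \<longleftrightarrow> nth_elem I (inv \<tau> i) < nth_elem I (inv \<tau> j)"
        using less[OF inv_mem[OF ij(2)] inv_mem[OF ij(3)]] less[OF inv_mem[OF ij(3)] inv_mem[OF ij(2)]]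
          inv_eq[of i j] ij(4) by (metis less_asym' linorder_neqE_nat less_not_refl)
      then show "(case e of (i, j) \<Rightarrow> poch \<kappa> (t i - t j + 1) k') *
          (case e of (i, j) \<Rightarrow> if inv \<tau> i < inv \<tau> j then 1 else H i j) =
          (case e of (i, j) \<Rightarrow>
            tfac \<kappa> k' (2 * nth_elem I (inv \<tau> i)) (2 * nth_elem I (inv \<tau> j)) (t i - t j))"
        using tfac_eq_quotient[OF k(2) tt[of i j], of \<kappa> "2 * nth_elem I (inv \<tau> i)" "2 * nth_elem I (inv \<tau> j)"] e
        unfolding ij(1) H_def by simp
    qed
    have "master \<kappa> k k' n l t z * weight_fun_perm \<kappa> k k' l I \<tau> t z =
        ((\<Prod>a=1..n. \<Prod>i=1..l. poch \<kappa> (t i - z a) k) * (\<Prod>i=1..l. G (nth_elem I (inv \<tau> i)) (t i))) *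
        ((\<Prod>(i, j)\<in>pairs l. poch \<kappa> (t i - t j + 1) k') *
         (\<Prod>(i, j)\<in>pairs l. if inv \<tau> i < inv \<tau> j then 1 else H i j))"
      unfolding master_def weight_fun_perm_def perm_act_def pairs_def[symmetric]
        G_def[symmetric] H_def[symmetric] G H
      by (simp only: mult_ac)
    then show ?thesis
      unfolding row pair weight_term_def .
  qed
  have cong: "weight_term \<kappa> k k' n l (\<lambda>i. 2 * g (b i)) t z = weight_term \<kappa> k k' n l (\<lambda>i. 2 * g (b' i)) t z"
    if "\<And>i. i \<in> {1..l} \<Longrightarrow> b i = b' i" for b b' g
    by (rule weight_term_cong) (simp_all add: that)
  have inj: "inj_on (nth_elem I) {1..l}"
    by (intro inj_onI) (metis less less_irrefl linorder_neqE_nat)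
  have "master \<kappa> k k' n l t z * weight_fun \<kappa> k k' l I t z =
      (\<Sum>\<tau> | \<tau> permutes {1..l}. weight_term \<kappa> k k' n l (\<lambda>i. 2 * nth_elem I (inv \<tau> i)) t z)"
    unfolding weight_fun_def sum_distrib_left by (intro sum.cong refl perm) simp
  also have "\<dots> = (\<Sum>\<sigma> | \<sigma> permutes {1..l}. weight_term \<kappa> k k' n l (\<lambda>i. 2 * nth_elem I (\<sigma> i)) t z)"
    by (rule sum_permutations_inverse[symmetric])
  also have "\<dots> = (\<Sum>b\<in>bijs l {1..l}. weight_term \<kappa> k k' n l (\<lambda>i. 2 * nth_elem I (b i)) t z)"
    by (rule sum_permutations_eq_sum_bijs) (rule cong)
  also have "\<dots> = (\<Sum>b\<in>bijs l (nth_elem I ` {1..l}). weight_term \<kappa> k k' n l (\<lambda>i. 2 * b i) t z)"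
    by (subst sum_bijs_image[OF inj]) (auto intro: weight_term_cong)
  finally show ?thesis
    unfolding image weight_sum_def .
qed

lemma U_poly_eq:
  assumes "0 < k" and "0 < k'" and "I \<subseteq> {1..n}" and "card I = l"
  shows "U_poly \<kappa> k k' n l I = weight_sum \<kappa> k k' n l I t_var z_var"
proof -
  have tz: "t_var i - z_var a \<noteq> 0" for i a
  proof
    assume 0: "t_var i - z_var a = 0"
    \<comment> \<open>At t_i = z_a + 1 the difference takes the value 1.\<close>
    let ?ev = "mpoly_eval id (\<lambda>_. Var a + 1) :: tzpoly \<Rightarrow> zpoly"
    have "?ev (t_var i - z_var a) = 1"
      unfolding comm_ring_hom.hom_diff[OF comm_ring_hom_mpoly_eval[OF comm_ring_hom_id]]
        mpoly_eval_Const[OF comm_ring_hom_id] mpoly_eval_Var[OF comm_ring_hom_id]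
      by simp
    then show False
      unfolding 0 mpoly_eval_0[OF comm_ring_hom_id] by simp
  qed
  have tt: "t_var i - t_var j + 1 \<noteq> 0" for i j
  proof
    assume 0: "t_var i - t_var j + 1 = 0"
    let ?ev = "mpoly_eval id (\<lambda>_. 0) :: tzpoly \<Rightarrow> zpoly"
    have "?ev (t_var i - t_var j + 1) = 1"
      unfolding comm_ring_hom.hom_diff[OF comm_ring_hom_mpoly_eval[OF comm_ring_hom_id]]
        comm_ring_hom.hom_add[OF comm_ring_hom_mpoly_eval[OF comm_ring_hom_id]]
        comm_ring_hom.hom_one[OF comm_ring_hom_mpoly_eval[OF comm_ring_hom_id]]
        mpoly_eval_Var[OF comm_ring_hom_id]
      by simp
    then show False
      unfolding 0 mpoly_eval_0[OF comm_ring_hom_id] by simp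
  qed
  note h = comm_ring_hom_to_fract
  let ?t = "\<lambda>i. to_fract (t_var i)" and ?z = "\<lambda>a. to_fract (z_var a)"
  have "to_fract (master \<kappa> k k' n l t_var z_var) = master \<kappa> k k' n l ?t ?z"
    unfolding master_def comm_ring_hom.hom_mult[OF h] comm_ring_hom.hom_prod[OF h]
      case_prod_unfold comm_ring_hom.hom_poch[OF h] comm_ring_hom.hom_add[OF h]
      comm_ring_hom.hom_diff[OF h] comm_ring_hom.hom_one[OF h] ..
  moreover have "master \<kappa> k k' n l ?t ?z * weight_fun \<kappa> k k' l I ?t ?z = weight_sum \<kappa> k k' n l I ?t ?z"
  proof (rule master_mult_weight_fun[OF assms])
    show "?t i - ?z a \<noteq> 0" for i a
      unfolding comm_ring_hom.hom_diff[OF h, symmetric] using tz by (simp only: to_fract_eq_0_iff not_False_eq_True)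
    show "?t i - ?t j + 1 \<noteq> 0" for i j
      unfolding comm_ring_hom.hom_diff[OF h, symmetric] comm_ring_hom.hom_one[OF h, symmetric]
        comm_ring_hom.hom_add[OF h, symmetric]
      using tt by (simp only: to_fract_eq_0_iff not_False_eq_True)
  qed
  moreover have "weight_sum \<kappa> k k' n l I ?t ?z = to_fract (weight_sum \<kappa> k k' n l I t_var z_var)"
    by (rule hom_weight_sum[OF h, symmetric])
  ultimately show ?thesis
    unfolding U_poly_def by (simp only: to_fract_eq_iff the_eq_trivial)
qed

section \<open>Reduction modulo \<open>N\<close>\<close>

text \<open>It does not depend on the positions, hence leaves every sum over bijections, and it is
  symmetric in z, as the exchange relation requires.\<close>

definition common_factor ::
    "int \<Rightarrow> nat \<Rightarrow> nat \<Rightarrow> nat \<Rightarrow> nat \<Rightarrow> (nat \<Rightarrow> 'a) \<Rightarrow> (nat \<Rightarrow> 'a) \<Rightarrow> 'a::comm_ring_1" where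
  "common_factor \<kappa> k k' n l t z =
     (\<Prod>i=1..l. \<Prod>a=1..n. poch \<kappa> (t i - z a - of_int \<kappa>) (k - 1)) *
     (\<Prod>(i, j)\<in>pairs l. poch \<kappa> (t i - t j + 1 - of_int \<kappa>) (k' - 1))"

lemma common_factor_swap:
  assumes "1 \<le> a" and "a < n"
  shows "common_factor \<kappa> k k' n l t (z \<circ> transpose a (a + 1)) = common_factor \<kappa> k k' n l t z"
proof -
  have s: "bij_betw (transpose a (a + 1)) {1..n} {1..n}"
    using assms by (intro permutes_imp_bij permutes_swap_id) auto
  have "(\<Prod>b=1..n. poch \<kappa> (x - (z \<circ> transpose a (a + 1)) b - of_int \<kappa>) (k - 1)) =
      (\<Prod>b=1..n. poch \<kappa> (x - z b - of_int \<kappa>) (k - 1))" for x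
    using prod.reindex_bij_betw[OF s, of "\<lambda>b. poch \<kappa> (x - z b - of_int \<kappa>) (k - 1)"]
    by (simp only: comp_apply)
  then show ?thesis
    unfolding common_factor_def by (simp only:)
qed

context sub_ring
begin

lemma weight_term_mem:
  assumes t: "\<And>i. i \<in> {1..l} \<Longrightarrow> t i \<in> S" and z: "\<And>a. a \<in> {1..n} \<Longrightarrow> z a \<in> S"
  shows "weight_term \<kappa> k k' n l c t z \<in> S"
proof -
  have zf: "zfac \<kappa> k u v x \<in> S" if "x \<in> S" for u v x
    using that by (simp add: zfac_def poch_mem diff_mem)
  have tf: "tfac \<kappa> k' u v x \<in> S" if "x \<in> S" for u v x
    using that by (simp add: tfac_def poch_mem diff_mem add_mem)
  show ?thesis
    unfolding weight_term_def zrow_def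
    by (intro mult_mem prod_mem) (auto simp: pairs_def intro!: zf tf diff_mem t z)
qed

lemma weight_sum_mem:
  assumes "\<And>i. i \<in> {1..l} \<Longrightarrow> t i \<in> S" and "\<And>a. a \<in> {1..n} \<Longrightarrow> z a \<in> S"
  shows "weight_sum \<kappa> k k' n l I t z \<in> S"
  unfolding weight_sum_def by (intro sum_mem weight_term_mem assms)

lemma cong_mod_of_int: "[a = b] (mod N) \<Longrightarrow> cong_mod N (of_int a) (of_int b)"
proof -
  assume "[a = b] (mod N)"
  then obtain c where "a - b = N * c"
    by (auto simp: cong_iff_dvd_diff)
  then have "(of_int a :: 'a) - of_int b = of_int N * of_int c"
    by (metis of_int_diff of_int_mult)
  then show ?thesis
    unfolding cong_mod_def by (intro conjI of_int_mem bexI[of _ "of_int c"])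
qed

text \<open>All three cases contain [x - \<kappa>]_(k-1); the remaining factor is x - \<kappa> k,
  which is congruent to x + 1, or 1, or x.\<close>

lemma cong_mod_zfac:
  assumes k: "0 < k" "[\<kappa> * int k = - 1] (mod N)" and x: "x \<in> S"
  shows "cong_mod N (zfac \<kappa> k u v x) (poch \<kappa> (x - of_int \<kappa>) (k - 1) * zred u v x)"
proof -
  let ?P = "poch \<kappa> (x - of_int \<kappa>) (k - 1)"
  have P: "?P \<in> S"
    by (intro poch_mem diff_mem x of_int_mem)
  obtain k0 where k0: "k = Suc k0"
    using k(1) by (cases k) auto
  have "poch \<kappa> (x - of_int \<kappa>) k = ?P * (x - of_int (\<kappa> * int k))"
    unfolding k0 poch_Suc by (simp add: algebra_simps)
  moreover have "cong_mod N (?P * (x - of_int (\<kappa> * int k))) (?P * (x - of_int (- 1)))"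
    by (intro cong_mod_mult cong_mod_diff cong_mod_of_int cong_mod_refl k P x)
  ultimately have right: "cong_mod N (poch \<kappa> (x - of_int \<kappa>) k) (?P * (x + 1))"
    by (simp only: of_int_minus of_int_1 diff_minus_eq_add)
  have left: "poch \<kappa> x k = ?P * x"
    unfolding k0 poch_Suc_left by (simp add: mult.commute)
  consider "v < u" | "v = u" | "u < v"
    by linarith
  then show ?thesis
  proof cases
    case 1
    then show ?thesis
      using right by (simp add: zfac_def zred_def)
  next
    case 2
    then show ?thesis
      using cong_mod_refl[OF P] by (simp add: zfac_def zred_def)
  next
    case 3
    then show ?thesis
      using cong_mod_refl[OF mult_mem[OF P x]] by (simp add: zfac_def zred_def left)
  qed
qed

text \<open>Besides [y + 1 - \<kappa>]_(k'-1) there remains y + 1 or y + 1 - \<kappa> k', and the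
  latter is congruent to y - 1.\<close>

lemma cong_mod_tfac:
  assumes k: "0 < k'" "[\<kappa> * int k' = 2] (mod N)" and y: "y \<in> S"
  shows "cong_mod N (tfac \<kappa> k' u v y) (poch \<kappa> (y + 1 - of_int \<kappa>) (k' - 1) * tred u v y)"
proof -
  let ?P = "poch \<kappa> (y + 1 - of_int \<kappa>) (k' - 1)"
  have P: "?P \<in> S" and y1: "y + 1 \<in> S"
    by (intro poch_mem diff_mem add_mem y of_int_mem one_mem)+
  obtain j where j: "k' = Suc j"
    using k(1) by (cases k') auto
  have "poch \<kappa> (y + 1 - of_int \<kappa>) k' = ?P * (y + 1 - of_int (\<kappa> * int k'))"
    unfolding j poch_Suc by (simp add: algebra_simps)
  moreover have "cong_mod N (?P * (y + 1 - of_int (\<kappa> * int k'))) (?P * (y + 1 - of_int 2))"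
    by (intro cong_mod_mult cong_mod_diff cong_mod_of_int cong_mod_refl k P y1)
  moreover have "y + 1 - of_int 2 = y - 1"
    by simp
  ultimately have right: "cong_mod N (poch \<kappa> (y + 1 - of_int \<kappa>) k') (?P * (y - 1))"
    by (simp only:)
  have left: "poch \<kappa> (y + 1) k' = ?P * (y + 1)"
    unfolding j poch_Suc_left by (simp add: mult.commute)
  show ?thesis
  proof (cases "u < v")
    case True
    then show ?thesis
      using cong_mod_refl[OF mult_mem[OF P y1]] by (simp add: tfac_def tred_def left)
  next
    case False
    then show ?thesis
      using right by (simp add: tfac_def tred_def)
  qed
qed

lemma cong_mod_weight_term:
  assumes k: "0 < k" "[\<kappa> * int k = - 1] (mod N)" and k': "0 < k'" "[\<kappa> * int k' = 2] (mod N)"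
    and t: "\<And>i. i \<in> {1..l} \<Longrightarrow> t i \<in> S" and z: "\<And>a. a \<in> {1..n} \<Longrightarrow> z a \<in> S"
  shows "cong_mod N (weight_term \<kappa> k k' n l c t z)
    (common_factor \<kappa> k k' n l t z * red_term n l c t z)"
proof -
  have "common_factor \<kappa> k k' n l t z * red_term n l c t z =
      (\<Prod>i=1..l. \<Prod>a=1..n. poch \<kappa> (t i - z a - of_int \<kappa>) (k - 1) * zred (c i) (2 * a) (t i - z a)) *
      (\<Prod>(i, j)\<in>pairs l. poch \<kappa> (t i - t j + 1 - of_int \<kappa>) (k' - 1) * tred (c i) (c j) (t i - t j))"
    unfolding common_factor_def red_term_def zrow_red_def prod.distrib case_prod_unfold
    by (simp only: mult_ac)
  moreover have "cong_mod N (weight_term \<kappa> k k' n l c t z) \<dots>"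
    unfolding weight_term_def zrow_def case_prod_unfold
    by (intro cong_mod_mult cong_mod_prod cong_mod_zfac cong_mod_tfac k k' diff_mem t z)
      (auto simp: pairs_def)
  ultimately show ?thesis
    by (simp only:)
qed

lemma cong_mod_weight_sum:
  assumes "0 < k" "[\<kappa> * int k = - 1] (mod N)" "0 < k'" "[\<kappa> * int k' = 2] (mod N)"
    and "\<And>i. i \<in> {1..l} \<Longrightarrow> t i \<in> S" "\<And>a. a \<in> {1..n} \<Longrightarrow> z a \<in> S"
  shows "cong_mod N (weight_sum \<kappa> k k' n l I t z)
    (common_factor \<kappa> k k' n l t z * red_sum n l I t z)"
  unfolding weight_sum_def red_sum_def sum_distrib_left
  by (intro cong_mod_sum cong_mod_weight_term assms)

end


section \<open>Difference integrals\<close>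

text \<open>The number \<open>N\<close> itself meets the condition, so the least such number
  exists.\<close>

lemma N_r_dvd:
  assumes "0 < N" and "p \<in> {1..l}"
  shows "N dvd int (N_r N l r) * (int (r p) + 1)"
proof -
  let ?Q = "\<lambda>M. 0 < M \<and> (\<forall>i\<in>{1..l}. [int M * (int (r i) + 1) = 0] (mod N))"
  have "?Q (nat N)"
    using assms(1) by (simp add: cong_0_iff)
  then have "?Q (N_r N l r)"
    unfolding N_r_def by (rule LeastI)
  then show ?thesis
    using assms(2) by (simp add: cong_0_iff)
qed

context
  fixes A :: "zpoly set" and \<kappa> N :: int and l :: nat and r :: "nat \<Rightarrow> nat"
  assumes A: "sub_ring A" and \<kappa>: "\<kappa> \<noteq> 0"
begin

interpretation A: sub_ring A
  by (rule A)

interpretation T: sub_ring "t_polys l A"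
  by (rule sub_ring_t_polys[OF A])

lemma diff_integral_mem: "g \<in> t_polys l A \<Longrightarrow> diff_integral \<kappa> N l r g \<in> A"
  unfolding diff_integral_def by (intro A.mult_mem A.of_nat_mem poch_coeffs_mem[OF A \<kappa>])

lemma diff_integral_add:
  "g \<in> t_polys l A \<Longrightarrow> h \<in> t_polys l A \<Longrightarrow>
    diff_integral \<kappa> N l r (g + h) = diff_integral \<kappa> N l r g + diff_integral \<kappa> N l r h"
  unfolding diff_integral_def by (simp only: poch_coeffs_add[OF A \<kappa>] distrib_left)

lemma diff_integral_Const_mult:
  "g \<in> t_polys l A \<Longrightarrow> diff_integral \<kappa> N l r (Const d * g) = d * diff_integral \<kappa> N l r g"
  unfolding diff_integral_def by (simp only: poch_coeffs_Const_mult[OF A \<kappa>] mult.left_commute)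

lemma diff_integral_0: "diff_integral \<kappa> N l r 0 = 0"
  using diff_integral_Const_mult[OF T.zero_mem, of 0] by simp

lemma diff_integral_diff:
  assumes "g \<in> t_polys l A" and "h \<in> t_polys l A"
  shows "diff_integral \<kappa> N l r (g - h) = diff_integral \<kappa> N l r g - diff_integral \<kappa> N l r h"
  using diff_integral_add[OF T.diff_mem[OF assms] assms(2)] by simp

lemma diff_integral_sum:
  "(\<And>x. x \<in> X \<Longrightarrow> g x \<in> t_polys l A) \<Longrightarrow>
    diff_integral \<kappa> N l r (sum g X) = (\<Sum>x\<in>X. diff_integral \<kappa> N l r (g x))"
  by (induction X rule: infinite_finite_induct)
    (simp_all add: diff_integral_0 diff_integral_add T.sum_mem)

lemma diff_integral_subst:
  assumes "g \<in> t_polys l A" and "comm_ring_hom \<phi>"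
  shows "diff_integral \<kappa> N l r (mpoly_eval (Const \<circ> \<phi>) Var g) = \<phi> (diff_integral \<kappa> N l r g)"
  unfolding diff_integral_def poch_coeffs_subst[OF A \<kappa> assms] comm_ring_hom.hom_mult[OF assms(2)]
    comm_ring_hom.hom_of_nat[OF assms(2)] ..

lemma diff_integral_cong:
  assumes "T.cong_mod N g h"
  shows "A.cong_mod N (diff_integral \<kappa> N l r g) (diff_integral \<kappa> N l r h)"
proof -
  obtain q where gh: "g \<in> t_polys l A" "h \<in> t_polys l A"
    and q: "q \<in> t_polys l A" "g - h = Const (of_int N) * q"
    using assms by (auto simp: T.cong_mod_def)
  have "diff_integral \<kappa> N l r g - diff_integral \<kappa> N l r h = of_int N * diff_integral \<kappa> N l r q"
    by (simp only: diff_integral_diff[OF gh, symmetric] q(2) diff_integral_Const_mult[OF q(1)])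
  then show ?thesis
    unfolding A.cong_mod_def using gh q(1) by (blast intro: diff_integral_mem)
qed

text \<open>
  The shift changes the coefficient of \<open>\<Prod>\<^sub>i [t\<^sub>i]\<^bsub>r i\<^esub>\<close> by a multiple of \<open>r\<^sub>p + 1\<close>, which is killed by the
  factor \<open>N_r\<close>.
\<close>

lemma diff_integral_shift:
  assumes N: "0 < N" and g: "g \<in> t_polys l A" and p: "p \<in> {1..l}"
    and shift: "mpoly_eval Const (t_var(p := t_var p + of_int \<kappa>)) g \<in> t_polys l A"
  shows "A.cong_mod N
    (diff_integral \<kappa> N l r (mpoly_eval Const (t_var(p := t_var p + of_int \<kappa>)) g))
    (diff_integral \<kappa> N l r g)"
proof -
  let ?r = "restrict r {1..l}"
  let ?c = "poch_coeffs \<kappa> l g (?r(p := ?r p + 1))"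
  obtain d where d: "int (N_r N l r) * (int (r p) + 1) = N * d"
    using N_r_dvd[OF N p, of r] by (elim dvdE)
  have "(of_nat (N_r N l r) * of_int (\<kappa> * (int (?r p) + 1)) :: zpoly) =
      of_int (\<kappa> * (int (N_r N l r) * (int (r p) + 1)))"
    using p by simp
  also have "\<dots> = of_int N * of_int (\<kappa> * d)"
    unfolding d by (simp add: mult_ac)
  finally have "diff_integral \<kappa> N l r (mpoly_eval Const (t_var(p := t_var p + of_int \<kappa>)) g) -
      diff_integral \<kappa> N l r g = of_int N * (of_int (\<kappa> * d) * ?c)"
    unfolding diff_integral_def poch_coeffs_shift[OF A \<kappa> g p] distrib_left add_diff_cancel_left'
      mult.assoc[symmetric] by (simp only:)
  moreover have "of_int (\<kappa> * d) * ?c \<in> A"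
    by (intro A.mult_mem A.of_int_mem poch_coeffs_mem[OF A \<kappa> g])
  ultimately show ?thesis
    unfolding A.cong_mod_def using g shift by (blast intro: diff_integral_mem)
qed

end

section \<open>Coordinates\<close>

lemma sub_ring_vars: "sub_ring {c :: zpoly. vars c \<subseteq> X}"
proof
  show "of_int c \<in> {c :: zpoly. vars c \<subseteq> X}" for c
    unfolding vars_def by (auto simp: single_of_int[symmetric] simp del: single_of_int split: if_splits)
  show "p + q \<in> {c. vars c \<subseteq> X}" if "p \<in> {c. vars c \<subseteq> X}" "q \<in> {c. vars c \<subseteq> X}" for p q :: zpoly
    using that keys_add[of p q] unfolding vars_def by blast
  show "p * q \<in> {c. vars c \<subseteq> X}" if "p \<in> {c. vars c \<subseteq> X}" "q \<in> {c. vars c \<subseteq> X}" for p q :: zpoly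
  proof -
    have "Poly_Mapping.keys m \<subseteq> X" if m: "m \<in> Poly_Mapping.keys (p * q)" for m
    proof -
      obtain a b where "m = a + b" "a \<in> Poly_Mapping.keys p" "b \<in> Poly_Mapping.keys q"
        using keys_mult[of p q] m by blast
      then show ?thesis
        using keys_add[of a b] \<open>p \<in> _\<close> \<open>q \<in> _\<close> unfolding vars_def by blast
    qed
    then show ?thesis
      unfolding vars_def by blast
  qed
qed

definition word_set :: "nat \<Rightarrow> (nat \<Rightarrow> nat) \<Rightarrow> nat set" where
  "word_set n i = {j \<in> {1..n}. i j = 2}"

lemma subset_word_in_words: "subset_word n I \<in> words n"
  by (auto simp: subset_word_def words_def)

lemma eq_subset_word_iff:
  assumes "i \<in> words n" and "I \<subseteq> {1..n}"
  shows "i = subset_word n I \<longleftrightarrow> I = word_set n i"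
proof
  assume "i = subset_word n I"
  then show "I = word_set n i"
    using assms(2) by (auto simp: word_set_def subset_word_def split: if_splits)
next
  assume I: "I = word_set n i"
  show "i = subset_word n I"
  proof
    fix j
    show "i j = subset_word n I j"
    proof (cases "j \<in> {1..n}")
      case True
      then have "i j = 1 \<or> i j = 2"
        using assms(1) by (auto simp: words_def)
      then show ?thesis
        using True by (auto simp: I word_set_def subset_word_def)
    next
      case False
      then have "i j = undefined"
        using assms(1) unfolding words_def by (blast dest: PiE_arb)
      then show ?thesis
        using False by (auto simp: subset_word_def)
    qed
  qed
qed

text \<open>At most one basis vector has a nonzero coordinate at \<open>i\<close>. For a word whose
  set has the wrong size none has, and there are no bijections either, so one formula covers all
  words.\<close>

lemma U_vec_eq:
  assumes k: "0 < k" "0 < k'"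
  shows "U_vec \<kappa> k k' n l i =
    (if i \<in> words n then weight_sum \<kappa> k k' n l (word_set n i) t_var z_var else 0)"
proof (cases "i \<in> words n")
  case False
  then have "i \<noteq> subset_word n I" for I
    using subset_word_in_words by metis
  then show ?thesis
    using False by (simp add: U_vec_def basis_vec_def)
next
  case True
  let ?J = "word_set n i"
  have J: "?J \<subseteq> {1..n}"
    by (auto simp: word_set_def)
  have fin: "finite (l_subsets n l)"
    by (rule finite_subset[of _ "Pow {1..n}"]) (auto simp: l_subsets_def)
  have "U_vec \<kappa> k k' n l i = (\<Sum>I\<in>l_subsets n l. if I = ?J then U_poly \<kappa> k k' n l I else 0)"
    unfolding U_vec_def basis_vec_def
  proof (rule sum.cong[OF refl])
    fix I assume "I \<in> l_subsets n l"
    then have "i = subset_word n I \<longleftrightarrow> I = ?J"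
      using eq_subset_word_iff[OF True] by (simp add: l_subsets_def)
    then show "U_poly \<kappa> k k' n l I * (if i = subset_word n I then 1 else 0) =
        (if I = ?J then U_poly \<kappa> k k' n l I else 0)"
      by simp
  qed
  also have "\<dots> = (if ?J \<in> l_subsets n l then U_poly \<kappa> k k' n l ?J else 0)"
    using fin by (simp add: sum.delta)
  also have "\<dots> = weight_sum \<kappa> k k' n l ?J t_var z_var"
  proof (cases "card ?J = l")
    case True
    then show ?thesis
      using J U_poly_eq[OF k J True] by (simp add: l_subsets_def)
  next
    case False
    then have "bijs l ?J = {}"
      using bij_betw_same_card[of _ "{1..l}" ?J] by (fastforce simp: bijs_def)
    then show ?thesis
      using False by (simp add: l_subsets_def weight_sum_def)
  qed
  finally show ?thesis
    using True by simp
qed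

lemma wordsD:
  assumes "i \<in> words n"
  shows "j \<in> {1..n} \<Longrightarrow> i j \<in> {1, 2}" and "j \<notin> {1..n} \<Longrightarrow> i j = undefined"
  using assms unfolding words_def by (blast dest: PiE_mem PiE_arb)+

lemma comp_in_words:
  assumes i: "i \<in> words n" and \<sigma>: "\<sigma> permutes {1..n}"
  shows "i \<circ> \<sigma> \<in> words n"
  unfolding words_def
proof (rule PiE_I)
  show "(i \<circ> \<sigma>) j \<in> {1, 2}" if "j \<in> {1..n}" for j
    using wordsD(1)[OF i, of "\<sigma> j"] permutes_in_image[OF \<sigma>] that by (simp only: comp_apply)
  show "(i \<circ> \<sigma>) j = undefined" if "j \<notin> {1..n}" for j
    using wordsD(2)[OF i that] permutes_not_in[OF \<sigma> that] by (simp only: comp_apply)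
qed

lemma word_set_comp_transpose:
  assumes "a \<in> {1..n}" and "b \<in> {1..n}"
  shows "word_set n (i \<circ> transpose a b) = transpose a b ` word_set n i"
proof -
  have mem: "transpose a b j \<in> {1..n} \<longleftrightarrow> j \<in> {1..n}" for j
    using permutes_in_image[OF permutes_swap_id[OF assms]] .
  show ?thesis
  proof (intro set_eqI iffI)
    fix j assume "j \<in> word_set n (i \<circ> transpose a b)"
    then have "transpose a b j \<in> word_set n i"
      using mem[of j] by (simp add: word_set_def)
    then have "transpose a b (transpose a b j) \<in> transpose a b ` word_set n i"
      by (rule imageI)
    then show "j \<in> transpose a b ` word_set n i"
      by simp
  next
    fix j assume "j \<in> transpose a b ` word_set n i"
    then obtain u where u: "j = transpose a b u" "u \<in> word_set n i"
      by (rule imageE)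
    then show "j \<in> word_set n (i \<circ> transpose a b)"
      using mem[of u] by (simp add: word_set_def)
  qed
qed

section \<open>The cyclic permutation of the tensor factors\<close>

text \<open>The cycle (a, a + 1, ..., n), equal to the product of the transpositions (a, a + 1) up
  to (n - 1, n).\<close>

definition cycle_site :: "nat \<Rightarrow> nat \<Rightarrow> nat \<Rightarrow> nat" where
  "cycle_site a n j = (if j = n then a else if a \<le> j \<and> j < n then j + 1 else j)"

text \<open>Operators act by composing the word on the right, so the order of the factors is kept:
  P_a P_b F at \<open>i\<close> is F at i s_a s_b.\<close>

lemma foldr_P_op:
  "foldr (\<lambda>a. (\<circ>) (P_op a (a + 1))) as id F i =
    F (i \<circ> foldr (\<lambda>a. (\<circ>) (transpose a (a + 1))) as id)"
  by (induction as arbitrary: i) (simp_all add: P_op_def comp_assoc)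

lemma foldr_transpose:
  assumes "a \<le> n"
  shows "foldr (\<lambda>a. (\<circ>) (transpose a (a + 1))) [a..<n] id = cycle_site a n"
  using assms
proof (induction rule: inc_induct)
  case base
  then show ?case
    by (auto simp: cycle_site_def)
next
  case (step a)
  have "transpose a (a + 1) \<circ> cycle_site (Suc a) n = cycle_site a n"
    using step.hyps by (intro ext) (auto simp: cycle_site_def transpose_def)
  moreover have "foldr g (x # xs) y = g x (foldr g xs y)"
    for g :: "nat \<Rightarrow> (nat \<Rightarrow> nat) \<Rightarrow> nat \<Rightarrow> nat" and x xs y
    by simp
  ultimately show ?case
    unfolding upt_conv_Cons[OF step.hyps(2)] by (simp only: step.IH)
qed

lemma P_mu_eq: "1 \<le> n \<Longrightarrow> P_mu n F i = F (i \<circ> cycle_site 1 n)"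
  unfolding P_mu_def foldr_P_op by (simp only: foldr_transpose)

lemma comp_cycle_in_words:
  assumes n: "1 \<le> n" and i: "i \<in> words n"
  shows "i \<circ> cycle_site 1 n \<in> words n"
  unfolding words_def
proof (rule PiE_I)
  show "(i \<circ> cycle_site 1 n) j \<in> {1, 2}" if "j \<in> {1..n}" for j
    using wordsD(1)[OF i, of "cycle_site 1 n j"] that n by (simp add: cycle_site_def)
  show "(i \<circ> cycle_site 1 n) j = undefined" if "j \<notin> {1..n}" for j
    using wordsD(2)[OF i that] that n by (auto simp: cycle_site_def)
qed

text \<open>On {1..n} the map \<open>rotate_site n\<close> is inverse to
  \<open>cycle_site 1 n\<close>.\<close>

lemma word_set_comp_cycle:
  assumes "1 \<le> n"
  shows "word_set n (i \<circ> cycle_site 1 n) = rotate_site n ` word_set n i"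
proof (intro set_eqI iffI)
  fix j assume "j \<in> word_set n (i \<circ> cycle_site 1 n)"
  then have "cycle_site 1 n j \<in> word_set n i" "rotate_site n (cycle_site 1 n j) = j"
    using assms by (auto simp: word_set_def cycle_site_def rotate_site_def split: if_splits)
  then show "j \<in> rotate_site n ` word_set n i"
    by (metis image_eqI)
next
  fix j assume "j \<in> rotate_site n ` word_set n i"
  then obtain u where "j = rotate_site n u" "u \<in> word_set n i"
    by (rule imageE)
  then show "j \<in> word_set n (i \<circ> cycle_site 1 n)"
    using assms by (auto simp: word_set_def cycle_site_def rotate_site_def split: if_splits)
qed

section \<open>The action of h and e in coordinates\<close>

lemma act_h_mat:
  "act n h_mat F i = (\<Sum>j=1..n. h_mat (i j) (i j)) * F i"
proof -
  have "act_at h_mat j F i = h_mat (i j) (i j) * F i" for j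
  proof -
    have "h_mat (i j) q * F (i(j := q)) = (if q = i j then h_mat (i j) (i j) * F i else 0)" for q
      by (simp add: h_mat_def)
    then have "act_at h_mat j F i = (\<Sum>q\<in>{1, 2}. if q = i j then h_mat (i j) (i j) * F i else 0)"
      unfolding act_at_def by (intro sum.cong refl)
    also have "\<dots> = h_mat (i j) (i j) * F i"
      by (auto simp: h_mat_def)
    finally show ?thesis .
  qed
  then show ?thesis
    by (simp only: act_def sum_distrib_right)
qed

lemma sum_h_mat:
  assumes "i \<in> words n"
  shows "(\<Sum>j=1..n. h_mat (i j) (i j)) = (of_int (int n - 2 * int (card (word_set n i))) :: 'a::comm_ring_1)"
proof -
  have "(\<Sum>j=1..n. h_mat (i j) (i j)) = (\<Sum>j=1..n. 1 - 2 * of_bool (i j = 2) :: 'a)"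
  proof (rule sum.cong[OF refl])
    fix j assume "j \<in> {1..n}"
    then have "i j = 1 \<or> i j = 2"
      using assms by (auto simp: words_def)
    then show "h_mat (i j) (i j) = (1 - 2 * of_bool (i j = 2) :: 'a)"
      by (auto simp: h_mat_def)
  qed
  also have "\<dots> = of_nat n - 2 * (\<Sum>j=1..n. of_bool (i j = 2))"
    by (simp add: sum_subtractf sum_distrib_left)
  also have "(\<Sum>j=1..n. of_bool (i j = 2)) = (of_nat (card (word_set n i)) :: 'a)"
    by (simp add: sum_of_bool_eq word_set_def Int_def)
  finally show ?thesis
    by simp
qed

text \<open>The words that e sends to \<open>i\<close> arise from \<open>i\<close> by turning one
  letter 1 into 2.\<close>

lemma act_e_mat:
  assumes "i \<in> words n"
  shows "act n e_mat F i = (\<Sum>j\<in>{1..n} - word_set n i. F (i(j := 2)))"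
proof -
  have "act n e_mat F i = (\<Sum>j=1..n. if i j = 1 then F (i(j := 2)) else 0)"
    unfolding act_def act_at_def by (intro sum.cong refl) (simp add: e_mat_def)
  also have "\<dots> = (\<Sum>j\<in>{1..n} - word_set n i. F (i(j := 2)))"
  proof (rule sum.mono_neutral_cong_right)
    have "i j = 1 \<or> i j = 2" if "j \<in> {1..n}" for j
      using assms that by (auto simp: words_def)
    then show "(if i j = 1 then F (i(j := 2)) else 0) = F (i(j := 2))"
      if "j \<in> {1..n} - word_set n i" for j
      using that by (auto simp: word_set_def)
  qed (auto simp: word_set_def)
  finally show ?thesis .
qed

lemma upd_in_words:
  assumes i: "i \<in> words n" and j: "j \<in> {1..n}"
  shows "i(j := 2) \<in> words n"
  unfolding words_def
proof (rule PiE_I)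
  show "(i(j := 2)) u \<in> {1, 2}" if "u \<in> {1..n}" for u
    using wordsD(1)[OF i that] by simp
  show "(i(j := 2)) u = undefined" if "u \<notin> {1..n}" for u
    using wordsD(2)[OF i that] j that by auto
qed

lemma word_set_upd: "j \<in> {1..n} \<Longrightarrow> word_set n (i(j := 2)) = insert j (word_set n i)"
  by (auto simp: word_set_def)

lemma lookup_cong_mod:
  assumes "sub_ring A" and "sub_ring.cong_mod A N p q"
  shows "[Poly_Mapping.lookup p m = Poly_Mapping.lookup (q :: zpoly) m] (mod N)"
proof -
  obtain d where "p - q = of_int N * d"
    using assms(2) unfolding sub_ring.cong_mod_def[OF assms(1)] by blast
  then have "Poly_Mapping.lookup p m - Poly_Mapping.lookup q m = N * Poly_Mapping.lookup d m"
    by (metis lookup_minus lookup_of_int_mult of_int_eq_id id_apply)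
  then show ?thesis
    by (simp add: cong_iff_dvd_diff)
qed

section \<open>The qKZ equations and the singular vector property modulo \<open>N\<close>\<close>

context
  fixes \<kappa> N :: int and k k' n l :: nat and r :: "nat \<Rightarrow> nat" and A :: "zpoly set" and F
  assumes \<kappa>: "0 < \<kappa>" and N: "0 < N"
    and k: "0 < k" "[\<kappa> * int k = - 1] (mod N)" and k': "0 < k'" "[\<kappa> * int k' = 2] (mod N)"
  defines "A \<equiv> {c. vars c \<subseteq> {1..n}}"
    and "F \<equiv> \<lambda>I. diff_integral \<kappa> N l r (weight_sum \<kappa> k k' n l I t_var z_var)"
begin

interpretation A: sub_ring A
  unfolding A_def by (rule sub_ring_vars)

interpretation T: sub_ring "t_polys l A"
  by (rule sub_ring_t_polys) (rule A.sub_ring_axioms)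

lemma \<kappa>_neq_0: "\<kappa> \<noteq> 0"
  using \<kappa> by simp

lemmas di_mem = diff_integral_mem[OF A.sub_ring_axioms \<kappa>_neq_0]
lemmas di_Const_mult = diff_integral_Const_mult[OF A.sub_ring_axioms \<kappa>_neq_0]
lemmas di_sum = diff_integral_sum[OF A.sub_ring_axioms \<kappa>_neq_0]
lemmas di_diff = diff_integral_diff[OF A.sub_ring_axioms \<kappa>_neq_0]
lemmas di_subst = diff_integral_subst[OF A.sub_ring_axioms \<kappa>_neq_0]
lemmas di_cong = diff_integral_cong[OF A.sub_ring_axioms \<kappa>_neq_0]

lemma z_var_mem: "a \<in> {1..n} \<Longrightarrow> z_var a \<in> t_polys l A"
  by (rule t_polys.Const) (simp add: A_def vars_def Var_def)

lemma t_var_mem: "i \<in> {1..l} \<Longrightarrow> t_var i \<in> t_polys l A"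
  by (rule t_polys.Var)

lemma F_mem: "F I \<in> A"
  unfolding F_def by (intro di_mem T.weight_sum_mem t_var_mem z_var_mem)

lemma subst_F:
  fixes \<rho> :: "nat \<Rightarrow> zpoly"
  shows "mpoly_subst \<rho> (F I) = diff_integral \<kappa> N l r (weight_sum \<kappa> k k' n l I t_var (\<lambda>a. Const (\<rho> a)))"
proof -
  let ?\<phi> = "mpoly_subst \<rho> :: zpoly \<Rightarrow> zpoly"
  let ?H = "mpoly_eval (Const \<circ> ?\<phi>) Var :: tzpoly \<Rightarrow> tzpoly"
  have \<phi>: "comm_ring_hom ?\<phi>"
    by (rule comm_ring_hom_mpoly_subst)
  have c: "comm_ring_hom (Const \<circ> ?\<phi>)"
    by (intro comm_ring_hom_comp comm_ring_hom_Const \<phi>)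
  have "?H (weight_sum \<kappa> k k' n l I t_var z_var) =
      weight_sum \<kappa> k k' n l I (\<lambda>i. ?H (t_var i)) (\<lambda>a. ?H (z_var a))"
    by (rule hom_weight_sum[OF comm_ring_hom_mpoly_eval[OF c]])
  also have "\<dots> = weight_sum \<kappa> k k' n l I t_var (\<lambda>a. Const (\<rho> a))"
    unfolding mpoly_eval_Var[OF c] mpoly_eval_Const[OF c] comp_apply mpoly_subst_Var ..
  finally have "?H (weight_sum \<kappa> k k' n l I t_var z_var) = \<dots>" .
  moreover have "weight_sum \<kappa> k k' n l I t_var z_var \<in> t_polys l A"
    by (intro T.weight_sum_mem t_var_mem z_var_mem)
  ultimately show ?thesis
    unfolding F_def using di_subst[OF _ \<phi>] by metis
qed

text \<open>The relation for the reduced sums, multiplied by the common factor, makes the integrands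
  congruent. The coefficients in z_a - z_(a+1) are constants for the integral.\<close>

lemma exchange_F:
  assumes a: "1 \<le> a" "a < n"
  defines "s \<equiv> transpose a (a + 1)"
  shows "A.cong_mod N ((Var a - Var (a + 1) - 1) * mpoly_subst (\<lambda>b. Var (s b)) (F I))
    ((Var a - Var (a + 1)) * F (s ` I) - F I)"
proof -
  let ?u = "Var a - Var (a + 1) :: zpoly"
  let ?W = "\<lambda>I. weight_sum \<kappa> k k' n l I t_var z_var"
  let ?W' = "weight_sum \<kappa> k k' n l I t_var (z_var \<circ> s)"
  let ?C = "common_factor \<kappa> k k' n l t_var z_var"
  have s_mem: "s b \<in> {1..n}" if "b \<in> {1..n}" for b
    using permutes_in_image[OF permutes_swap_id[of a "{1..n}" "a + 1"]] a that unfolding s_def by simp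
  have W: "?W J \<in> t_polys l A" for J
    by (intro T.weight_sum_mem t_var_mem z_var_mem)
  have z': "(z_var \<circ> s) b \<in> t_polys l A" if "b \<in> {1..n}" for b
    using z_var_mem[OF s_mem[OF that]] by simp
  have W': "?W' \<in> t_polys l A"
    by (intro T.weight_sum_mem t_var_mem z')
  have u: "Const ?u = z_var a - z_var (a + 1)" "Const (?u - 1) = z_var a - z_var (a + 1) - 1"
    by (simp_all add: Const_diff)
  have u_mem: "z_var a - z_var (a + 1) \<in> t_polys l A"
    using a by (intro T.diff_mem z_var_mem) auto
  have "T.cong_mod N (Const (?u - 1) * ?W')
      (Const (?u - 1) * (common_factor \<kappa> k k' n l t_var (z_var \<circ> s) * red_sum n l I t_var (z_var \<circ> s)))"
    unfolding u
    by (intro T.cong_mod_mult T.cong_mod_refl T.diff_mem u_mem T.one_mem T.cong_mod_weight_sum k k' t_var_mem z')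
  also have "Const (?u - 1) * (common_factor \<kappa> k k' n l t_var (z_var \<circ> s) * red_sum n l I t_var (z_var \<circ> s)) =
      Const ?u * (?C * red_sum n l (s ` I) t_var z_var) - ?C * red_sum n l I t_var z_var"
    unfolding s_def common_factor_swap[OF a] u mult.left_commute[of _ ?C]
      red_sum_swap[OF a, of z_var l I t_var] by (simp only: right_diff_distrib)
  finally have 1: "T.cong_mod N (Const (?u - 1) * ?W')
      (Const ?u * (?C * red_sum n l (s ` I) t_var z_var) - ?C * red_sum n l I t_var z_var)" .
  have 2: "T.cong_mod N (Const ?u * ?W (s ` I) - ?W I)
      (Const ?u * (?C * red_sum n l (s ` I) t_var z_var) - ?C * red_sum n l I t_var z_var)"
    unfolding u
    by (intro T.cong_mod_mult T.cong_mod_diff T.cong_mod_refl u_mem T.cong_mod_weight_sum k k' t_var_mem z_var_mem)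
  have "A.cong_mod N (diff_integral \<kappa> N l r (Const (?u - 1) * ?W'))
      (diff_integral \<kappa> N l r (Const ?u * ?W (s ` I) - ?W I))"
    by (rule di_cong) (rule T.cong_mod_trans[OF 1 T.cong_mod_sym[OF 2]])
  moreover have "Const ?u * ?W (s ` I) \<in> t_polys l A"
    unfolding u by (intro T.mult_mem u_mem W)
  moreover have "mpoly_subst (\<lambda>b. Var (s b)) (F I) = diff_integral \<kappa> N l r ?W'"
    by (simp only: subst_F comp_def)
  ultimately show ?thesis
    by (simp only: di_Const_mult[OF W'] di_Const_mult[OF W] di_diff[OF _ W] F_def)
qed

text \<open>Arbitrary z-polynomials \<zeta> are allowed, since the shift is applied both to the
  original and to the rotated parameters.\<close>

lemma congr_shift:
  assumes p: "p \<in> {1..l}" and z: "\<And>a. a \<in> {1..n} \<Longrightarrow> Const (\<zeta> a) \<in> t_polys l A"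
  shows "A.cong_mod N
    (diff_integral \<kappa> N l r (weight_term \<kappa> k k' n l c (t_var(p := t_var p + of_int \<kappa>)) (\<lambda>a. Const (\<zeta> a))))
    (diff_integral \<kappa> N l r (weight_term \<kappa> k k' n l c t_var (\<lambda>a. Const (\<zeta> a))))"
proof -
  let ?H = "mpoly_eval Const (t_var(p := t_var p + of_int \<kappa>)) :: tzpoly \<Rightarrow> tzpoly"
  have H: "?H (weight_term \<kappa> k k' n l c t_var (\<lambda>a. Const (\<zeta> a))) =
      weight_term \<kappa> k k' n l c (t_var(p := t_var p + of_int \<kappa>)) (\<lambda>a. Const (\<zeta> a))"
    unfolding hom_weight_term[OF comm_ring_hom_mpoly_eval[OF comm_ring_hom_Const]]
      mpoly_eval_Var[OF comm_ring_hom_Const] mpoly_eval_Const[OF comm_ring_hom_Const] ..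
  have t': "(t_var(p := t_var p + of_int \<kappa>)) i \<in> t_polys l A" if "i \<in> {1..l}" for i
    using t_var_mem[OF that] t_var_mem[OF p] by (auto intro: T.add_mem)
  show ?thesis
    unfolding H[symmetric]
  proof (rule diff_integral_shift[OF A.sub_ring_axioms \<kappa>_neq_0 N _ p])
    show "weight_term \<kappa> k k' n l c t_var (\<lambda>a. Const (\<zeta> a)) \<in> t_polys l A"
      by (intro T.weight_term_mem t_var_mem z)
    show "?H (weight_term \<kappa> k k' n l c t_var (\<lambda>a. Const (\<zeta> a))) \<in> t_polys l A"
      unfolding H by (intro T.weight_term_mem t' z)
  qed
qed

text \<open>Before integration corresponding terms are equal up to a shift of the variable at site
  1, and that variable depends on the bijection; so the integral is taken term by term.\<close>

lemma rotate_F: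
  assumes n: "1 \<le> n" and I: "I \<subseteq> {1..n}"
  shows "A.cong_mod N (mpoly_subst (\<lambda>b. if b = 1 then Var 1 - of_int \<kappa> else Var b) (F I))
    (mpoly_subst (\<lambda>b. if b < n then Var (b + 1) else Var 1) (F (rotate_site n ` I)))"
proof -
  let ?z = "z_var(1 := z_var 1 - of_int \<kappa>)"
  define z' where "z' = (\<lambda>a. if a < n then z_var (a + 1) else z_var 1)"
  have z: "?z a \<in> t_polys l A" if "a \<in> {1..n}" for a
    using z_var_mem[OF that] z_var_mem[of 1] n by (auto intro: T.diff_mem)
  have z'_mem: "z' a \<in> t_polys l A" if "a \<in> {1..n}" for a
    using that z_var_mem by (auto simp: z'_def)
  have z'_Const: "z' = (\<lambda>a. Const (if a < n then Var (a + 1) else Var 1))"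
    by (auto simp: z'_def)
  have z_Const: "?z = (\<lambda>a. Const (if a = 1 then Var 1 - of_int \<kappa> else Var a))"
    by (auto simp: Const_diff)
  have inj: "inj_on (rotate_site n) I"
    using I n by (intro inj_on_subset[OF _ I] inj_onI) (auto simp: rotate_site_def split: if_splits)
  have "weight_sum \<kappa> k k' n l (rotate_site n ` I) t_var z' =
      (\<Sum>b\<in>bijs l I. weight_term \<kappa> k k' n l (\<lambda>i. 2 * rotate_site n (b i)) t_var z')"
    unfolding weight_sum_def by (subst sum_bijs_image[OF inj]) (auto intro: weight_term_cong)
  then have R: "diff_integral \<kappa> N l r (weight_sum \<kappa> k k' n l (rotate_site n ` I) t_var z') =
      (\<Sum>b\<in>bijs l I. diff_integral \<kappa> N l r (weight_term \<kappa> k k' n l (\<lambda>i. 2 * rotate_site n (b i)) t_var z'))"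
    by (simp only:) (intro di_sum T.weight_term_mem t_var_mem z'_mem)
  have L: "diff_integral \<kappa> N l r (weight_sum \<kappa> k k' n l I t_var ?z) =
      (\<Sum>b\<in>bijs l I. diff_integral \<kappa> N l r (weight_term \<kappa> k k' n l (\<lambda>i. 2 * b i) t_var ?z))"
    unfolding weight_sum_def by (intro di_sum T.weight_term_mem t_var_mem z)
  have "A.cong_mod N (diff_integral \<kappa> N l r (weight_term \<kappa> k k' n l (\<lambda>i. 2 * b i) t_var ?z))
      (diff_integral \<kappa> N l r (weight_term \<kappa> k k' n l (\<lambda>i. 2 * rotate_site n (b i)) t_var z'))"
    if b: "b \<in> bijs l I" for b
  proof (cases "1 \<in> I")
    case True
    then obtain p where p: "p \<in> {1..l}" "b p = 1"
      using bijsD(3)[OF b] by blast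
    have eq: "weight_term \<kappa> k k' n l (\<lambda>i. 2 * b i) t_var ?z =
        weight_term \<kappa> k k' n l (\<lambda>i. 2 * rotate_site n (b i)) (t_var(p := t_var p + of_int \<kappa>)) z'"
      unfolding z'_def by (rule weight_term_rotate(2)[OF n b I p])
    show ?thesis
      unfolding eq unfolding z'_Const
      by (rule congr_shift[OF p(1)]) (use z'_mem in \<open>simp only: z'_Const\<close>)
  next
    case False
    have eq: "weight_term \<kappa> k k' n l (\<lambda>i. 2 * b i) t_var ?z =
        weight_term \<kappa> k k' n l (\<lambda>i. 2 * rotate_site n (b i)) t_var z'"
      unfolding z'_def by (rule weight_term_rotate(1)[OF n b I False])
    show ?thesis
      unfolding eq
      by (intro A.cong_mod_refl di_mem T.weight_term_mem t_var_mem z'_mem)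
  qed
  then have "A.cong_mod N (diff_integral \<kappa> N l r (weight_sum \<kappa> k k' n l I t_var ?z))
      (diff_integral \<kappa> N l r (weight_sum \<kappa> k k' n l (rotate_site n ` I) t_var z'))"
    unfolding L R by (rule A.cong_mod_sum)
  then show ?thesis
    unfolding subst_F z_Const z'_Const .
qed

lemma sum_insert_F:
  assumes J: "J \<subseteq> {1..n}"
  shows "A.cong_mod N (\<Sum>a\<in>{1..n} - J. F (insert a J)) 0"
proof -
  let ?W = "\<lambda>I. weight_sum \<kappa> k k' n l I t_var z_var"
  let ?C = "common_factor \<kappa> k k' n l t_var z_var"
  let ?B = "bijs l (insert 0 J)"
  let ?T = "\<lambda>h b. weight_term \<kappa> k k' n l (\<lambda>i. free_pos h (b i)) t_var z_var"
  let ?R = "\<lambda>h b. red_term n l (\<lambda>i. free_pos h (b i)) t_var z_var"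
  have T_mem: "?T h b \<in> t_polys l A" for h b
    by (intro T.weight_term_mem t_var_mem z_var_mem)
  have "T.cong_mod N (\<Sum>a\<in>{1..n} - J. ?W (insert a J)) (\<Sum>a\<in>{1..n} - J. ?C * red_sum n l (insert a J) t_var z_var)"
    by (intro T.cong_mod_sum T.cong_mod_weight_sum k k' t_var_mem z_var_mem)
  also have "(\<Sum>a\<in>{1..n} - J. ?C * red_sum n l (insert a J) t_var z_var) =
      (\<Sum>b\<in>?B. ?C * ?R (2 * n + 1) b - ?C * ?R 1 b)"
    unfolding sum_distrib_left[symmetric] sum_red_sum_insert[OF J] right_diff_distrib[symmetric] ..
  finally have 1: "T.cong_mod N (\<Sum>a\<in>{1..n} - J. ?W (insert a J)) (\<Sum>b\<in>?B. ?C * ?R (2 * n + 1) b - ?C * ?R 1 b)" .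
  \<comment> \<open>The way back from reduced to full terms, because the shift by \<kappa> relates
    the two extreme positions only for the latter.\<close>
  have 2: "T.cong_mod N (\<Sum>b\<in>?B. ?T (2 * n + 1) b - ?T 1 b) (\<Sum>b\<in>?B. ?C * ?R (2 * n + 1) b - ?C * ?R 1 b)"
    by (intro T.cong_mod_sum T.cong_mod_diff T.cong_mod_weight_term k k' t_var_mem z_var_mem)
  have "A.cong_mod N (diff_integral \<kappa> N l r (\<Sum>a\<in>{1..n} - J. ?W (insert a J)))
      (diff_integral \<kappa> N l r (\<Sum>b\<in>?B. ?T (2 * n + 1) b - ?T 1 b))"
    by (rule di_cong) (rule T.cong_mod_trans[OF 1 T.cong_mod_sym[OF 2]])
  moreover have "diff_integral \<kappa> N l r (\<Sum>a\<in>{1..n} - J. ?W (insert a J)) = (\<Sum>a\<in>{1..n} - J. F (insert a J))"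
    unfolding F_def by (intro di_sum T.weight_sum_mem t_var_mem z_var_mem)
  moreover have "diff_integral \<kappa> N l r (\<Sum>b\<in>?B. ?T (2 * n + 1) b - ?T 1 b) =
      (\<Sum>b\<in>?B. diff_integral \<kappa> N l r (?T (2 * n + 1) b) - diff_integral \<kappa> N l r (?T 1 b))"
    by (subst di_sum) (simp_all only: T.diff_mem T_mem di_diff)
  moreover have "A.cong_mod N (\<Sum>b\<in>?B. diff_integral \<kappa> N l r (?T (2 * n + 1) b) - diff_integral \<kappa> N l r (?T 1 b))
      (\<Sum>b\<in>?B. 0)"
  proof (rule A.cong_mod_sum)
    fix b assume b: "b \<in> ?B"
    obtain p where p: "p \<in> {1..l}" "b p = 0"
      using bijsD(3)[OF b, of 0] by blast
    have "A.cong_mod N (diff_integral \<kappa> N l r (?T 1 b)) (diff_integral \<kappa> N l r (?T (2 * n + 1) b))"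
      unfolding weight_term_free_shift[OF b J p] by (rule congr_shift[OF p(1) z_var_mem])
    from A.cong_mod_diff[OF A.cong_mod_refl A.cong_mod_sym[OF this]]
    have "A.cong_mod N (diff_integral \<kappa> N l r (?T 1 b) - diff_integral \<kappa> N l r (?T (2 * n + 1) b))
        (diff_integral \<kappa> N l r (?T 1 b) - diff_integral \<kappa> N l r (?T 1 b))"
      by (simp only: di_mem T_mem)
    from A.cong_mod_diff[OF A.cong_mod_refl[OF A.zero_mem] this]
    show "A.cong_mod N (diff_integral \<kappa> N l r (?T (2 * n + 1) b) - diff_integral \<kappa> N l r (?T 1 b)) 0"
      by simp
  qed
  ultimately show ?thesis
    by (simp only: sum.neutral_const) (rule A.cong_mod_trans)
qed

lemma f_sol_eq: "f_sol \<kappa> N k k' n l r i = (if i \<in> words n then F (word_set n i) else 0)"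
  unfolding f_sol_def U_vec_eq[OF k(1) k'(1)] F_def
  using diff_integral_0[OF A.sub_ring_axioms \<kappa>_neq_0] by simp

lemma F_eq_0:
  assumes "card I \<noteq> l"
  shows "F I = 0"
proof -
  have "bijs l I = {}"
    using assms bij_betw_same_card[of _ "{1..l}" I] by (fastforce simp: bijs_def)
  then show ?thesis
    by (simp add: F_def weight_sum_def diff_integral_0[OF A.sub_ring_axioms \<kappa>_neq_0])
qed

lemma f_sol_qKZ:
  assumes n: "1 < n"
  defines "f \<equiv> f_sol \<kappa> N k k' n l r"
  shows "f \<in> weight_space n (int n - 2 * int l)"
    and "vars (f i) \<subseteq> {1..n}"
    and "a \<in> {1..n - 1} \<Longrightarrow> tensor_cong n N
      (\<lambda>i. (Var a - Var (a + 1) - 1) * tensor_subst (\<lambda>b. Var (transpose a (a + 1) b)) f i)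
      (P_op a (a + 1) (R_num a (a + 1) (Var a - Var (a + 1)) f))"
    and "tensor_cong n N
      (tensor_subst (\<lambda>b. if b = 1 then Var 1 - of_int \<kappa> else Var b) f)
      (P_mu n (tensor_subst (\<lambda>b. if b < n then Var (b + 1) else Var 1) f))"
    and "tensor_cong n N (act n e_mat f) (\<lambda>i. 0)"
proof -
  have f: "f i = (if i \<in> words n then F (word_set n i) else 0)" for i
    by (simp add: f_def f_sol_eq)
  have word_set: "word_set n i \<subseteq> {1..n}" for i
    by (auto simp: word_set_def)
  note lookup = lookup_cong_mod[OF A.sub_ring_axioms]
  show "f \<in> weight_space n (int n - 2 * int l)"
  proof -
    \<comment> \<open>The eigenvalue at a word depends only on the size of its set, and the
      coordinates of \<open>f\<close> at sizes other than \<open>l\<close> vanish.\<close>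
    have "(\<Sum>j=1..n. h_mat (i j) (i j)) * f i = of_int (int n - 2 * int l) * f i" for i
    proof (cases "i \<in> words n \<and> card (word_set n i) = l")
      case True
      then show ?thesis
        by (simp only: sum_h_mat)
    next
      case False
      then have "f i = 0"
        using F_eq_0 by (auto simp: f)
      then show ?thesis
        by simp
    qed
    then have "act n h_mat f = (\<lambda>i. of_int (int n - 2 * int l) * f i)"
      unfolding fun_eq_iff act_h_mat by blast
    then show ?thesis
      by (simp add: weight_space_def tensor_power_def f)
  qed
  show "vars (f i) \<subseteq> {1..n}"
    using F_mem[of "word_set n i"] A.zero_mem by (simp add: f A_def)
  show "tensor_cong n N
      (\<lambda>i. (Var a - Var (a + 1) - 1) * tensor_subst (\<lambda>b. Var (transpose a (a + 1) b)) f i)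
      (P_op a (a + 1) (R_num a (a + 1) (Var a - Var (a + 1)) f))" if a: "a \<in> {1..n - 1}"
    unfolding tensor_cong_def
  proof (intro ballI allI)
    fix i m assume i: "i \<in> words n"
    let ?s = "transpose a (a + 1)"
    have a': "a \<in> {1..n}" "a + 1 \<in> {1..n}" "1 \<le> a" "a < n"
      using a by auto
    have s: "i \<circ> ?s \<in> words n"
      by (intro comp_in_words i permutes_swap_id a')
    \<comment> \<open>The outer permutation evaluates \<open>R_num\<close> at i s, where the
      permutation inside \<open>R_num\<close> leads back to \<open>i\<close>.\<close>
    have "i \<circ> ?s \<circ> ?s = i"
      by (simp add: fun_eq_iff)
    moreover have "?s ` ?s ` X = X" for X
      by (simp add: image_image)
    ultimately have "P_op a (a + 1) (R_num a (a + 1) (Var a - Var (a + 1)) f) i =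
        (Var a - Var (a + 1)) * F (?s ` word_set n i) - F (word_set n i)"
      using i s by (simp only: P_op_def R_num_def f if_True word_set_comp_transpose[OF a'(1,2)])
    moreover have "tensor_subst (\<lambda>b. Var (?s b)) f i = mpoly_subst (\<lambda>b. Var (?s b)) (F (word_set n i))"
      using i by (simp only: tensor_subst_def f if_True)
    ultimately show "[Poly_Mapping.lookup ((Var a - Var (a + 1) - 1) * tensor_subst (\<lambda>b. Var (?s b)) f i) m =
        Poly_Mapping.lookup (P_op a (a + 1) (R_num a (a + 1) (Var a - Var (a + 1)) f) i) m] (mod N)"
      using lookup[OF exchange_F[OF a'(3,4), of "word_set n i"], of m] by (simp only:)
  qed
  show "tensor_cong n N
      (tensor_subst (\<lambda>b. if b = 1 then Var 1 - of_int \<kappa> else Var b) f)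
      (P_mu n (tensor_subst (\<lambda>b. if b < n then Var (b + 1) else Var 1) f))"
    unfolding tensor_cong_def
  proof (intro ballI allI)
    fix i m assume i: "i \<in> words n"
    have n1: "1 \<le> n"
      using n by simp
    show "[Poly_Mapping.lookup (tensor_subst (\<lambda>b. if b = 1 then Var 1 - of_int \<kappa> else Var b) f i) m =
        Poly_Mapping.lookup (P_mu n (tensor_subst (\<lambda>b. if b < n then Var (b + 1) else Var 1) f) i) m] (mod N)"
      using lookup[OF rotate_F[OF n1 word_set], of i m] i comp_cycle_in_words[OF n1 i]
      by (simp only: P_mu_eq[OF n1] tensor_subst_def f if_True word_set_comp_cycle[OF n1])
  qed
  show "tensor_cong n N (act n e_mat f) (\<lambda>i. 0)"
    unfolding tensor_cong_def
  proof (intro ballI allI)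
    fix i m assume i: "i \<in> words n"
    have "act n e_mat f i = (\<Sum>j\<in>{1..n} - word_set n i. F (insert j (word_set n i)))"
      unfolding act_e_mat[OF i]
      by (intro sum.cong refl) (simp add: f upd_in_words[OF i] word_set_upd)
    then show "[Poly_Mapping.lookup (act n e_mat f i) m = Poly_Mapping.lookup 0 m] (mod N)"
      using lookup[OF sum_insert_F[OF word_set], of i m] by (simp only:)
  qed
qed

end

theorem theorem5p1:
  fixes \<kappa> N :: int and k k' n l :: nat and r :: "nat \<Rightarrow> nat" and f :: "zpoly tensor"
  assumes "coprime \<kappa> N" and "0 < \<kappa>" and "\<kappa> < N"
    and "0 < k" and "int k < N" and "0 < k'" and "int k' < N"
    and "[\<kappa> * int k = - 1] (mod N)" and "[\<kappa> * int k' = 2] (mod N)"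
    and "n > 1" and "1 \<le> l" and "l \<le> n"
    and f: "f = f_sol \<kappa> N k k' n l r"
  shows "f \<in> weight_space n (int n - 2 * int l) \<and>
    (\<forall>i. vars (f i) \<subseteq> {1..n}) \<and>
    (\<forall>a\<in>{1..n - 1}. tensor_cong n N
      (\<lambda>i. (Var a - Var (a + 1) - 1) * tensor_subst (\<lambda>b. Var (transpose a (a + 1) b)) f i)
      (P_op a (a + 1) (R_num a (a + 1) (Var a - Var (a + 1)) f))) \<and>
    tensor_cong n N
      (tensor_subst (\<lambda>b. if b = 1 then Var 1 - of_int \<kappa> else Var b) f)
      (P_mu n (tensor_subst (\<lambda>b. if b < n then Var (b + 1) else Var 1) f)) \<and>
    tensor_cong n N (act n e_mat f) (\<lambda>i. 0)"
proof -
  have N: "0 < N"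
    using assms(2,3) by linarith
  note qKZ = f_sol_qKZ[OF assms(2) N assms(4,8,6,9,10), where l = l and r = r, folded f]
  show ?thesis
    using qKZ by blast
qed

end
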